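(* Let $L>0$ and let $\mathcal{A}$ be the set of admissible framed curves defined in the context. For any $(y,b)\in\mathcal{A}$ and any $\epsilon>0$ there exists $(y_\epsilon,b_\epsilon)\in\mathcal{A}\cap\big(C^\infty([0,L];\mathbb{R}^3)\times C^\infty([0,L];\mathbb{R}^3)\big)$ with $$\|y_\epsilon-y\|_{H^2}\le\epsilon\qquad\text{and}\qquad\|b_\epsilon-b\|_{H^1}\le\epsilon.$$
   Context: $L_{\rm bc}^{\rm rod}:H^2((0,L);\mathbb{R}^3)\times H^1((0,L);\mathbb{R}^3)\to Y$ is a linear map into a finite-dimensional linear space $Y$ that only involves linear combinations of the boundary values $y(0),y(L),y'(0),y'(L),b(0),b(L)$, and $\ell_{\rm bc}^{\rm rod}\in Y$ is given boundary data. The set of admissible framed curves is $$\mathcal{A}=\{(y,b)\in H^2((0,L);\mathbb{R}^3)\times H^1((0,L);\mathbb{R}^3):\ L_{\rm bc}^{\rm rod}[y,b]=\ell_{\rm bc}^{\rm rod},\ |y'|=|b|=1,\ y'\cdot b=0\text{ on }[0,L]\}.$$ $\mathcal{A}$ is assumed to be nonempty. *)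

theory Defs
  imports "HOL-Analysis.Analysis"
begin

text \<open>
  Derivatives are taken within S, so they are one-sided at the end points of a compact interval:
  \<open>smooth_on {a..b}\<close> is \<open>C\<^sup>\<infinity>([a,b])\<close>, smooth up to the boundary.
\<close>

definition smooth_on :: "real set \<Rightarrow> (real \<Rightarrow> 'a::real_normed_vector) \<Rightarrow> bool" where
  "smooth_on S f \<longleftrightarrow> (\<exists>D :: nat \<Rightarrow> real \<Rightarrow> 'a. (\<forall>x\<in>S. D 0 x = f x) \<and>
     (\<forall>n. \<forall>x\<in>S. (D n has_vector_derivative D (Suc n) x) (at x within S)))"

definition test_function :: "real \<Rightarrow> real \<Rightarrow> (real \<Rightarrow> real) \<Rightarrow> bool" where
  "test_function a b \<phi> \<longleftrightarrow> smooth_on UNIV \<phi> \<and>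
     compact (closure {x. \<phi> x \<noteq> 0}) \<and> closure {x. \<phi> x \<noteq> 0} \<subseteq> {a<..<b}"

definition locally_integrable :: "real \<Rightarrow> real \<Rightarrow> (real \<Rightarrow> 'a::euclidean_space) \<Rightarrow> bool" where
  "locally_integrable a b u \<longleftrightarrow>
     (\<forall>K. compact K \<and> K \<subseteq> {a<..<b} \<longrightarrow> set_integrable lebesgue K u)"

definition has_weak_derivative ::
    "real \<Rightarrow> real \<Rightarrow> (real \<Rightarrow> 'a::euclidean_space) \<Rightarrow> (real \<Rightarrow> 'a) \<Rightarrow> bool" where
  "has_weak_derivative a b u v \<longleftrightarrow> locally_integrable a b u \<and> locally_integrable a b v \<and>
     (\<forall>\<phi>. test_function a b \<phi> \<longrightarrow>
        integral\<^sup>L (lebesgue_on {a<..<b}) (\<lambda>x. deriv \<phi> x *\<^sub>R u x) =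
        - integral\<^sup>L (lebesgue_on {a<..<b}) (\<lambda>x. \<phi> x *\<^sub>R v x))"

definition in_L2 :: "real \<Rightarrow> real \<Rightarrow> (real \<Rightarrow> 'a::euclidean_space) \<Rightarrow> bool" where
  "in_L2 a b u \<longleftrightarrow> u \<in> borel_measurable (lebesgue_on {a<..<b}) \<and>
     integrable (lebesgue_on {a<..<b}) (\<lambda>x. (norm (u x))\<^sup>2)"

text \<open>
  Elements of Sobolev spaces are represented by arbitrary functions on the reals, of which only the
  a.e. behaviour on the open interval matters. The weak derivative is determined up to a null set,
  hence a choice; all notions below are insensitive to it.
\<close>

definition weak_deriv ::
    "real \<Rightarrow> real \<Rightarrow> (real \<Rightarrow> 'a::euclidean_space) \<Rightarrow> real \<Rightarrow> 'a" where
  "weak_deriv a b u = (SOME v. has_weak_derivative a b u v)"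

definition in_H1 :: "real \<Rightarrow> real \<Rightarrow> (real \<Rightarrow> 'a::euclidean_space) \<Rightarrow> bool" where
  "in_H1 a b u \<longleftrightarrow> in_L2 a b u \<and> (\<exists>v. has_weak_derivative a b u v \<and> in_L2 a b v)"

definition in_H2 :: "real \<Rightarrow> real \<Rightarrow> (real \<Rightarrow> 'a::euclidean_space) \<Rightarrow> bool" where
  "in_H2 a b u \<longleftrightarrow> in_L2 a b u \<and>
     (\<exists>v w. has_weak_derivative a b u v \<and> in_L2 a b v \<and> has_weak_derivative a b v w \<and> in_L2 a b w)"

definition H1_norm :: "real \<Rightarrow> real \<Rightarrow> (real \<Rightarrow> 'a::euclidean_space) \<Rightarrow> real" where
  "H1_norm a b u = sqrt (integral\<^sup>L (lebesgue_on {a<..<b}) (\<lambda>x. (norm (u x))\<^sup>2)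
     + integral\<^sup>L (lebesgue_on {a<..<b}) (\<lambda>x. (norm (weak_deriv a b u x))\<^sup>2))"

definition H2_norm :: "real \<Rightarrow> real \<Rightarrow> (real \<Rightarrow> 'a::euclidean_space) \<Rightarrow> real" where
  "H2_norm a b u = sqrt (integral\<^sup>L (lebesgue_on {a<..<b}) (\<lambda>x. (norm (u x))\<^sup>2)
     + integral\<^sup>L (lebesgue_on {a<..<b}) (\<lambda>x. (norm (weak_deriv a b u x))\<^sup>2)
     + integral\<^sup>L (lebesgue_on {a<..<b}) (\<lambda>x. (norm (weak_deriv a b (weak_deriv a b u) x))\<^sup>2))"

text \<open>
  The continuous representative on the closed interval, which exists for every \<open>H\<^sup>1\<close> function and is
  unique on \<open>[a,b]\<close> when \<open>a < b\<close>. Pointwise and boundary values refer to it.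
\<close>

definition cont_rep ::
    "real \<Rightarrow> real \<Rightarrow> (real \<Rightarrow> 'a::euclidean_space) \<Rightarrow> real \<Rightarrow> 'a" where
  "cont_rep a b u =
     (SOME g. continuous_on {a..b} g \<and> (AE x in lebesgue_on {a<..<b}. g x = u x))"

text \<open>
  A boundary operator is a linear map on \<open>H\<^sup>2 \<times> H\<^sup>1\<close> that factors through the boundary values
  \<open>y(0), y(L), y'(0), y'(L), b(0), b(L)\<close>. Linearity of the operator is inherited from that of
  \<open>\<Lambda>\<close>, since these values depend linearly on \<open>(y, b)\<close>.
\<close>

definition boundary_operator ::
    "real \<Rightarrow> ((real \<Rightarrow> real^3) \<Rightarrow> (real \<Rightarrow> real^3) \<Rightarrow> 'v::real_vector) \<Rightarrow> bool" where
  "boundary_operator L Lbc \<longleftrightarrow>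
     (\<exists>\<Lambda> :: (real^3) \<times> (real^3) \<times> (real^3) \<times> (real^3) \<times> (real^3) \<times> (real^3) \<Rightarrow> 'v.
        linear \<Lambda> \<and>
        (\<forall>y b. in_H2 0 L y \<and> in_H1 0 L b \<longrightarrow>
           Lbc y b = \<Lambda> (cont_rep 0 L y 0, cont_rep 0 L y L,
                         cont_rep 0 L (weak_deriv 0 L y) 0, cont_rep 0 L (weak_deriv 0 L y) L,
                         cont_rep 0 L b 0, cont_rep 0 L b L)))"

definition admissible_curves ::
    "real \<Rightarrow> ((real \<Rightarrow> real^3) \<Rightarrow> (real \<Rightarrow> real^3) \<Rightarrow> 'v::real_vector) \<Rightarrow> 'v \<Rightarrow>
     ((real \<Rightarrow> real^3) \<times> (real \<Rightarrow> real^3)) set" where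
  "admissible_curves L Lbc l =
     {(y, b). in_H2 0 L y \<and> in_H1 0 L b \<and> Lbc y b = l \<and>
        (\<forall>t\<in>{0..L}. norm (cont_rep 0 L (weak_deriv 0 L y) t) = 1 \<and>
                     norm (cont_rep 0 L b t) = 1 \<and>
                     cont_rep 0 L (weak_deriv 0 L y) t \<bullet> cont_rep 0 L b t = 0)}"

end

theory Submission
  imports Defs
begin

text \<open>
  Put \<open>t = y'\<close>. It suffices to approximate the orthonormal pair \<open>(t, b)\<close> in \<open>H\<^sup>1\<close> by smooth orthonormal
  pairs with the same end point values and the same integral of \<open>t\<close>, since then the integrated curve has
  all the boundary values of \<open>y\<close>. Polynomial approximations \<open>\<sigma>\<close> of \<open>t\<close> and \<open>\<beta>\<close> of \<open>b\<close> are turned into an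
  orthonormal pair by normalisation and Gram-Schmidt, which are smooth, continuous in \<open>H\<^sup>1\<close>, and fix the
  limit \<open>(t, b)\<close>.

  The integral is corrected by replacing \<open>\<sigma>\<close> by \<open>\<sigma> + \<phi> c\<close>, where \<open>\<phi>(x) = (x - a) (b - x)\<close> and \<open>c\<close> is a small
  constant vector. For a unit vector \<open>t\<close> with \<open>t + h \<noteq> 0\<close> one has
  \<open>(sgn (t + h) - t) \<bullet> h = (1 + |t + h|) (1 - sgn (t + h) \<bullet> t) \<ge> 0\<close>, with equality only if \<open>h\<close> is parallel
  to \<open>t\<close>. So unless \<open>t\<close> is constant (and then there is nothing to approximate), the map
  \<open>c \<mapsto> \<integral>sgn (t + \<phi> c) - \<integral>t\<close> points strictly outward on small spheres. This persists when \<open>t\<close> is replaced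
  inside \<open>sgn\<close> by a uniformly close \<open>\<sigma>\<close>, and Brouwer's theorem yields a zero.
\<close>

section \<open>Smooth functions and test functions\<close>

text \<open>The mean of \<open>t\<close> is the rigid constraint. If \<open>t\<close> is constant,
  its integral has the largest length a unit curve can reach, so no other unit curve shares it and
  no correction could succeed; hence the separate case. Otherwise strict outwardness on a sphere is
  an open condition. Brouwer's theorem asks only for continuity in \<open>c\<close>, so no
  derivative of the correction map is estimated, and uniform closeness of the polynomials to
  \<open>t\<close> suffices, which H^1 closeness provides in one dimension. Only \<open>t\<close>
  carries an integral constraint, so it is corrected before \<open>b\<close> is orthogonalised
  against it. With \<open>w\<close> the weak derivative of \<open>t\<close>, the derivatives of the
  normalised polynomials converge to \<open>w - (t \<bullet> w) t\<close>. This expression is not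
  simplified: weak differentiation is closed under L^2 limits and single-valued a.e., so the limit
  must be \<open>w\<close>. The same uniqueness makes the norms and boundary values computable,
  since they are defined through choice operators.\<close>

lemma smooth_on_coinduct:
  assumes "P f"
    and step: "\<And>g. P g \<Longrightarrow> \<exists>g'. P g' \<and> (\<forall>x\<in>S. (g has_vector_derivative g' x) (at x within S))"
  shows "smooth_on S f"
proof -
  \<comment> \<open>\<open>smooth_on\<close> asks for one coherent tower of derivatives, while
    \<open>step\<close> yields one derivative at a time; dependent choice joins them, with stage 0
    pinned to \<open>f\<close>.\<close>
  have "\<exists>D. D 0 = f \<and> (\<forall>n. P (D n) \<and> (\<forall>x\<in>S. (D n has_vector_derivative D (Suc n) x) (at x within S)))"
    using dependent_nat_choice[of "\<lambda>n g. P g \<and> (n = 0 \<longrightarrow> g = f)"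
        "\<lambda>n g g'. \<forall>x\<in>S. (g has_vector_derivative g' x) (at x within S)"] assms
    by (metis nat.distinct(1))
  then show ?thesis
    unfolding smooth_on_def by metis
qed

lemma smooth_on_antiderivative:
  assumes f: "smooth_on S f"
    and F: "\<And>x. x \<in> S \<Longrightarrow> (F has_vector_derivative f x) (at x within S)"
  shows "smooth_on S F"
proof -
  obtain D where D0: "\<And>x. x \<in> S \<Longrightarrow> D 0 x = f x"
    and D: "\<And>n x. x \<in> S \<Longrightarrow> (D n has_vector_derivative D (Suc n) x) (at x within S)"
    using f unfolding smooth_on_def by blast
  show ?thesis
    unfolding smooth_on_def
  proof (intro exI[of _ "\<lambda>n. case n of 0 \<Rightarrow> F | Suc m \<Rightarrow> D m"] conjI allI ballI)
    fix n x assume "x \<in> S"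
    then show "((case n of 0 \<Rightarrow> F | Suc m \<Rightarrow> D m) has_vector_derivative
        (case Suc n of 0 \<Rightarrow> F | Suc m \<Rightarrow> D m) x) (at x within S)"
      using F D D0 by (cases n) auto
  qed auto
qed

text \<open>Each derivative lowers the exponent by one and leaves a polynomial factor, so the family
  over all real \<open>r\<close> and all \<open>p\<close> is closed under differentiation. The
  exponent -1/2 will give normalisation.\<close>

lemma smooth_on_polynomial_quotient:
  fixes p :: "real \<Rightarrow> 'a::euclidean_space" and q :: "real \<Rightarrow> real"
  assumes p: "polynomial_function p" and q: "real_polynomial_function q"
    and pos: "\<And>x. x \<in> S \<Longrightarrow> q x > 0"
  shows "smooth_on S (\<lambda>x. (q x powr r) *\<^sub>R p x)"
proof (rule smooth_on_coinduct[where P = "\<lambda>f. \<exists>r p. polynomial_function p \<and> f = (\<lambda>x. (q x powr r) *\<^sub>R p x)"])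
  show "\<exists>s p'. polynomial_function p' \<and> (\<lambda>x. (q x powr r) *\<^sub>R p x) = (\<lambda>x. (q x powr s) *\<^sub>R p' x)"
    using p by blast
next
  fix g :: "real \<Rightarrow> 'a"
  assume "\<exists>r p. polynomial_function p \<and> g = (\<lambda>x. (q x powr r) *\<^sub>R p x)"
  then obtain r p where p: "polynomial_function p" and g: "g = (\<lambda>x. (q x powr r) *\<^sub>R p x)"
    by blast
  obtain q' where q': "real_polynomial_function q'" "\<And>x. (q has_real_derivative q' x) (at x)"
    using has_real_derivative_polynomial_function[OF q] by blast
  obtain p' where p': "polynomial_function p'" "\<And>x. (p has_vector_derivative p' x) (at x)"
    using has_vector_derivative_polynomial_function[OF p] by blast
  let ?g' = "\<lambda>x. (q x powr (r - 1)) *\<^sub>R (q x *\<^sub>R p' x + (r * q' x) *\<^sub>R p x)"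
  have "polynomial_function (\<lambda>x. q x *\<^sub>R p' x + (r * q' x) *\<^sub>R p x)"
    using p p'(1) q real_polynomial_function.intros(4)[OF real_polynomial_function.intros(2) q'(1)]
    by (intro polynomial_function_add polynomial_function_mult)
      (simp_all flip: real_polynomial_function_eq)
  moreover have "(g has_vector_derivative ?g' x) (at x within S)" if "x \<in> S" for x
  proof -
    have "((\<lambda>x. q x powr r) has_real_derivative r * q x powr (r - 1) * q' x) (at x)"
      using pos[OF that] q'(2)[of x] by (auto intro!: derivative_eq_intros)
    then have "(g has_vector_derivative (q x powr r) *\<^sub>R p' x + (r * q x powr (r - 1) * q' x) *\<^sub>R p x) (at x)"
      unfolding g using p'(2) by (intro has_vector_derivative_scaleR)
    moreover have "q x powr r = q x powr (r - 1) * q x"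
      using pos[OF that] by (simp add: powr_diff)
    ultimately show ?thesis
      by (simp add: scaleR_add_right mult_ac has_vector_derivative_at_within)
  qed
  ultimately show "\<exists>g'. (\<exists>r p. polynomial_function p \<and> g' = (\<lambda>x. (q x powr r) *\<^sub>R p x)) \<and>
      (\<forall>x\<in>S. (g has_vector_derivative g' x) (at x within S))"
    by blast
qed

lemma real_polynomial_function_inner:
  fixes f g :: "'a::real_normed_vector \<Rightarrow> 'b::euclidean_space"
  assumes "polynomial_function f" "polynomial_function g"
  shows "real_polynomial_function (\<lambda>x. f x \<bullet> g x)"
proof -
  have "real_polynomial_function (\<lambda>x. \<Sum>b\<in>Basis. (f x \<bullet> b) * (g x \<bullet> b))"
    using assms by (auto simp: polynomial_function_iff_Basis_inner
        intro!: real_polynomial_function_sum real_polynomial_function.intros(4))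
  then show ?thesis
    by (subst euclidean_inner)
qed

text \<open>The norm of a polynomial curve is not polynomial, but its square is, so
  \<open>sgn p\<close> is \<open>p\<close> times the power -1/2 of a positive polynomial.\<close>

lemma smooth_on_sgn_polynomial:
  fixes p :: "real \<Rightarrow> 'a::euclidean_space"
  assumes p: "polynomial_function p" and nz: "\<And>x. x \<in> S \<Longrightarrow> p x \<noteq> 0"
  shows "smooth_on S (\<lambda>x. sgn (p x))"
proof -
  have "sgn (p x) = ((p x \<bullet> p x) powr (- 1 / 2)) *\<^sub>R p x" for x
  proof (cases "p x = 0")
    case False
    then have "(p x \<bullet> p x) powr (- 1 / 2) = inverse (norm (p x))"
      by (simp add: norm_eq_sqrt_inner powr_minus powr_half_sqrt[symmetric])
    then show ?thesis
      by (simp add: sgn_div_norm)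
  qed auto
  then show ?thesis
    using smooth_on_polynomial_quotient[OF p real_polynomial_function_inner[OF p p], of S "-1/2"] nz
    by simp
qed

text \<open>The powers of \<open>(x - c) (d - x)\<close> in the denominator make the family closed under differentiation,
  and the polynomial factor makes it rich enough to test against.\<close>

definition bump :: "real \<Rightarrow> real \<Rightarrow> (real \<Rightarrow> real) \<Rightarrow> nat \<Rightarrow> real \<Rightarrow> real" where
  "bump c d p m x =
     (if c < x \<and> x < d
      then p x / ((x - c) * (d - x)) ^ m * exp (- 1 / ((x - c) * (d - x))) else 0)"

text \<open>The \<open>n\<close>-th power of \<open>1 + y / n\<close> stays below
  \<open>exp y\<close>. With \<open>y = 1 / q\<close> this says that \<open>exp (- 1 / q)\<close>
  decays faster than any power of \<open>q\<close>, which flattens the bump at its end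
  points.\<close>

lemma power_mult_exp_minus_le: 
  fixes y :: real
  assumes "y \<ge> 0"
  shows "y ^ n * exp (- y) \<le> real n ^ n"
proof (cases "n = 0")
  case False
  have "(y / n) ^ n \<le> (1 + y / n) ^ n"
    using assms by (intro power_mono) auto
  also have "\<dots> \<le> exp y"
    using assms False by (intro exp_ge_one_plus_x_over_n_power_n) auto
  finally have "y ^ n \<le> exp y * real n ^ n"
    using False by (simp add: power_divide field_simps)
  then show ?thesis
    by (simp add: exp_minus field_simps)
qed (use assms in auto)

text \<open>A quadratic bound around every \<open>z\<close> outside the open interval makes the
  difference quotient at \<open>z\<close> tend to 0, so end points and exterior points are handled
  alike.\<close>

lemma bump_quadratic_bound:
  assumes p: "real_polynomial_function p"
  obtains C where "\<And>x z. \<not> (c < z \<and> z < d) \<Longrightarrow> \<bar>bump c d p m x\<bar> \<le> C * (x - z)\<^sup>2"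
proof -
  have "compact (p ` {c..d})"
    using p by (intro compact_continuous_image continuous_on_polymonial_function)
      (auto simp: real_polynomial_function_eq)
  then obtain B where B: "\<And>x. x \<in> {c..d} \<Longrightarrow> \<bar>p x\<bar> \<le> B"
    by (meson bounded_real compact_imp_bounded imageI)
  \<comment> \<open>Of the \<open>m + 2\<close> powers, \<open>m\<close> cancel the denominator of
    the bump and two remain as \<open>q\<^sup>2\<close>.\<close>
  let ?K = "real (m + 2) ^ (m + 2)"
  show ?thesis
  proof
    fix x z assume z: "\<not> (c < z \<and> z < d)"
    show "\<bar>bump c d p m x\<bar> \<le> (\<bar>B\<bar> * ?K * (d - c)\<^sup>2) * (x - z)\<^sup>2"
    proof (cases "c < x \<and> x < d")
      case True
      define q where "q = (x - c) * (d - x)"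
      have q: "q > 0"
        using True by (simp add: q_def)
      \<comment> \<open>The factor of \<open>q\<close> that belongs to the side of \<open>z\<close>
        is at most the distance to \<open>z\<close>; the other is at most
        \<open>d - c\<close>.\<close>
      have "q \<le> (d - c) * \<bar>x - z\<bar>"
      proof (cases "z \<le> c")
        case True
        then show ?thesis
          using \<open>c < x \<and> x < d\<close> mult_mono[of "x - c" "\<bar>x - z\<bar>" "d - x" "d - c"]
          by (simp add: q_def mult.commute)
      next
        case False
        then show ?thesis
          using \<open>c < x \<and> x < d\<close> z mult_mono[of "x - c" "d - c" "d - x" "\<bar>x - z\<bar>"]
          by (simp add: q_def)
      qed
      then have q2: "q\<^sup>2 \<le> (d - c)\<^sup>2 * (x - z)\<^sup>2"
        using q power_mono[of q "(d - c) * \<bar>x - z\<bar>" 2] by (simp add: power_mult_distrib)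
      have "(1 / q) ^ (m + 2) * exp (- (1 / q)) \<le> ?K"
        using q by (intro power_mult_exp_minus_le) auto
      then have "(1 / q) ^ m * exp (- (1 / q)) \<le> ?K * q\<^sup>2"
        using q by (simp add: field_simps power_add power2_eq_square)
      also have "?K * q\<^sup>2 \<le> ?K * ((d - c)\<^sup>2 * (x - z)\<^sup>2)"
        using q2 by (intro mult_left_mono) auto
      finally have "\<bar>p x\<bar> * ((1 / q) ^ m * exp (- (1 / q))) \<le> \<bar>B\<bar> * (?K * ((d - c)\<^sup>2 * (x - z)\<^sup>2))"
        using B[of x] True q by (intro mult_mono[of "\<bar>p x\<bar>"]) auto
      moreover have "\<bar>bump c d p m x\<bar> = \<bar>p x\<bar> * ((1 / q) ^ m * exp (- (1 / q)))"
        using True q unfolding bump_def q_def[symmetric] by (simp add: abs_mult power_divide)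
      ultimately show ?thesis
        by (simp only: mult_ac)
    next
      case False
      then show ?thesis
        by (auto simp: bump_def)
    qed
  qed
qed

text \<open>Differentiating \<open>exp (- 1 / q)\<close> brings in \<open>q' / q\<^sup>2\<close>, so
  all terms of the derivative share the denominator \<open>q ^ (m + 2)\<close>. Outside the open
  interval the quadratic bound gives derivative 0.\<close>

lemma bump_derivative:
  assumes p: "real_polynomial_function p"
  obtains p' where "real_polynomial_function p'"
    "\<And>x. (bump c d p m has_real_derivative bump c d p' (m + 2) x) (at x)"
proof -
  obtain p1 where p1: "real_polynomial_function p1" "\<And>x. (p has_real_derivative p1 x) (at x)"
    using has_real_derivative_polynomial_function[OF p] by blast
  let ?q = "\<lambda>x. (x - c) * (d - x)"
  let ?q' = "\<lambda>x. c + d - 2 * x"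
  \<comment> \<open>The numerator over the common denominator; its terms come from \<open>p\<close>,
    from the power \<open>m\<close> and from the exponential, in this order.\<close>
  define p' where "p' = (\<lambda>x. p1 x * ?q x ^ 2 - real m * p x * ?q' x * ?q x + p x * ?q' x)"
  have lin: "real_polynomial_function (\<lambda>x::real. x)"
    by (simp add: real_polynomial_function.intros(1))
  have "real_polynomial_function p'"
    unfolding p'_def
    by (intro real_polynomial_function.intros(3) real_polynomial_function_diff real_polynomial_function_power
        real_polynomial_function.intros(4) p p1(1) lin real_polynomial_function.intros(2))
  moreover have "(bump c d p m has_real_derivative bump c d p' (m + 2) x) (at x)" for x
  proof (cases "c < x \<and> x < d")
    case True
    define Q where "Q = ?q x"
    have q: "Q > 0"
      using True by (simp add: Q_def)
    define r where "r = ?q' x"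
    define E where "E = exp (- 1 / Q)"
    have p'x: "p' x = p1 x * Q\<^sup>2 - real m * p x * r * Q + p x * r"
      by (simp add: p'_def Q_def r_def)
    have eq: "(p1 x * Q ^ m - p x * (real m * Q ^ (m - 1) * r)) / (Q ^ m * Q ^ m) * E
        + p x / Q ^ m * (E * (r / (Q * Q))) = p' x / Q ^ (m + 2) * E"
      unfolding p'x using q by (cases m) (simp_all add: field_simps power2_eq_square power_add)
    obtain g where g: "g = ?q"
      by blast
    have E': "exp (- (1 / Q)) = E"
      by (simp add: E_def)
    have dg: "(g has_real_derivative r) (at x)"
      unfolding g r_def by (auto intro!: derivative_eq_intros)
    have gx: "g x = Q"
      by (simp add: g Q_def)
    have "((\<lambda>x. p x / g x ^ m * exp (- 1 / g x)) has_real_derivative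
       (p1 x * Q ^ m - p x * (real m * Q ^ (m - 1) * r)) / (Q ^ m * Q ^ m) * E
        + p x / Q ^ m * (E * (r / (Q * Q)))) (at x)"
      using q p1(2)[of x] dg by (auto intro!: derivative_eq_intros simp: gx E' field_simps)
    then have "((\<lambda>x. p x / ?q x ^ m * exp (- 1 / ?q x)) has_real_derivative bump c d p' (m + 2) x) (at x)"
      using True unfolding eq g by (simp add: bump_def Q_def E_def)
    moreover have "\<forall>\<^sub>F y in nhds x. p y / ?q y ^ m * exp (- 1 / ?q y) = bump c d p m y"
      using True eventually_nhds_in_open[of "{c<..<d}" x]
      by (auto simp: bump_def elim!: eventually_mono)
    ultimately show ?thesis
      by (subst (asm) DERIV_cong_ev) auto
  next
    case False
    obtain C where C: "\<And>y z. \<not> (c < z \<and> z < d) \<Longrightarrow> \<bar>bump c d p m y\<bar> \<le> C * (y - z)\<^sup>2"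
      using bump_quadratic_bound[OF p] by blast
    have zero: "bump c d p m x = 0" "bump c d p' (m + 2) x = 0"
      using False by (auto simp: bump_def)
    have "((\<lambda>y. bump c d p m y / (y - x)) \<longlongrightarrow> 0) (at x)"
    proof (rule Lim_null_comparison)
      show "\<forall>\<^sub>F y in at x. norm (bump c d p m y / (y - x)) \<le> C * \<bar>y - x\<bar>"
        unfolding eventually_at_filter
      proof (intro always_eventually allI impI)
        fix y assume "y \<noteq> x"
        then show "norm (bump c d p m y / (y - x)) \<le> C * \<bar>y - x\<bar>"
          using C[OF False, of y] by (simp add: field_simps power2_eq_square)
      qed
      show "((\<lambda>y. C * \<bar>y - x\<bar>) \<longlongrightarrow> 0) (at x)"
        by (auto intro!: tendsto_eq_intros)
    qed
    then show ?thesis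
      unfolding has_field_derivative_iff zero by simp
  qed
  ultimately show ?thesis
    using that by blast
qed

lemma smooth_on_bump:
  assumes "real_polynomial_function p"
  shows "smooth_on UNIV (bump c d p m)"
proof (rule smooth_on_coinduct[where P = "\<lambda>f. \<exists>p m. real_polynomial_function p \<and> f = bump c d p m"])
  fix g assume "\<exists>p m. real_polynomial_function p \<and> g = bump c d p m"
  then show "\<exists>g'. (\<exists>p m. real_polynomial_function p \<and> g' = bump c d p m) \<and>
      (\<forall>x\<in>UNIV. (g has_vector_derivative g' x) (at x))"
    by (metis bump_derivative has_real_derivative_iff_has_vector_derivative)
qed (use assms in auto)

lemma continuous_on_bump:
  assumes "real_polynomial_function p"
  shows "continuous_on S (bump c d p m)"
  using bump_derivative[OF assms, of c d m] by (metis DERIV_continuous_on DERIV_subset subset_UNIV)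

lemma bump_eq_0: "\<not> (c < x \<and> x < d) \<Longrightarrow> bump c d p m x = 0"
  by (auto simp: bump_def)

lemma bump_pos: "c < x \<Longrightarrow> x < d \<Longrightarrow> p x > 0 \<Longrightarrow> bump c d p m x > 0"
  by (simp add: bump_def)

section \<open>Test functions built from bumps\<close>

lemma test_functionI:
  assumes "smooth_on UNIV \<phi>" and "\<And>x. x \<notin> {c..d} \<Longrightarrow> \<phi> x = 0" and "a < c" "d < b"
  shows "test_function a b \<phi>"
proof -
  have sub: "closure {x. \<phi> x \<noteq> 0} \<subseteq> {c..d}"
    using assms(2) by (intro closure_minimal subsetI) force+
  then have "compact (closure {x. \<phi> x \<noteq> 0})"
    using bounded_subset compact_eq_bounded_closed by blast
  then show ?thesis
    using sub assms unfolding test_function_def by force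
qed

lemma test_function_bump:
  assumes "real_polynomial_function p" "a < c" "d < b"
  shows "test_function a b (bump c d p m)"
  using assms by (intro test_functionI[of _ c d] smooth_on_bump) (auto simp: bump_def)

text \<open>Zero mean makes the primitive vanish to the right of \<open>d\<close>, as it does to the
  left of \<open>c\<close>, so it is again compactly supported.\<close>

lemma test_function_antiderivative_bump:
  assumes p: "real_polynomial_function p" and cd: "a < c" "c < d" "d < b"
    and zero: "integral {c..d} (bump c d p m) = 0"
  obtains \<phi> where "test_function a b \<phi>" "deriv \<phi> = bump c d p m"
proof -
  \<comment> \<open>Starting at \<open>c - 1\<close> makes every \<open>x \<ge> c\<close>, including
    \<open>c\<close> itself, interior to the interval \<open>{c - 1..x + 1}\<close> on which the
    primitive is differentiated.\<close>
  define \<phi> where "\<phi> x = integral {c - 1..x} (bump c d p m)" for x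
  have cont: "continuous_on S (bump c d p m)" for S
    using continuous_on_bump[OF p] .
  have left: "\<phi> x = 0" if "x \<le> c" for x
    unfolding \<phi>_def using that by (subst integral_cong[of _ _ "\<lambda>_. 0"]) (auto simp: bump_def)
  have right: "\<phi> x = 0" if "x \<ge> d" for x
  proof -
    have int: "bump c d p m integrable_on {u..v}" for u v
      using integrable_continuous_interval[OF cont] .
    have "\<phi> x = integral {c - 1..c} (bump c d p m) + integral {c..x} (bump c d p m)"
      unfolding \<phi>_def using that cd int by (intro Henstock_Kurzweil_Integration.integral_combine[symmetric]) auto
    also have "integral {c..x} (bump c d p m) = integral {c..d} (bump c d p m) + integral {d..x} (bump c d p m)"
      using that cd int by (intro Henstock_Kurzweil_Integration.integral_combine[symmetric]) auto
    also have "integral {d..x} (bump c d p m) = 0"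
      by (subst integral_cong[of _ _ "\<lambda>_. 0"]) (auto simp: bump_def)
    finally show ?thesis
      using left[of c] zero by (simp add: \<phi>_def)
  qed
  have der: "(\<phi> has_vector_derivative bump c d p m x) (at x)" for x
  proof (cases "x < c")
    case True
    then have "\<forall>\<^sub>F y in nhds x. \<phi> y = 0"
      using eventually_nhds_in_open[of "{..<c}" x] left by (auto elim!: eventually_mono)
    then have "(\<phi> has_real_derivative 0) (at x)"
      by (subst DERIV_cong_ev[OF refl _ refl]) auto
    then show ?thesis
      using True by (simp add: bump_def has_real_derivative_iff_has_vector_derivative)
  next
    case False
    have "(\<phi> has_vector_derivative bump c d p m x) (at x within {c - 1..x + 1})"
      unfolding \<phi>_def using False by (intro integral_has_vector_derivative cont) auto
    then show ?thesis
      using False by (subst (asm) at_within_interior) auto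
  qed
  have "smooth_on UNIV \<phi>"
    by (rule smooth_on_antiderivative[OF smooth_on_bump[OF p, of c d m]]) (simp add: der)
  then have "test_function a b \<phi>"
  proof (rule test_functionI[of _ c d])
    show "\<phi> x = 0" if "x \<notin> {c..d}" for x
      using that left[of x] right[of x] by force
  qed (use cd in auto)
  moreover have "deriv \<phi> = bump c d p m"
    using der by (intro ext DERIV_imp_deriv) (simp add: has_real_derivative_iff_has_vector_derivative)
  ultimately show thesis
    by (rule that)
qed

section \<open>Uniqueness of weak derivatives\<close>

lemma AE_lebesgue_on_iff_negligible:
  assumes "S \<in> sets lebesgue"
  shows "(AE x in lebesgue_on S. P x) \<longleftrightarrow> (\<exists>N. negligible N \<and> (\<forall>x\<in>S - N. P x))"
proof -
  have "(AE x in lebesgue_on S. P x) \<longleftrightarrow> (AE x in lebesgue. x \<in> S \<longrightarrow> P x)"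
    using assms by (subst AE_restrict_space_iff) auto
  also have "\<dots> \<longleftrightarrow> (\<exists>N\<in>null_sets lebesgue. {x. \<not> (x \<in> S \<longrightarrow> P x)} \<subseteq> N)"
    by (simp add: eventually_ae_filter)
  finally show ?thesis
    unfolding negligible_iff_null_sets by blast
qed

lemma integrable_bounded_scaleR:
  fixes w :: "'b \<Rightarrow> 'a::{banach, second_countable_topology}"
  assumes "integrable M w" "f \<in> borel_measurable M" "\<And>x. x \<in> space M \<Longrightarrow> \<bar>f x\<bar> \<le> B"
  shows "integrable M (\<lambda>x. f x *\<^sub>R w x)"
proof (rule Bochner_Integration.integrable_bound)
  show "integrable M (\<lambda>x. B * norm (w x))"
    using assms(1) by auto
  show "(\<lambda>x. f x *\<^sub>R w x) \<in> borel_measurable M"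
    using assms by (intro borel_measurable_scaleR) auto
  show "AE x in M. norm (f x *\<^sub>R w x) \<le> norm (B * norm (w x))"
    using assms(3) by (intro AE_I2) (force simp: abs_mult intro!: mult_right_mono)
qed

lemma integrable_continuous_scaleR:
  fixes w :: "real \<Rightarrow> 'a::euclidean_space"
  assumes w: "integrable (lebesgue_on {c..d}) w" and f: "continuous_on {c..d} f"
  shows "integrable (lebesgue_on {c..d}) (\<lambda>x. f x *\<^sub>R w x)"
proof -
  obtain B where "\<And>x. x \<in> {c..d} \<Longrightarrow> \<bar>f x\<bar> \<le> B"
    using compact_imp_bounded[OF compact_continuous_image[OF f compact_Icc]]
    by (meson bounded_real imageI)
  then show ?thesis
    using w f by (intro integrable_bounded_scaleR[where B = B] continuous_imp_measurable_on_sets_lebesgue) auto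
qed

text \<open>Polynomial multiples of a bump are uniformly dense among continuous multiples, and indicators
  are boundedly a.e. limits of continuous functions.\<close>

lemma AE_zero_if_bump_integrals_zero:
  fixes w :: "real \<Rightarrow> 'a::euclidean_space"
  assumes w: "integrable (lebesgue_on {c..d}) w"
    and zero: "\<And>p. real_polynomial_function p \<Longrightarrow>
      integral\<^sup>L (lebesgue_on {c..d}) (\<lambda>x. bump c d p 0 x *\<^sub>R w x) = 0"
  shows "AE x in lebesgue_on {c<..<d}. w x = 0"
proof -
  let ?M = "lebesgue_on {c..d}"
  interpret finite_measure ?M
    by (intro finite_measure_lebesgue_on) auto
  define h where "h x = bump c d (\<lambda>_. 1) 0 x *\<^sub>R w x" for x
  have bump_split: "bump c d p 0 x *\<^sub>R w x = p x *\<^sub>R h x" for p x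
    by (simp add: h_def bump_def)
  have h: "integrable ?M h"
    unfolding h_def by (intro integrable_continuous_scaleR w continuous_on_bump real_polynomial_function.intros(2))
  have cont_zero: "integral\<^sup>L ?M (\<lambda>x. g x *\<^sub>R h x) = 0" if g: "continuous_on {c..d} g" for g
  proof -
    have bound: "norm (integral\<^sup>L ?M (\<lambda>x. g x *\<^sub>R h x)) \<le> e * (1 + integral\<^sup>L ?M (\<lambda>x. norm (h x)))"
      if e: "e > 0" for e
    proof -
      obtain p where p: "real_polynomial_function p" "\<And>x. x \<in> {c..d} \<Longrightarrow> \<bar>g x - p x\<bar> < e"
        using Stone_Weierstrass_real_polynomial_function[OF compact_Icc g e] by blast
      have cp: "continuous_on {c..d} p"
        using p(1) by (simp add: continuous_on_polymonial_function real_polynomial_function_eq)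
      have "integral\<^sup>L ?M (\<lambda>x. g x *\<^sub>R h x) = integral\<^sup>L ?M (\<lambda>x. g x *\<^sub>R h x) - integral\<^sup>L ?M (\<lambda>x. p x *\<^sub>R h x)"
        using zero[OF p(1)] by (simp add: bump_split)
      also have "\<dots> = integral\<^sup>L ?M (\<lambda>x. (g x - p x) *\<^sub>R h x)"
        using h g cp by (simp add: integrable_continuous_scaleR scaleR_diff_left)
      finally have "norm (integral\<^sup>L ?M (\<lambda>x. g x *\<^sub>R h x)) \<le> integral\<^sup>L ?M (\<lambda>x. norm ((g x - p x) *\<^sub>R h x))"
        by (metis integral_norm_bound)
      also have "\<dots> \<le> integral\<^sup>L ?M (\<lambda>x. e * norm (h x))"
        using h g cp p(2)
        by (intro integral_mono integrable_norm integrable_continuous_scaleR continuous_intros)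
          (auto intro!: mult_right_mono[OF less_imp_le])
      finally show ?thesis
        using e by (simp add: distrib_left)
    qed
    \<comment> \<open>The summand 1 keeps \<open>K\<close> positive even if \<open>h\<close>
      vanishes a.e., so that \<open>e / K\<close> is a legitimate tolerance.\<close>
    define K where "K = 1 + integral\<^sup>L ?M (\<lambda>x. norm (h x))"
    have "K > 0"
      unfolding K_def by (intro add_pos_nonneg) auto
    have "norm (integral\<^sup>L ?M (\<lambda>x. g x *\<^sub>R h x)) \<le> 0 + e" if "e > 0" for e
      using bound[of "e / K"] that \<open>K > 0\<close> by (simp add: K_def[symmetric])
    then have "norm (integral\<^sup>L ?M (\<lambda>x. g x *\<^sub>R h x)) \<le> 0"
      by (rule field_le_epsilon)
    then show ?thesis
      by simp
  qed
  have "set_lebesgue_integral ?M A h = 0" if A: "A \<in> sets ?M" for A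
  proof -
    have "A \<in> sets lebesgue"
      using A by (auto simp: sets_restrict_space_iff)
    then have "(indicator A :: real \<Rightarrow> real) measurable_on UNIV"
      by (intro lebesgue_measurable_imp_measurable_on_real borel_measurable_indicator) auto
    then obtain N g where N: "negligible N" and g: "\<And>n. continuous_on UNIV (g n)"
      and lim: "\<And>x. x \<notin> N \<Longrightarrow> (\<lambda>n. g n x) \<longlonglongrightarrow> (indicator A x :: real)"
      unfolding measurable_on_def by auto
    \<comment> \<open>Clamping to [0, 1] keeps continuity and the limit, since an indicator takes
      its values there, and makes \<open>norm (h x)\<close> a dominating function.\<close>
    define f where "f n x = max 0 (min 1 (g n x))" for n x
    have f: "continuous_on {c..d} (f n)" for n
      unfolding f_def using continuous_on_subset[OF g[of n], of "{c..d}"] by (auto intro!: continuous_intros)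
    have "(\<lambda>n. integral\<^sup>L ?M (\<lambda>x. f n x *\<^sub>R h x)) \<longlonglongrightarrow> integral\<^sup>L ?M (\<lambda>x. indicat_real A x *\<^sub>R h x)"
    proof (rule integral_dominated_convergence)
      show "(\<lambda>x. indicat_real A x *\<^sub>R h x) \<in> borel_measurable ?M"
        using h A by (intro borel_measurable_scaleR borel_measurable_indicator) auto
      show "(\<lambda>x. f n x *\<^sub>R h x) \<in> borel_measurable ?M" for n
        using h f by (intro borel_measurable_integrable integrable_continuous_scaleR)
      show "integrable ?M (\<lambda>x. norm (h x))"
        using h by simp
      show "AE x in ?M. (\<lambda>n. f n x *\<^sub>R h x) \<longlonglongrightarrow> indicat_real A x *\<^sub>R h x"
      proof (subst AE_lebesgue_on_iff_negligible)
        have "(\<lambda>n. f n x) \<longlonglongrightarrow> indicat_real A x" if "x \<notin> N" for x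
        proof -
          have "(\<lambda>n. f n x) \<longlonglongrightarrow> max 0 (min 1 (indicat_real A x))"
            unfolding f_def by (intro tendsto_intros lim that)
          then show ?thesis
            by (simp add: indicator_def split: if_splits)
        qed
        then show "\<exists>N. negligible N \<and> (\<forall>x\<in>{c..d} - N. (\<lambda>n. f n x *\<^sub>R h x) \<longlonglongrightarrow> indicat_real A x *\<^sub>R h x)"
          using N by (auto intro!: exI[of _ N] tendsto_scaleR)
      qed auto
      show "AE x in ?M. norm (f n x *\<^sub>R h x) \<le> norm (h x)" for n
        by (auto simp: f_def intro!: AE_I2 mult_left_le_one_le)
    qed
    then show ?thesis
      by (simp add: cont_zero[OF f] set_lebesgue_integral_def LIMSEQ_const_iff)
  qed
  then have "AE x in ?M. h x = 0"
    by (intro density_zero[OF h])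
  then obtain N where "negligible N" "\<forall>x\<in>{c..d} - N. h x = 0"
    by (auto simp: AE_lebesgue_on_iff_negligible)
  \<comment> \<open>The bump is positive on the open interval, so it can be divided out.\<close>
  moreover have "w x = 0" if "h x = 0" "x \<in> {c<..<d}" for x
    using that bump_pos[of c x d "\<lambda>_. 1" 0] by (simp add: h_def)
  ultimately show ?thesis
    by (auto simp: AE_lebesgue_on_iff_negligible intro!: exI[of _ N])
qed

text \<open>Local integrability gives access to compact subintervals only. Countably many of them,
  with margins \<open>1 / Suc n\<close>, exhaust the interval, and a countable union of null sets is
  null.\<close>

lemma AE_lebesgue_on_Ioo_exhaust:
  fixes a b :: real
  assumes "\<And>c d. a < c \<Longrightarrow> c < d \<Longrightarrow> d < b \<Longrightarrow> AE x in lebesgue_on {c<..<d}. P x"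
  shows "AE x in lebesgue_on {a<..<b}. P x"
proof -
  let ?c = "\<lambda>n. a + 1 / real (Suc n)" and ?d = "\<lambda>n. b - 1 / real (Suc n)"
  have "\<exists>N. negligible N \<and> (\<forall>x\<in>{?c n<..<?d n} - N. P x)" for n
  proof (cases "?c n < ?d n")
    case True
    then have "AE x in lebesgue_on {?c n<..<?d n}. P x"
      by (intro assms) auto
    then show ?thesis
      by (simp add: AE_lebesgue_on_iff_negligible)
  qed (auto intro!: exI[of _ "{}"])
  then obtain N where N: "\<And>n. negligible (N n)" "\<And>n x. x \<in> {?c n<..<?d n} - N n \<Longrightarrow> P x"
    by metis
  have "negligible (\<Union>(range N))"
    using N(1) by (intro negligible_countable_Union) auto
  moreover have "P x" if x: "x \<in> {a<..<b} - \<Union>(range N)" for x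
  proof -
    obtain n where n: "1 / real (Suc n) < min (x - a) (b - x)"
      using x reals_Archimedean[of "min (x - a) (b - x)"] by (auto simp: inverse_eq_divide)
    then have "x \<in> {?c n<..<?d n} - N n"
      using x by auto
    then show ?thesis
      by (rule N(2))
  qed
  ultimately show ?thesis
    by (auto simp: AE_lebesgue_on_iff_negligible)
qed

lemma integral_lebesgue_on_supported:
  fixes f :: "real \<Rightarrow> 'a::euclidean_space"
  assumes "\<And>x. x \<notin> {c..d} \<Longrightarrow> f x = 0" "{c..d} \<subseteq> {a<..<b}"
  shows "integral\<^sup>L (lebesgue_on {a<..<b}) f = integral\<^sup>L (lebesgue_on {c..d}) f"
proof -
  have "(\<lambda>x. indicat_real {a<..<b} x *\<^sub>R f x) = (\<lambda>x. indicat_real {c..d} x *\<^sub>R f x)"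
    using assms by (force simp: indicator_def)
  moreover have "integral\<^sup>L (lebesgue_on S) f = integral\<^sup>L lebesgue (\<lambda>x. indicat_real S x *\<^sub>R f x)"
    if "S \<in> sets lebesgue" for S
    using that by (simp add: integral_restrict_space)
  ultimately show ?thesis
    by simp
qed

lemma integral_bump_scaleR:
  fixes w :: "real \<Rightarrow> 'a::euclidean_space"
  assumes "a < c" "d < b"
  shows "integral\<^sup>L (lebesgue_on {a<..<b}) (\<lambda>x. bump c d p m x *\<^sub>R w x) =
    integral\<^sup>L (lebesgue_on {c..d}) (\<lambda>x. bump c d p m x *\<^sub>R w x)"
  using assms by (intro integral_lebesgue_on_supported) (auto simp: bump_eq_0)

lemma locally_integrable_Icc:
  assumes "locally_integrable a b w" "a < c" "d < b"
  shows "integrable (lebesgue_on {c..d}) w"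
proof (rule absolutely_integrable_imp_integrable)
  show "w absolutely_integrable_on {c..d}"
    using assms(1)[unfolded locally_integrable_def, rule_format, of "{c..d}"] assms(2,3) by fastforce
qed auto

text \<open>The fundamental lemma of the calculus of variations; on each subinterval, bumps with
  polynomial factors are already enough test functions.\<close>

lemma AE_zero_if_weakly_zero:
  fixes w :: "real \<Rightarrow> 'a::euclidean_space"
  assumes w: "locally_integrable a b w"
    and zero: "\<And>\<phi>. test_function a b \<phi> \<Longrightarrow> integral\<^sup>L (lebesgue_on {a<..<b}) (\<lambda>x. \<phi> x *\<^sub>R w x) = 0"
  shows "AE x in lebesgue_on {a<..<b}. w x = 0"
proof (rule AE_lebesgue_on_Ioo_exhaust)
  fix c d assume cd: "a < c" "c < d" "d < b"
  show "AE x in lebesgue_on {c<..<d}. w x = 0"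
  proof (rule AE_zero_if_bump_integrals_zero[OF locally_integrable_Icc[OF w cd(1,3)]])
    fix p :: "real \<Rightarrow> real" assume "real_polynomial_function p"
    then show "integral\<^sup>L (lebesgue_on {c..d}) (\<lambda>x. bump c d p 0 x *\<^sub>R w x) = 0"
      using zero[OF test_function_bump[of p a c d b 0]] cd
      by (simp add: integral_bump_scaleR)
  qed
qed

text \<open>The du Bois-Reymond lemma on a compact subinterval. A bump minus the multiple of a fixed
  bump that cancels its mean is the derivative of a test function. Hence \<open>w - C\<close>
  integrates to zero against every bump, where \<open>C\<close> is the mean of \<open>w\<close>
  weighted by the fixed bump.\<close>

lemma AE_const_if_derivative_weakly_zero_Icc:
  fixes w :: "real \<Rightarrow> 'a::euclidean_space"
  assumes w: "locally_integrable a b w"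
    and zero: "\<And>\<phi>. test_function a b \<phi> \<Longrightarrow> integral\<^sup>L (lebesgue_on {a<..<b}) (\<lambda>x. deriv \<phi> x *\<^sub>R w x) = 0"
    and cd: "a < c" "c < d" "d < b"
  obtains C where "AE x in lebesgue_on {c<..<d}. w x = C"
proof -
  let ?M = "lebesgue_on {c..d}" and ?\<psi> = "bump c d (\<lambda>_. 1) 0"
  have one: "real_polynomial_function (\<lambda>_::real. 1::real)"
    by (rule real_polynomial_function.intros(2))
  have int: "integrable ?M w"
    by (rule locally_integrable_Icc[OF w cd(1,3)])
  have intb: "integrable ?M (bump c d p 0)" if "real_polynomial_function p" for p
    using continuous_on_bump[OF that] by (intro continuous_imp_integrable_real)
  have intbw: "integrable ?M (\<lambda>x. bump c d p 0 x *\<^sub>R w x)" if "real_polynomial_function p" for p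
    by (intro integrable_continuous_scaleR int continuous_on_bump that)
  define I where "I = integral\<^sup>L ?M ?\<psi>"
  have "I \<noteq> 0"
  proof
    assume "I = 0"
    then have "\<forall>x\<in>{c..d}. ?\<psi> x = 0"
      unfolding I_def using integralL_eq_0_iff[OF continuous_on_bump[OF one] cd(2)]
      by (simp add: bump_def)
    then have "?\<psi> ((c + d) / 2) = 0"
      using cd by auto
    then show False
      using bump_pos[of c "(c + d) / 2" d "\<lambda>_. 1" 0] cd by simp
  qed
  define C where "C = (1 / I) *\<^sub>R integral\<^sup>L ?M (\<lambda>x. ?\<psi> x *\<^sub>R w x)"
  have "AE x in lebesgue_on {c<..<d}. w x - C = 0"
  proof (rule AE_zero_if_bump_integrals_zero)
    show "integrable ?M (\<lambda>x. w x - C)"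
      using int continuous_imp_integrable_real[OF continuous_on_const]
      by (intro Bochner_Integration.integrable_diff) auto
    fix p :: "real \<Rightarrow> real" assume p: "real_polynomial_function p"
    define J where "J = integral\<^sup>L ?M (bump c d p 0)"
    let ?p1 = "\<lambda>x. p x - J / I"
    have p1: "real_polynomial_function ?p1"
      by (intro real_polynomial_function_diff p real_polynomial_function.intros(2))
    have split: "bump c d ?p1 0 x = bump c d p 0 x - (J / I) * ?\<psi> x" for x
      by (simp add: bump_def algebra_simps)
    have "integral\<^sup>L ?M (bump c d ?p1 0) = 0"
      unfolding split using intb[OF p] intb[OF one] \<open>I \<noteq> 0\<close> by (simp add: I_def[symmetric] J_def[symmetric])
    then have "integral {c..d} (bump c d ?p1 0) = 0"
      by (subst (asm) lebesgue_integral_eq_integral) (auto intro: intb[OF p1])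
    then obtain \<phi> where \<phi>: "test_function a b \<phi>" "deriv \<phi> = bump c d ?p1 0"
      by (rule test_function_antiderivative_bump[OF p1 cd])
    have "0 = integral\<^sup>L ?M (\<lambda>x. bump c d ?p1 0 x *\<^sub>R w x)"
      using zero[OF \<phi>(1)] unfolding \<phi>(2) using cd
      by (simp add: integral_bump_scaleR)
    also have "\<dots> = integral\<^sup>L ?M (\<lambda>x. bump c d p 0 x *\<^sub>R w x - (J / I) *\<^sub>R (?\<psi> x *\<^sub>R w x))"
      unfolding split by (simp add: scaleR_diff_left)
    also have "\<dots> = integral\<^sup>L ?M (\<lambda>x. bump c d p 0 x *\<^sub>R w x)
        - integral\<^sup>L ?M (\<lambda>x. (J / I) *\<^sub>R (?\<psi> x *\<^sub>R w x))"
      using intbw[OF p] intbw[OF one]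
      by (intro Bochner_Integration.integral_diff integrable_scaleR_right)
    also have "\<dots> = integral\<^sup>L ?M (\<lambda>x. bump c d p 0 x *\<^sub>R w x) - J *\<^sub>R C"
      unfolding C_def integral_scaleR_right by simp
    also have "\<dots> = integral\<^sup>L ?M (\<lambda>x. bump c d p 0 x *\<^sub>R (w x - C))"
      using intbw[OF p] intb[OF p] by (simp add: scaleR_diff_right J_def)
    finally show "integral\<^sup>L ?M (\<lambda>x. bump c d p 0 x *\<^sub>R (w x - C)) = 0"
      by simp
  qed
  then show ?thesis
    by (intro that[of C]) auto
qed

text \<open>The constants found on different subintervals are tied together through one reference
  interval, the middle third.\<close>

lemma AE_const_if_derivative_weakly_zero:
  fixes w :: "real \<Rightarrow> 'a::euclidean_space"
  assumes w: "locally_integrable a b w" and "a < b"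
    and zero: "\<And>\<phi>. test_function a b \<phi> \<Longrightarrow> integral\<^sup>L (lebesgue_on {a<..<b}) (\<lambda>x. deriv \<phi> x *\<^sub>R w x) = 0"
  obtains C where "AE x in lebesgue_on {a<..<b}. w x = C"
proof -
  define c0 d0 where "c0 = (2 * a + b) / 3" and "d0 = (a + 2 * b) / 3"
  have c0: "a < c0" "c0 < d0" "d0 < b"
    using \<open>a < b\<close> by (auto simp: c0_def d0_def)
  obtain C0 where C0: "AE x in lebesgue_on {c0<..<d0}. w x = C0"
    using AE_const_if_derivative_weakly_zero_Icc[OF w zero c0] by blast
  have "AE x in lebesgue_on {a<..<b}. w x = C0"
  proof (rule AE_lebesgue_on_Ioo_exhaust)
    fix c d assume cd: "a < c" "c < d" "d < b"
    \<comment> \<open>On the hull of both intervals the constant must be \<open>C0\<close>: the two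
      a.e. statements meet on the reference interval, which is not negligible.\<close>
    obtain C where C: "AE x in lebesgue_on {min c c0<..<max d d0}. w x = C"
    proof (rule AE_const_if_derivative_weakly_zero_Icc[OF w zero])
      show "a < min c c0" "min c c0 < max d d0" "max d d0 < b"
        using c0 cd by auto
    qed
    obtain N0 N where N0: "negligible N0" "\<And>x. x \<in> {c0<..<d0} - N0 \<Longrightarrow> w x = C0"
      and N: "negligible N" "\<And>x. x \<in> {min c c0<..<max d d0} - N \<Longrightarrow> w x = C"
      using C0 C by (auto simp: AE_lebesgue_on_iff_negligible)
    have "\<not> negligible {c0<..<d0}"
      using c0 by (metis box_real(1) negligible_interval(2) greaterThanLessThan_empty_iff not_le)
    moreover have "negligible (N0 \<union> N)"
      using N0 N by (simp add: negligible_Un)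
    ultimately have "\<not> {c0<..<d0} \<subseteq> N0 \<union> N"
      using negligible_subset by blast
    then obtain x where "x \<in> {c0<..<d0}" "x \<notin> N0" "x \<notin> N"
      by blast
    then have "C = C0"
      using N0(2)[of x] N(2)[of x] by (auto simp: min_less_iff_disj less_max_iff_disj)
    then show "AE x in lebesgue_on {c<..<d}. w x = C0"
      using N by (auto simp: AE_lebesgue_on_iff_negligible min_less_iff_disj less_max_iff_disj
          intro!: exI[of _ N])
  qed
  then show ?thesis
    by (rule that)
qed

lemma integrable_test_function_scaleR:
  fixes w :: "real \<Rightarrow> 'a::euclidean_space"
  assumes w: "locally_integrable a b w"
    and f: "continuous_on UNIV f" and K: "{x. f x \<noteq> 0} \<subseteq> {c..d}" and cd: "a < c" "d < b"
  shows "integrable (lebesgue_on {a<..<b}) (\<lambda>x. f x *\<^sub>R w x)"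
proof -
  have "integrable (lebesgue_on {c..d}) (\<lambda>x. f x *\<^sub>R w x)"
    using continuous_on_subset[OF f] by (intro integrable_continuous_scaleR locally_integrable_Icc[OF w cd]) auto
  then have "integrable lebesgue (\<lambda>x. indicat_real {c..d} x *\<^sub>R (f x *\<^sub>R w x))"
    by (subst (asm) integrable_restrict_space) auto
  also have "(\<lambda>x. indicat_real {c..d} x *\<^sub>R (f x *\<^sub>R w x)) = (\<lambda>x. indicat_real {a<..<b} x *\<^sub>R (f x *\<^sub>R w x))"
    using K cd by (force simp: indicator_def subset_eq)
  finally show ?thesis
    by (subst integrable_restrict_space) auto
qed

lemma test_function_facts:
  assumes "test_function a b \<phi>" and "a < b"
  obtains c d where "a < c" "c < d" "d < b" "{x. \<phi> x \<noteq> 0} \<subseteq> {c..d}" "{x. deriv \<phi> x \<noteq> 0} \<subseteq> {c..d}"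
    "continuous_on UNIV \<phi>" "continuous_on UNIV (deriv \<phi>)" "\<And>x. (\<phi> has_real_derivative deriv \<phi> x) (at x)"
proof -
  let ?S = "closure {x. \<phi> x \<noteq> 0}"
  have K: "compact ?S" "?S \<subseteq> {a<..<b}"
    using assms by (auto simp: test_function_def)
  obtain D where D0: "\<And>x. D 0 x = \<phi> x" and D: "\<And>n x. (D n has_vector_derivative D (Suc n) x) (at x)"
    using assms unfolding test_function_def smooth_on_def by auto
  have "D 0 = \<phi>"
    using D0 by auto
  have der: "(\<phi> has_real_derivative D 1 x) (at x)" for x
    using D[of 0 x] \<open>D 0 = \<phi>\<close> by (simp add: has_real_derivative_iff_has_vector_derivative)
  then have deriv: "deriv \<phi> = D 1"
    by (intro ext DERIV_imp_deriv)
  have cont: "continuous_on UNIV (D n)" for n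
    using D by (intro continuous_at_imp_continuous_on ballI has_vector_derivative_continuous)
  obtain c d where cd: "a < c" "c < d" "d < b" "?S \<subseteq> {c..d}"
  proof (cases "?S = {}")
    case True
    then show ?thesis
      using that[of "(2 * a + b) / 3" "(a + 2 * b) / 3"] \<open>a < b\<close> by auto
  next
    case False
    then obtain l u where "l \<in> ?S" "u \<in> ?S" "\<And>x. x \<in> ?S \<Longrightarrow> l \<le> x \<and> x \<le> u"
      using compact_attains_inf[OF K(1)] compact_attains_sup[OF K(1)] by metis
    then have lu: "a < l" "l \<le> u" "u < b" "?S \<subseteq> {l..u}"
      using K(2) by (auto simp: subset_eq)
    \<comment> \<open>Moving the right end from \<open>u\<close> to the midpoint of \<open>u\<close>
      and \<open>b\<close> secures \<open>c < d\<close> where only \<open>l \<le> u\<close> is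
      known.\<close>
    moreover have "{l..u} \<subseteq> {l..(u + b) / 2}"
      using lu by auto
    ultimately show ?thesis
      by (intro that[of l "(u + b) / 2"]) auto
  qed
  have "deriv \<phi> x = 0" if "x \<notin> {c..d}" for x
  proof -
    have x: "x \<in> - {c..d}"
      using that by blast
    have "\<phi> y = 0" if "y \<in> - {c..d}" for y
      using that cd(4) closure_subset[of "{x. \<phi> x \<noteq> 0}"] by blast
    then have "\<forall>\<^sub>F y in nhds x. \<phi> y = 0"
      using eventually_nhds_in_open[OF open_Compl[OF closed_atLeastAtMost] x] by (auto elim!: eventually_mono)
    then have "(\<phi> has_real_derivative 0) (at x)"
      by (subst DERIV_cong_ev[OF refl _ refl]) auto
    then show ?thesis
      by (rule DERIV_imp_deriv)
  qed
  then have s1: "{x. deriv \<phi> x \<noteq> 0} \<subseteq> {c..d}"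
    by blast
  have s0: "{x. \<phi> x \<noteq> 0} \<subseteq> {c..d}"
    using closure_subset cd(4) by (rule subset_trans)
  have c0: "continuous_on UNIV \<phi>" and c1: "continuous_on UNIV (deriv \<phi>)"
    using cont[of 0] cont[of 1] by (simp_all only: deriv \<open>D 0 = \<phi>\<close>)
  have "(\<phi> has_real_derivative deriv \<phi> x) (at x)" for x
    using der by (simp only: deriv)
  then show thesis
    by (rule that[OF cd(1-3) s0 s1 c0 c1])
qed

lemma locally_integrable_diff:
  "locally_integrable a b u \<Longrightarrow> locally_integrable a b v \<Longrightarrow> locally_integrable a b (\<lambda>x. u x - v x)"
  by (auto simp: locally_integrable_def intro!: set_integral_diff)

lemma has_weak_derivative_diff:
  assumes u: "has_weak_derivative a b u1 v1" "has_weak_derivative a b u2 v2" and "a < b"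
  shows "has_weak_derivative a b (\<lambda>x. u1 x - u2 x) (\<lambda>x. v1 x - v2 x)"
  unfolding has_weak_derivative_def
proof (intro conjI allI impI)
  show "locally_integrable a b (\<lambda>x. u1 x - u2 x)" "locally_integrable a b (\<lambda>x. v1 x - v2 x)"
    using u by (auto simp: has_weak_derivative_def intro: locally_integrable_diff)
  fix \<phi> assume \<phi>: "test_function a b \<phi>"
  obtain c d where cd: "a < c" "c < d" "d < b" "{x. \<phi> x \<noteq> 0} \<subseteq> {c..d}" "{x. deriv \<phi> x \<noteq> 0} \<subseteq> {c..d}"
    and cont: "continuous_on UNIV \<phi>" "continuous_on UNIV (deriv \<phi>)"
    using test_function_facts[OF \<phi> \<open>a < b\<close>] by metis
  have loc: "locally_integrable a b u1" "locally_integrable a b u2" "locally_integrable a b v1" "locally_integrable a b v2"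
    using u by (auto simp: has_weak_derivative_def)
  note int = integrable_test_function_scaleR[OF _ cont(2) cd(5,1,3)] integrable_test_function_scaleR[OF _ cont(1) cd(4,1,3)]
  show "integral\<^sup>L (lebesgue_on {a<..<b}) (\<lambda>x. deriv \<phi> x *\<^sub>R (u1 x - u2 x)) =
    - integral\<^sup>L (lebesgue_on {a<..<b}) (\<lambda>x. \<phi> x *\<^sub>R (v1 x - v2 x))"
    using u \<phi> by (simp add: scaleR_diff_right int loc has_weak_derivative_def)
qed

text \<open>The function \<open>u - u\<close> has weak derivative \<open>v1 - v2\<close>, and it
  makes one side of the defining identity zero.\<close>

lemma weak_derivative_unique:
  assumes "has_weak_derivative a b u v1" "has_weak_derivative a b u v2" and "a < b"
  shows "AE x in lebesgue_on {a<..<b}. v1 x = v2 x"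
proof -
  have *: "has_weak_derivative a b (\<lambda>x. u x - u x) (\<lambda>x. v1 x - v2 x)"
    by (intro has_weak_derivative_diff assms)
  have "AE x in lebesgue_on {a<..<b}. v1 x - v2 x = 0"
    using * by (intro AE_zero_if_weakly_zero) (auto simp: has_weak_derivative_def)
  then show ?thesis
    by simp
qed

lemma weak_derivative_zero_imp_const:
  assumes "has_weak_derivative a b u (\<lambda>_. 0)" and "a < b"
  obtains C where "AE x in lebesgue_on {a<..<b}. u x = C"
proof (rule AE_const_if_derivative_weakly_zero[of a b u])
  show "integral\<^sup>L (lebesgue_on {a<..<b}) (\<lambda>x. deriv \<phi> x *\<^sub>R u x) = 0" if "test_function a b \<phi>" for \<phi>
    using assms(1) that unfolding has_weak_derivative_def by simp
qed (use assms in \<open>auto simp: has_weak_derivative_def\<close>)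

section \<open>Square-integrable functions\<close>

lemma finite_measure_lebesgue_on_Ioo: "finite_measure (lebesgue_on {a<..<b::real})"
  by (intro finite_measure_lebesgue_on) auto

text \<open>Completeness of Lebesgue measure makes \<open>g\<close> integrable along with
  \<open>f\<close>. This suits functions such as \<open>weak_deriv\<close>, which are chosen and
  controlled only a.e.\<close>

lemma integral_lebesgue_on_cong_AE:
  fixes f :: "real \<Rightarrow> 'a::euclidean_space"
  assumes f: "integrable (lebesgue_on S) f" and S: "S \<in> sets lebesgue"
    and eq: "AE x in lebesgue_on S. g x = f x"
  shows "integral\<^sup>L (lebesgue_on S) g = integral\<^sup>L (lebesgue_on S) f"
proof -
  obtain N where N: "negligible N" "\<And>x. x \<in> S - N \<Longrightarrow> g x = f x"
    using eq S by (auto simp: AE_lebesgue_on_iff_negligible)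
  have "f absolutely_integrable_on S"
    using f S by (simp add: set_integrable_def integrable_restrict_space)
  then have "g absolutely_integrable_on S"
    using N by (rule absolutely_integrable_spike)
  then have g: "integrable (lebesgue_on S) g"
    using S by (rule absolutely_integrable_imp_integrable)
  show "integral\<^sup>L (lebesgue_on S) g = integral\<^sup>L (lebesgue_on S) f"
    using integral_spike[OF N] by (simp add: lebesgue_integral_eq_integral f g S)
qed

lemma
  fixes f :: "real \<Rightarrow> 'a::euclidean_space"
  assumes "continuous_on {a..b} f"
  shows integrable_continuous_Ioo: "integrable (lebesgue_on {a<..<b}) f"
    and integral_continuous_Ioo: "integral\<^sup>L (lebesgue_on {a<..<b}) f = integral {a..b} f"
proof -
  have "f absolutely_integrable_on {a<..<b}"
    using absolutely_integrable_continuous_real[OF assms] absolutely_integrable_on_Icc_iff_Ioo by blast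
  then show int: "integrable (lebesgue_on {a<..<b}) f"
    by (intro absolutely_integrable_imp_integrable) auto
  show "integral\<^sup>L (lebesgue_on {a<..<b}) f = integral {a..b} f"
    by (subst lebesgue_integral_eq_integral[OF int]) (auto simp: integral_open_interval_real)
qed

lemma integrable_Ioo_imp_Icc:
  fixes f :: "real \<Rightarrow> 'a::euclidean_space"
  assumes "integrable (lebesgue_on {a<..<b}) f" "{c..d} \<subseteq> {a..b}"
  shows "f integrable_on {c..d}"
proof -
  have "f integrable_on {a<..<b}"
    using assms by (intro integrable_on_lebesgue_on) auto
  then have "f integrable_on {a..b}"
    by (simp add: integrable_on_open_interval_real)
  then show ?thesis
    using assms(2) by (rule integrable_on_subinterval)
qed

lemma norm_integral_Icc_le:
  fixes f :: "real \<Rightarrow> 'a::euclidean_space"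
  assumes f: "integrable (lebesgue_on {a<..<b}) f" and "{c..d} \<subseteq> {a..b}"
  shows "norm (integral {c..d} f) \<le> integral\<^sup>L (lebesgue_on {a<..<b}) (\<lambda>x. norm (f x))"
proof -
  have nf: "integrable (lebesgue_on {a<..<b}) (\<lambda>x. norm (f x))"
    using f by simp
  have "norm (integral {c..d} f) \<le> integral {c..d} (\<lambda>x. norm (f x))"
    using integrable_Ioo_imp_Icc[OF f assms(2)] integrable_Ioo_imp_Icc[OF nf assms(2)]
    by (intro integral_norm_bound_integral) auto
  also have "\<dots> \<le> integral {a..b} (\<lambda>x. norm (f x))"
    using integrable_Ioo_imp_Icc[OF nf assms(2)] integrable_Ioo_imp_Icc[OF nf order_refl] assms(2)
    by (intro integral_subset_le) auto
  also have "\<dots> = integral\<^sup>L (lebesgue_on {a<..<b}) (\<lambda>x. norm (f x))"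
    by (subst lebesgue_integral_eq_integral[OF nf]) (auto simp: integral_open_interval_real)
  finally show ?thesis .
qed

text \<open>Kept squared, so that \<open>H1_norm\<close> and \<open>H2_norm\<close> are roots of
  plain sums of such terms; only convergence to 0 has to be tracked, not sharp constants.\<close>

definition L2_sq :: "real \<Rightarrow> real \<Rightarrow> (real \<Rightarrow> 'a::euclidean_space) \<Rightarrow> real" where
  "L2_sq a b u = integral\<^sup>L (lebesgue_on {a<..<b}) (\<lambda>x. (norm (u x))\<^sup>2)"

lemma L2_sq_nonneg: "L2_sq a b u \<ge> 0"
  by (simp add: L2_sq_def)

lemma in_L2I:
  assumes "u \<in> borel_measurable (lebesgue_on {a<..<b})" "integrable (lebesgue_on {a<..<b}) g"
    and "\<And>x. x \<in> {a<..<b} \<Longrightarrow> (norm (u x))\<^sup>2 \<le> g x"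
  shows "in_L2 a b u"
  unfolding in_L2_def
proof
  show "integrable (lebesgue_on {a<..<b}) (\<lambda>x. (norm (u x))\<^sup>2)"
    using assms(1) by (intro Bochner_Integration.integrable_bound[OF assms(2)])
      (auto intro!: AE_I2 order_trans[OF assms(3)])
qed (rule assms(1))

lemma power2_norm_add_le:
  fixes x y :: "'a::real_normed_vector"
  shows "(norm (x + y))\<^sup>2 \<le> 2 * (norm x)\<^sup>2 + 2 * (norm y)\<^sup>2"
proof -
  have "(norm (x + y))\<^sup>2 \<le> (norm x + norm y)\<^sup>2"
    by (intro power_mono norm_triangle_ineq) auto
  also have "\<dots> \<le> 2 * (norm x)\<^sup>2 + 2 * (norm y)\<^sup>2"
    using zero_le_power2[of "norm x - norm y"] by (simp add: power2_eq_square algebra_simps)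
  finally show ?thesis .
qed

text \<open>The factor 2 comes from \<open>2 * r * s \<le> r\<^sup>2 + s\<^sup>2\<close> and takes
  the place of Minkowski's inequality.\<close>

lemma
  fixes u v :: "real \<Rightarrow> 'a::euclidean_space"
  assumes u: "in_L2 a b u" and v: "in_L2 a b v"
  shows in_L2_add: "in_L2 a b (\<lambda>x. u x + v x)"
    and L2_sq_add: "L2_sq a b (\<lambda>x. u x + v x) \<le> 2 * L2_sq a b u + 2 * L2_sq a b v"
proof -
  let ?M = "lebesgue_on {a<..<b}" and ?g = "\<lambda>x. 2 * (norm (u x))\<^sup>2 + 2 * (norm (v x))\<^sup>2"
  have g: "integrable ?M ?g"
    using u v by (simp add: in_L2_def)
  show uv: "in_L2 a b (\<lambda>x. u x + v x)"
    using u v g by (intro in_L2I[OF _ g] power2_norm_add_le) (auto simp: in_L2_def)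
  have "L2_sq a b (\<lambda>x. u x + v x) \<le> integral\<^sup>L ?M ?g"
    unfolding L2_sq_def using uv g by (intro integral_mono power2_norm_add_le) (auto simp: in_L2_def)
  also have "\<dots> = 2 * L2_sq a b u + 2 * L2_sq a b v"
    using u v by (simp add: L2_sq_def in_L2_def)
  finally show "L2_sq a b (\<lambda>x. u x + v x) \<le> 2 * L2_sq a b u + 2 * L2_sq a b v" .
qed

lemma in_L2_minus: "in_L2 a b u \<Longrightarrow> in_L2 a b (\<lambda>x. - u x)"
  by (simp add: in_L2_def)

lemma in_L2_diff:
  fixes u v :: "real \<Rightarrow> 'a::euclidean_space"
  assumes "in_L2 a b u" "in_L2 a b v"
  shows "in_L2 a b (\<lambda>x. u x - v x)"
  using in_L2_add[OF assms(1) in_L2_minus[OF assms(2)]] by simp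

text \<open>The estimate is Cauchy-Schwarz against the constant 1, read off from the nonnegative
  variance of \<open>norm (u x)\<close> around its mean \<open>m\<close>.\<close>

lemma
  fixes u :: "real \<Rightarrow> 'a::euclidean_space"
  assumes u: "in_L2 a b u" and ab: "a < b"
  shows in_L2_imp_integrable: "integrable (lebesgue_on {a<..<b}) u"
    and integral_norm_le_L2: "integral\<^sup>L (lebesgue_on {a<..<b}) (\<lambda>x. norm (u x)) \<le> sqrt ((b - a) * L2_sq a b u)"
proof -
  let ?M = "lebesgue_on {a<..<b}"
  interpret finite_measure ?M
    by (rule finite_measure_lebesgue_on_Ioo)
  have u2: "integrable ?M (\<lambda>x. (norm (u x))\<^sup>2)"
    using u by (simp add: in_L2_def)
  have le: "norm (u x) \<le> 1 + (norm (u x))\<^sup>2" for x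
    using zero_le_power2[of "norm (u x) - 1 / 2"] by (simp add: power2_eq_square algebra_simps)
  show int: "integrable ?M u"
    by (rule Bochner_Integration.integrable_bound[of _ "\<lambda>x. 1 + (norm (u x))\<^sup>2"])
      (use u u2 le in \<open>auto simp: in_L2_def intro!: AE_I2 order_trans[OF le]\<close>)
  define I where "I = integral\<^sup>L ?M (\<lambda>x. norm (u x))"
  define m where "m = I / (b - a)"
  have "0 \<le> integral\<^sup>L ?M (\<lambda>x. (norm (u x) - m)\<^sup>2)"
    by simp
  also have "(\<lambda>x. (norm (u x) - m)\<^sup>2) = (\<lambda>x. (norm (u x))\<^sup>2 - (2 * m) * norm (u x) + m\<^sup>2)"
    by (auto simp: power2_eq_square algebra_simps)
  also have "integral\<^sup>L ?M \<dots> = L2_sq a b u - (2 * m) * I + m\<^sup>2 * (b - a)"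
    using u2 int ab by (simp add: L2_sq_def I_def measure_restrict_space)
  also have "\<dots> = L2_sq a b u - I\<^sup>2 / (b - a)"
  proof -
    have "m * (b - a) = I"
      using ab by (simp add: m_def)
    then have "m\<^sup>2 * (b - a) = m * I"
      by (simp add: power2_eq_square mult.assoc)
    then show ?thesis
      by (simp add: m_def power2_eq_square)
  qed
  finally have "I\<^sup>2 \<le> (b - a) * L2_sq a b u"
    using ab by (simp add: field_simps)
  then show "I \<le> sqrt ((b - a) * L2_sq a b u)"
    by (rule real_le_rsqrt)
qed

lemma in_L2_continuous:
  fixes f :: "real \<Rightarrow> 'a::euclidean_space"
  assumes "continuous_on {a..b} f"
  shows "in_L2 a b f"
  unfolding in_L2_def
  using assms by (auto intro!: borel_measurable_integrable integrable_continuous_Ioo continuous_intros)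

lemma L2_sq_le_const:
  fixes f :: "real \<Rightarrow> 'a::euclidean_space"
  assumes f: "in_L2 a b f" and le: "\<And>x. x \<in> {a<..<b} \<Longrightarrow> norm (f x) \<le> B" and "a \<le> b"
  shows "L2_sq a b f \<le> B\<^sup>2 * (b - a)"
proof -
  interpret finite_measure "lebesgue_on {a<..<b}"
    by (rule finite_measure_lebesgue_on_Ioo)
  have "L2_sq a b f \<le> integral\<^sup>L (lebesgue_on {a<..<b}) (\<lambda>x. B\<^sup>2)"
    unfolding L2_sq_def using f le by (intro integral_mono power_mono) (auto simp: in_L2_def)
  then show ?thesis
    using assms(3) by (simp add: measure_restrict_space mult.commute)
qed

lemma in_L2_imp_locally_integrable:
  assumes "in_L2 a b u" "a < b"
  shows "locally_integrable a b u"
proof -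
  have "set_integrable lebesgue {a<..<b} u"
    using in_L2_imp_integrable[OF assms] by (simp add: set_integrable_def integrable_restrict_space)
  then show ?thesis
    unfolding locally_integrable_def
    using set_integrable_subset lmeasurable_compact by blast
qed

lemma AE_L2_cong:
  fixes u :: "real \<Rightarrow> 'a::euclidean_space"
  assumes "in_L2 a b u" "AE x in lebesgue_on {a<..<b}. v x = u x"
  shows "L2_sq a b v = L2_sq a b u"
  unfolding L2_sq_def
proof (rule integral_lebesgue_on_cong_AE)
  show "AE x in lebesgue_on {a<..<b}. (norm (v x))\<^sup>2 = (norm (u x))\<^sup>2"
    using assms(2) by (rule eventually_mono) simp
qed (use assms(1) in \<open>auto simp: in_L2_def\<close>)

lemma L2_dominated_convergence:
  fixes f :: "nat \<Rightarrow> real \<Rightarrow> 'a::euclidean_space"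
  assumes f: "\<And>n. f n \<in> borel_measurable (lebesgue_on {a<..<b})"
    and u: "u \<in> borel_measurable (lebesgue_on {a<..<b})"
    and w: "integrable (lebesgue_on {a<..<b}) (w :: real \<Rightarrow> real)"
    and lim: "AE x in lebesgue_on {a<..<b}. (\<lambda>n. f n x) \<longlonglongrightarrow> u x"
    and bound: "\<And>n. AE x in lebesgue_on {a<..<b}. (norm (f n x - u x))\<^sup>2 \<le> w x"
  shows "(\<lambda>n. L2_sq a b (\<lambda>x. f n x - u x)) \<longlonglongrightarrow> 0"
proof -
  let ?M = "lebesgue_on {a<..<b}"
  have "(\<lambda>n. integral\<^sup>L ?M (\<lambda>x. (norm (f n x - u x))\<^sup>2)) \<longlonglongrightarrow> integral\<^sup>L ?M (\<lambda>x. 0)"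
  proof (rule integral_dominated_convergence[OF _ _ w])
    show "AE x in ?M. (\<lambda>n. (norm (f n x - u x))\<^sup>2) \<longlonglongrightarrow> 0"
      using lim
    proof (rule AE_mp, intro AE_I2 impI)
      fix x assume "(\<lambda>n. f n x) \<longlonglongrightarrow> u x"
      then have "(\<lambda>n. (norm (f n x - u x))\<^sup>2) \<longlonglongrightarrow> (norm (u x - u x))\<^sup>2"
        by (intro tendsto_intros)
      then show "(\<lambda>n. (norm (f n x - u x))\<^sup>2) \<longlonglongrightarrow> 0"
        by simp
    qed
  qed (use f u bound in auto)
  then show ?thesis
    by (simp add: L2_sq_def)
qed

text \<open>The nearest-point projection onto a ball serves as a continuous truncation.\<close>

lemma L2_truncation:
  fixes u :: "real \<Rightarrow> 'a::euclidean_space"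
  assumes u: "in_L2 a b u"
  shows "(\<lambda>n. L2_sq a b (\<lambda>x. closest_point (cball 0 (real n)) (u x) - u x)) \<longlonglongrightarrow> 0"
proof (rule L2_dominated_convergence)
  show "(\<lambda>x. closest_point (cball 0 (real n)) (u x)) \<in> borel_measurable (lebesgue_on {a<..<b})" for n
    using u by (intro borel_measurable_continuous_on[OF continuous_on_closest_point]) (auto simp: in_L2_def)
  show "AE x in lebesgue_on {a<..<b}. (\<lambda>n. closest_point (cball 0 (real n)) (u x)) \<longlonglongrightarrow> u x"
  proof (intro AE_I2 tendsto_eventually)
    fix x
    obtain N where "norm (u x) \<le> real N"
      using real_arch_simple by blast
    then have "norm (u x) \<le> real n" if "n \<ge> N" for n
      using that by (meson of_nat_mono order_trans)
    then show "\<forall>\<^sub>F n in sequentially. closest_point (cball 0 (real n)) (u x) = u x"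
      by (auto simp: eventually_sequentially intro!: exI[of _ N] closest_point_self)
  qed
  show "AE x in lebesgue_on {a<..<b}. (norm (closest_point (cball 0 (real n)) (u x) - u x))\<^sup>2 \<le> (norm (u x))\<^sup>2" for n
  proof (intro AE_I2 power_mono)
    fix x
    show "norm (closest_point (cball 0 (real n)) (u x) - u x) \<le> norm (u x)"
      using closest_point_le[of "cball 0 (real n)" 0 "u x"] by (simp add: dist_norm norm_minus_commute)
  qed auto
qed (use u in \<open>auto simp: in_L2_def\<close>)

text \<open>A measurable function is an a.e. limit of continuous ones. Composing with the projection
  onto the ball keeps them continuous and bounds the error by \<open>2 * m\<close>, so dominated
  convergence applies.\<close>

lemma L2_approx_bounded_by_continuous:
  fixes u :: "real \<Rightarrow> 'a::euclidean_space"
  assumes u: "u \<in> borel_measurable (lebesgue_on {a<..<b})"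
    and e: "e > 0"
  obtains g where "continuous_on UNIV g"
    "L2_sq a b (\<lambda>x. g x - closest_point (cball 0 (real m)) (u x)) < e"
proof -
  interpret finite_measure "lebesgue_on {a<..<b}"
    by (rule finite_measure_lebesgue_on_Ioo)
  let ?c = "closest_point (cball (0::'a) (real m))"
  have c: "continuous_on UNIV ?c"
    by (intro continuous_on_closest_point) auto
  have cb: "norm (?c z) \<le> real m" for z
    using closest_point_in_set[of "cball (0::'a) (real m)" z] by simp
  have "u measurable_on {a<..<b}"
    using u by (simp add: measurable_on_iff_borel_measurable)
  then obtain N g where N: "negligible N" and g: "\<And>n. continuous_on UNIV (g n)"
    and lim: "\<And>x. x \<notin> N \<Longrightarrow> (\<lambda>n. g n x) \<longlonglongrightarrow> (if x \<in> {a<..<b} then u x else 0)"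
    unfolding measurable_on_def by blast
  have cg: "continuous_on UNIV (\<lambda>x. ?c (g n x))" for n
    using continuous_on_compose[OF g continuous_on_subset[OF c subset_UNIV], of n] by (simp add: o_def)
  have "(\<lambda>n. L2_sq a b (\<lambda>x. ?c (g n x) - ?c (u x))) \<longlonglongrightarrow> 0"
  proof (rule L2_dominated_convergence)
    show "(\<lambda>x. ?c (g n x)) \<in> borel_measurable (lebesgue_on {a<..<b})" for n
      using continuous_on_subset[OF cg] by (intro continuous_imp_measurable_on_sets_lebesgue) auto
    show "(\<lambda>x. ?c (u x)) \<in> borel_measurable (lebesgue_on {a<..<b})"
      using u by (intro borel_measurable_continuous_on[OF c])
    have "(\<lambda>n. ?c (g n x)) \<longlonglongrightarrow> ?c (u x)" if "x \<in> {a<..<b} - N" for x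
      using lim[of x] that continuous_on_tendsto_compose[OF c] by auto
    then show "AE x in lebesgue_on {a<..<b}. (\<lambda>n. ?c (g n x)) \<longlonglongrightarrow> ?c (u x)"
      using N by (subst AE_lebesgue_on_iff_negligible) auto
    show "AE x in lebesgue_on {a<..<b}. (norm (?c (g n x) - ?c (u x)))\<^sup>2 \<le> (2 * real m)\<^sup>2" for n
    proof (intro AE_I2 power_mono)
      fix x
      show "norm (?c (g n x) - ?c (u x)) \<le> 2 * real m"
        using norm_triangle_ineq4[of "?c (g n x)" "?c (u x)"] cb[of "g n x"] cb[of "u x"] by linarith
    qed auto
  qed simp
  then obtain n where "L2_sq a b (\<lambda>x. ?c (g n x) - ?c (u x)) < e"
    using order_tendstoD(2)[OF _ e] eventually_happens'[OF sequentially_bot] by blast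
  then show thesis
    using that cg by blast
qed

lemma L2_approx_by_polynomial:
  fixes u :: "real \<Rightarrow> 'a::euclidean_space"
  assumes u: "in_L2 a b u" and ab: "a < b" and e: "e > 0"
  obtains p where "polynomial_function p" "L2_sq a b (\<lambda>x. p x - u x) \<le> e"
proof -
  \<comment> \<open>The two errors of \<open>e / 16\<close> combine to \<open>e / 4\<close>, and
    with the Weierstrass error \<open>e / 8\<close> the total is
    \<open>2 * (e / 8) + 2 * (e / 4)\<close>, below \<open>e\<close>.\<close>
  have e16: "e / 16 > 0"
    using e by simp
  let ?c = "\<lambda>m. closest_point (cball (0::'a) (real m))"
  obtain m where m: "L2_sq a b (\<lambda>x. ?c m (u x) - u x) < e / 16"
    using order_tendstoD(2)[OF L2_truncation[OF u] e16] eventually_happens'[OF sequentially_bot] by blast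
  obtain g where g: "continuous_on UNIV g" "L2_sq a b (\<lambda>x. g x - ?c m (u x)) < e / 16"
    using L2_approx_bounded_by_continuous[OF _ e16, of u a b m] u unfolding in_L2_def by blast
  \<comment> \<open>A uniform error of \<open>\<eta>\<close> has \<open>L2_sq\<close> at most
    \<open>e / 8\<close>.\<close>
  define \<eta> where "\<eta> = sqrt (e / (8 * (b - a)))"
  have "\<eta> > 0"
    using e ab by (simp add: \<eta>_def)
  then obtain p where p: "polynomial_function p" "\<And>x. x \<in> {a..b} \<Longrightarrow> norm (g x - p x) < \<eta>"
    using Stone_Weierstrass_polynomial_function[OF compact_Icc continuous_on_subset[OF g(1) subset_UNIV], of \<eta> a b] by blast
  have "continuous_on {a..b} (\<lambda>x. p x - g x)"
    using continuous_on_subset[OF g(1)]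
    by (intro continuous_on_diff continuous_on_polymonial_function[OF p(1)]) auto
  then have pg: "in_L2 a b (\<lambda>x. p x - g x)"
    by (rule in_L2_continuous)
  have "L2_sq a b (\<lambda>x. p x - g x) \<le> \<eta>\<^sup>2 * (b - a)"
    using ab p(2) by (intro L2_sq_le_const[OF pg]) (auto simp: norm_minus_commute less_imp_le)
  also have "\<dots> = e / 8"
    using e ab by (simp add: \<eta>_def nonzero_divide_eq_eq)
  finally have 1: "L2_sq a b (\<lambda>x. p x - g x) \<le> e / 8" .
  interpret finite_measure "lebesgue_on {a<..<b}"
    by (rule finite_measure_lebesgue_on_Ioo)
  have cu: "in_L2 a b (\<lambda>x. ?c m (u x))"
  proof (rule in_L2I[of _ _ _ "\<lambda>_. (real m)\<^sup>2"])
    show "(\<lambda>x. ?c m (u x)) \<in> borel_measurable (lebesgue_on {a<..<b})"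
      using u by (intro borel_measurable_continuous_on[OF continuous_on_closest_point]) (auto simp: in_L2_def)
    show "(norm (?c m (u x)))\<^sup>2 \<le> (real m)\<^sup>2" for x
      using closest_point_in_set[of "cball (0::'a) (real m)" "u x"] by (intro power_mono) auto
  qed simp
  have gL2: "in_L2 a b g"
    using continuous_on_subset[OF g(1)] by (intro in_L2_continuous) auto
  have "L2_sq a b (\<lambda>x. (g x - ?c m (u x)) + (?c m (u x) - u x)) \<le> 2 * (e / 16) + 2 * (e / 16)"
    using L2_sq_add[OF in_L2_diff[OF gL2 cu] in_L2_diff[OF cu u]] g(2) m by linarith
  then have 2: "L2_sq a b (\<lambda>x. g x - u x) \<le> e / 4"
    by simp
  have "L2_sq a b (\<lambda>x. (p x - g x) + (g x - u x)) \<le> e"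
    using L2_sq_add[OF pg in_L2_diff[OF gL2 u]] 1 2 e by linarith
  then show thesis
    using that[OF p(1)] by simp
qed

section \<open>Sobolev functions on an interval\<close>

text \<open>Integration by parts; the boundary terms vanish because a test function is zero at both
  end points.\<close>

lemma has_weak_derivative_C1:
  fixes f :: "real \<Rightarrow> 'a::euclidean_space"
  assumes f: "\<And>x. x \<in> {a..b} \<Longrightarrow> (f has_vector_derivative f' x) (at x within {a..b})"
    and f': "continuous_on {a..b} f'" and ab: "a < b"
  shows "has_weak_derivative a b f f'"
  unfolding has_weak_derivative_def
proof (intro conjI allI impI)
  have cf: "continuous_on {a..b} f"
    using f by (rule continuous_on_vector_derivative)
  show "locally_integrable a b f" "locally_integrable a b f'"
    using in_L2_imp_locally_integrable[OF in_L2_continuous] cf f' ab by blast+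
  fix \<phi> assume "test_function a b \<phi>"
  then obtain c d where cd: "a < c" "c < d" "d < b" and supp: "{x. \<phi> x \<noteq> 0} \<subseteq> {c..d}"
    and cont: "continuous_on UNIV \<phi>" "continuous_on UNIV (deriv \<phi>)"
    and der: "\<And>x. (\<phi> has_real_derivative deriv \<phi> x) (at x)"
    using test_function_facts[OF _ ab] by metis
  have "a \<notin> {c..d}" "b \<notin> {c..d}"
    using cd by auto
  then have zero: "\<phi> a = 0" "\<phi> b = 0"
    using supp by auto
  have "((\<lambda>x. \<phi> x *\<^sub>R f x) has_vector_derivative \<phi> x *\<^sub>R f' x + deriv \<phi> x *\<^sub>R f x) (at x within {a..b})"
    if "x \<in> {a..b}" for x
    using f[OF that] der[of x] has_field_derivative_at_within
    by (intro has_vector_derivative_scaleR) blast+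
  then have "((\<lambda>x. \<phi> x *\<^sub>R f' x + deriv \<phi> x *\<^sub>R f x) has_integral (\<phi> b *\<^sub>R f b - \<phi> a *\<^sub>R f a)) {a..b}"
    using ab by (intro fundamental_theorem_of_calculus) auto
  then have "integral {a..b} (\<lambda>x. \<phi> x *\<^sub>R f' x + deriv \<phi> x *\<^sub>R f x) = 0"
    by (simp add: zero integral_unique)
  moreover have c1: "continuous_on {a..b} (\<lambda>x. \<phi> x *\<^sub>R f' x)" "continuous_on {a..b} (\<lambda>x. deriv \<phi> x *\<^sub>R f x)"
    using continuous_on_subset[OF cont(1)] continuous_on_subset[OF cont(2)] cf f'
    by (auto intro!: continuous_on_scaleR)
  ultimately have "integral {a..b} (\<lambda>x. \<phi> x *\<^sub>R f' x) + integral {a..b} (\<lambda>x. deriv \<phi> x *\<^sub>R f x) = 0"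
    by (subst (asm) Henstock_Kurzweil_Integration.integral_add) (auto intro: integrable_continuous_interval)
  then show "integral\<^sup>L (lebesgue_on {a<..<b}) (\<lambda>x. deriv \<phi> x *\<^sub>R f x) =
    - integral\<^sup>L (lebesgue_on {a<..<b}) (\<lambda>x. \<phi> x *\<^sub>R f' x)"
    unfolding integral_continuous_Ioo[OF c1(1)] integral_continuous_Ioo[OF c1(2)]
    by (simp add: eq_neg_iff_add_eq_0 add.commute)
qed

lemma tendsto_integral_scaleR_L1:
  fixes w :: "real \<Rightarrow> 'a::euclidean_space"
  assumes wn: "\<And>n. integrable (lebesgue_on {a<..<b}) (W n)" and w: "integrable (lebesgue_on {a<..<b}) w"
    and lim: "(\<lambda>n. integral\<^sup>L (lebesgue_on {a<..<b}) (\<lambda>x. norm (W n x - w x))) \<longlonglongrightarrow> 0"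
    and f: "continuous_on UNIV f"
  shows "(\<lambda>n. integral\<^sup>L (lebesgue_on {a<..<b}) (\<lambda>x. f x *\<^sub>R W n x)) \<longlonglongrightarrow>
    integral\<^sup>L (lebesgue_on {a<..<b}) (\<lambda>x. f x *\<^sub>R w x)"
proof -
  let ?M = "lebesgue_on {a<..<b}"
  have fc: "continuous_on {a..b} f"
    using continuous_on_subset[OF f] by auto
  obtain B where B: "\<And>x. x \<in> {a..b} \<Longrightarrow> \<bar>f x\<bar> \<le> B"
    using compact_imp_bounded[OF compact_continuous_image[OF fc compact_Icc]]
    by (meson bounded_real imageI)
  have meas: "f \<in> borel_measurable ?M"
    using continuous_on_subset[OF f] by (intro continuous_imp_measurable_on_sets_lebesgue) auto
  have int: "integrable ?M (\<lambda>x. f x *\<^sub>R v x)" if "integrable ?M v" for v :: "real \<Rightarrow> 'a"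
    using that meas B by (intro integrable_bounded_scaleR[where B = B]) auto
  have "(\<lambda>n. integral\<^sup>L ?M (\<lambda>x. f x *\<^sub>R W n x) - integral\<^sup>L ?M (\<lambda>x. f x *\<^sub>R w x)) \<longlonglongrightarrow> 0"
  proof (rule Lim_null_comparison)
    show "(\<lambda>n. B * integral\<^sup>L ?M (\<lambda>x. norm (W n x - w x))) \<longlonglongrightarrow> 0"
      using tendsto_mult_left[OF lim, of B] by simp
    show "\<forall>\<^sub>F n in sequentially. norm (integral\<^sup>L ?M (\<lambda>x. f x *\<^sub>R W n x) - integral\<^sup>L ?M (\<lambda>x. f x *\<^sub>R w x))
        \<le> B * integral\<^sup>L ?M (\<lambda>x. norm (W n x - w x))"
    proof (intro always_eventually allI)
      fix n
      have d: "integrable ?M (\<lambda>x. W n x - w x)"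
        using wn w by simp
      have "norm (integral\<^sup>L ?M (\<lambda>x. f x *\<^sub>R W n x) - integral\<^sup>L ?M (\<lambda>x. f x *\<^sub>R w x))
          = norm (integral\<^sup>L ?M (\<lambda>x. f x *\<^sub>R (W n x - w x)))"
        using int wn w by (simp add: scaleR_diff_right)
      also have "\<dots> \<le> integral\<^sup>L ?M (\<lambda>x. norm (f x *\<^sub>R (W n x - w x)))"
        by (rule integral_norm_bound)
      also have "\<dots> \<le> integral\<^sup>L ?M (\<lambda>x. B * norm (W n x - w x))"
        using int[OF d] d B
        by (intro integral_mono integrable_norm integrable_mult_right) (auto intro!: mult_right_mono)
      finally show "norm (integral\<^sup>L ?M (\<lambda>x. f x *\<^sub>R W n x) - integral\<^sup>L ?M (\<lambda>x. f x *\<^sub>R w x))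
        \<le> B * integral\<^sup>L ?M (\<lambda>x. norm (W n x - w x))"
        by simp
    qed
  qed
  then show ?thesis
    by (simp add: LIM_zero_iff)
qed

text \<open>Closedness of weak differentiation. On a bounded interval L^2 convergence implies L^1
  convergence, and a test function and its derivative are bounded, so both sides of the defining
  identity pass to the limit.\<close>

lemma has_weak_derivative_limit:
  fixes u v :: "real \<Rightarrow> 'a::euclidean_space"
  assumes ab: "a < b" and weak: "\<And>n. has_weak_derivative a b (U n) (V n)"
    and L2: "\<And>n. in_L2 a b (U n)" "\<And>n. in_L2 a b (V n)" "in_L2 a b u" "in_L2 a b v"
    and U: "(\<lambda>n. L2_sq a b (\<lambda>x. U n x - u x)) \<longlonglongrightarrow> 0"
    and V: "(\<lambda>n. L2_sq a b (\<lambda>x. V n x - v x)) \<longlonglongrightarrow> 0"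
  shows "has_weak_derivative a b u v"
  unfolding has_weak_derivative_def
proof (intro conjI allI impI)
  let ?M = "lebesgue_on {a<..<b}"
  show "locally_integrable a b u" "locally_integrable a b v"
    using L2 ab by (auto intro: in_L2_imp_locally_integrable)
  fix \<phi> assume \<phi>: "test_function a b \<phi>"
  then have cont: "continuous_on UNIV \<phi>" "continuous_on UNIV (deriv \<phi>)"
    using test_function_facts[OF _ ab] by metis+
  have L1: "(\<lambda>n. integral\<^sup>L ?M (\<lambda>x. norm (W n x - w x))) \<longlonglongrightarrow> 0"
    if "(\<lambda>n. L2_sq a b (\<lambda>x. W n x - w x)) \<longlonglongrightarrow> 0" "\<And>n. in_L2 a b (W n)" "in_L2 a b w" for W and w :: "real \<Rightarrow> 'a"
  proof (rule Lim_null_comparison)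
    show "(\<lambda>n. sqrt ((b - a) * L2_sq a b (\<lambda>x. W n x - w x))) \<longlonglongrightarrow> 0"
      using tendsto_real_sqrt[OF tendsto_mult_left[OF that(1), of "b - a"]] by simp
    show "\<forall>\<^sub>F n in sequentially. norm (integral\<^sup>L ?M (\<lambda>x. norm (W n x - w x)))
        \<le> sqrt ((b - a) * L2_sq a b (\<lambda>x. W n x - w x))"
      using integral_norm_le_L2[OF in_L2_diff[OF that(2,3)] ab] by (intro always_eventually allI) simp
  qed
  have "(\<lambda>n. integral\<^sup>L ?M (\<lambda>x. deriv \<phi> x *\<^sub>R U n x)) \<longlonglongrightarrow> integral\<^sup>L ?M (\<lambda>x. deriv \<phi> x *\<^sub>R u x)"
    using L2 ab U by (intro tendsto_integral_scaleR_L1 cont L1 in_L2_imp_integrable)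
  moreover have "(\<lambda>n. - integral\<^sup>L ?M (\<lambda>x. \<phi> x *\<^sub>R V n x)) \<longlonglongrightarrow> - integral\<^sup>L ?M (\<lambda>x. \<phi> x *\<^sub>R v x)"
    using L2 ab V by (intro tendsto_minus tendsto_integral_scaleR_L1 cont L1 in_L2_imp_integrable)
  moreover have "integral\<^sup>L ?M (\<lambda>x. deriv \<phi> x *\<^sub>R U n x) = - integral\<^sup>L ?M (\<lambda>x. \<phi> x *\<^sub>R V n x)" for n
    using weak \<phi> by (auto simp: has_weak_derivative_def)
  ultimately show "integral\<^sup>L ?M (\<lambda>x. deriv \<phi> x *\<^sub>R u x) = - integral\<^sup>L ?M (\<lambda>x. \<phi> x *\<^sub>R v x)"
    using LIMSEQ_unique by simp
qed

lemma continuous_on_primitive: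
  fixes v :: "real \<Rightarrow> 'a::euclidean_space"
  assumes "integrable (lebesgue_on {a<..<b}) v"
  shows "continuous_on {a..b} (\<lambda>x. integral {a..x} v)"
  using integrable_Ioo_imp_Icc[OF assms] by (intro indefinite_integral_continuous_1) auto

lemma norm_primitive_diff_le:
  fixes u v :: "real \<Rightarrow> 'a::euclidean_space"
  assumes u: "in_L2 a b u" and v: "in_L2 a b v" and ab: "a < b" and x: "x \<in> {a..b}"
  shows "norm (integral {a..x} u - integral {a..x} v) \<le> sqrt ((b - a) * L2_sq a b (\<lambda>x. u x - v x))"
proof -
  have sub: "{a..x} \<subseteq> {a..b}"
    using x by auto
  have "integral {a..x} u - integral {a..x} v = integral {a..x} (\<lambda>x. u x - v x)"
    using integrable_Ioo_imp_Icc[OF in_L2_imp_integrable[OF u ab] sub]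
      integrable_Ioo_imp_Icc[OF in_L2_imp_integrable[OF v ab] sub]
    by (simp add: Henstock_Kurzweil_Integration.integral_diff)
  then show ?thesis
    using norm_integral_Icc_le[OF in_L2_imp_integrable[OF in_L2_diff[OF u v] ab] sub]
      integral_norm_le_L2[OF in_L2_diff[OF u v] ab] by simp
qed

text \<open>Polynomial approximants of \<open>v\<close> have C^1 primitives, for which this is
  integration by parts. Taking primitives is bounded from L^2 to the uniform norm, so closedness
  carries the statement over to \<open>v\<close>.\<close>

lemma has_weak_derivative_primitive:
  fixes v :: "real \<Rightarrow> 'a::euclidean_space"
  assumes v: "in_L2 a b v" and ab: "a < b"
  shows "has_weak_derivative a b (\<lambda>x. integral {a..x} v) v"
proof -
  have "\<exists>p. polynomial_function p \<and> L2_sq a b (\<lambda>x. p x - v x) \<le> 1 / real (Suc n)" for n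
    using L2_approx_by_polynomial[OF v ab, of "1 / real (Suc n)"] by auto
  then obtain p where p: "\<And>n. polynomial_function (p n)" "\<And>n. L2_sq a b (\<lambda>x. p n x - v x) \<le> 1 / real (Suc n)"
    by metis
  have cp: "continuous_on S (p n)" for n S
    using p(1) by (rule continuous_on_polymonial_function)
  have L2p: "in_L2 a b (p n)" for n
    using cp by (rule in_L2_continuous)
  have lim: "(\<lambda>n. L2_sq a b (\<lambda>x. p n x - v x)) \<longlonglongrightarrow> 0"
  proof (rule Lim_null_comparison[OF _ LIMSEQ_inverse_real_of_nat])
    show "\<forall>\<^sub>F n in sequentially. norm (L2_sq a b (\<lambda>x. p n x - v x)) \<le> inverse (real (Suc n))"
      using p(2) by (intro always_eventually allI) (simp add: L2_sq_nonneg inverse_eq_divide)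
  qed
  have prim: "in_L2 a b (\<lambda>x. integral {a..x} w)" if "in_L2 a b w" for w :: "real \<Rightarrow> 'a"
    using in_L2_imp_integrable[OF that ab] by (intro in_L2_continuous continuous_on_primitive)
  show ?thesis
  proof (rule has_weak_derivative_limit[OF ab _ prim[OF L2p] L2p prim[OF v] v _ lim])
    show "has_weak_derivative a b (\<lambda>x. integral {a..x} (p n)) (p n)" for n
      using integral_has_vector_derivative[OF cp] cp ab by (intro has_weak_derivative_C1) auto
    let ?e = "\<lambda>n. (b - a) * L2_sq a b (\<lambda>x. p n x - v x)"
    show "(\<lambda>n. L2_sq a b (\<lambda>x. integral {a..x} (p n) - integral {a..x} v)) \<longlonglongrightarrow> 0"
    proof (rule Lim_null_comparison)
      show "(\<lambda>n. ?e n * (b - a)) \<longlonglongrightarrow> 0"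
        using tendsto_mult_right[OF tendsto_mult_left[OF lim, of "b - a"], of "b - a"] by simp
      have "L2_sq a b (\<lambda>x. integral {a..x} (p n) - integral {a..x} v) \<le> (sqrt (?e n))\<^sup>2 * (b - a)" for n
        using ab norm_primitive_diff_le[OF L2p v ab]
        by (intro L2_sq_le_const in_L2_diff prim L2p v) auto
      then show "\<forall>\<^sub>F n in sequentially. norm (L2_sq a b (\<lambda>x. integral {a..x} (p n) - integral {a..x} v)) \<le> ?e n * (b - a)"
        using ab by (simp add: L2_sq_nonneg)
    qed
  qed
qed

section \<open>Independence of the chosen derivatives and representatives\<close>

lemma has_weak_derivative_cong_AE:
  fixes u u' :: "real \<Rightarrow> 'a::euclidean_space"
  assumes weak: "has_weak_derivative a b u v" and eq: "AE x in lebesgue_on {a<..<b}. u' x = u x" and ab: "a < b"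
  shows "has_weak_derivative a b u' v"
proof -
  have u: "locally_integrable a b u"
    using weak by (simp add: has_weak_derivative_def)
  obtain N where N: "negligible N" "\<And>x. x \<in> {a<..<b} - N \<Longrightarrow> u' x = u x"
    using eq by (auto simp: AE_lebesgue_on_iff_negligible)
  have "u' absolutely_integrable_on K" if K: "compact K" "K \<subseteq> {a<..<b}" for K
  proof (rule absolutely_integrable_spike[OF _ N(1)])
    show "u absolutely_integrable_on K"
      using u K by (simp add: locally_integrable_def)
    show "u' x = u x" if "x \<in> K - N" for x
      using that K(2) by (intro N(2)) blast
  qed
  then have u': "locally_integrable a b u'"
    by (simp add: locally_integrable_def)
  have "integral\<^sup>L (lebesgue_on {a<..<b}) (\<lambda>x. deriv \<phi> x *\<^sub>R u' x) =
      integral\<^sup>L (lebesgue_on {a<..<b}) (\<lambda>x. deriv \<phi> x *\<^sub>R u x)" if \<phi>: "test_function a b \<phi>" for \<phi>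
  proof (rule integral_lebesgue_on_cong_AE)
    obtain c d where "a < c" "d < b" "{x. deriv \<phi> x \<noteq> 0} \<subseteq> {c..d}" "continuous_on UNIV (deriv \<phi>)"
      using test_function_facts[OF \<phi> ab] by metis
    then show "integrable (lebesgue_on {a<..<b}) (\<lambda>x. deriv \<phi> x *\<^sub>R u x)"
      by (intro integrable_test_function_scaleR[OF u])
    show "AE x in lebesgue_on {a<..<b}. deriv \<phi> x *\<^sub>R u' x = deriv \<phi> x *\<^sub>R u x"
      using eq by (rule eventually_mono) simp
  qed auto
  then show ?thesis
    using weak u' by (simp add: has_weak_derivative_def)
qed

lemma weak_deriv_AE:
  assumes "has_weak_derivative a b u v" "a < b"
  shows "AE x in lebesgue_on {a<..<b}. weak_deriv a b u x = v x"
proof -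
  have "has_weak_derivative a b u (weak_deriv a b u)"
    unfolding weak_deriv_def by (rule someI[of _ v]) (rule assms(1))
  then show ?thesis
    by (rule weak_derivative_unique[OF _ assms])
qed

lemma H1_norm_eq:
  assumes "has_weak_derivative a b u v" "in_L2 a b v" "a < b"
  shows "H1_norm a b u = sqrt (L2_sq a b u + L2_sq a b v)"
  unfolding H1_norm_def L2_sq_def[symmetric]
  using AE_L2_cong[OF assms(2) weak_deriv_AE[OF assms(1,3)]] by simp

text \<open>The inner \<open>weak_deriv\<close> agrees with \<open>v\<close> only a.e., so
  \<open>w\<close> must first be recognised as its weak derivative before the outer choice can be
  compared with \<open>w\<close>.\<close>

lemma H2_norm_eq:
  assumes "has_weak_derivative a b u v" "has_weak_derivative a b v w" "in_L2 a b v" "in_L2 a b w" "a < b"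
  shows "H2_norm a b u = sqrt (L2_sq a b u + L2_sq a b v + L2_sq a b w)"
  unfolding H2_norm_def L2_sq_def[symmetric]
  using AE_L2_cong[OF assms(3) weak_deriv_AE[OF assms(1,5)]]
    AE_L2_cong[OF assms(4) weak_deriv_AE[OF has_weak_derivative_cong_AE[OF assms(2)
      weak_deriv_AE[OF assms(1,5)] assms(5)] assms(5)]] by simp

text \<open>The set of disagreement inside the open interval is open and negligible, hence empty;
  the end points follow by continuity.\<close>

lemma continuous_AE_eq_imp_eq:
  fixes g h :: "real \<Rightarrow> 'a::euclidean_space"
  assumes g: "continuous_on {a..b} g" and h: "continuous_on {a..b} h"
    and eq: "AE x in lebesgue_on {a<..<b}. g x = h x" and ab: "a < b" and x: "x \<in> {a..b}"
  shows "g x = h x"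
proof -
  obtain N where N: "negligible N" "\<And>x. x \<in> {a<..<b} - N \<Longrightarrow> g x = h x"
    using eq by (auto simp: AE_lebesgue_on_iff_negligible)
  have c: "continuous_on {a..b} (\<lambda>x. g x - h x)"
    using g h by (rule continuous_on_diff)
  have "open ({a<..<b} \<inter> (\<lambda>x. g x - h x) -` (- {0}))"
    using continuous_on_subset[OF c, of "{a<..<b}"] by (intro continuous_open_preimage) (auto simp: subset_eq)
  moreover have "{a<..<b} \<inter> (\<lambda>x. g x - h x) -` (- {0}) \<subseteq> N"
    using N(2) by auto
  ultimately have "{a<..<b} \<inter> (\<lambda>x. g x - h x) -` (- {0}) = {}"
    using N(1) negligible_subset open_not_negligible by blast
  then have zero: "g x - h x = 0" if "x \<in> {a<..<b}" for x
    using that by auto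
  have "g x - h x = 0"
    using continuous_constant_on_closure[of "{a<..<b}" "\<lambda>x. g x - h x" 0 x] c zero x ab
    by (simp add: closure_greaterThanLessThan)
  then show ?thesis
    by simp
qed

lemma cont_rep_eq:
  fixes g :: "real \<Rightarrow> 'a::euclidean_space"
  assumes g: "continuous_on {a..b} g" and eq: "AE x in lebesgue_on {a<..<b}. g x = u x" and ab: "a < b"
    and x: "x \<in> {a..b}"
  shows "cont_rep a b u x = g x"
proof -
  have *: "continuous_on {a..b} (cont_rep a b u) \<and> (AE x in lebesgue_on {a<..<b}. cont_rep a b u x = u x)"
    unfolding cont_rep_def by (rule someI[of _ g]) (use g eq in blast)
  then have "AE x in lebesgue_on {a<..<b}. cont_rep a b u x = u x"
    by blast
  then have "AE x in lebesgue_on {a<..<b}. cont_rep a b u x = g x"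
    using eq by eventually_elim simp
  then show ?thesis
    using * g ab x by (intro continuous_AE_eq_imp_eq[of a b]) auto
qed

text \<open>Subtracting the primitive of \<open>v\<close> leaves a function with weak derivative
  zero, hence an a.e. constant. The result is the absolutely continuous representative.\<close>

lemma weak_derivative_imp_primitive:
  fixes u v :: "real \<Rightarrow> 'a::euclidean_space"
  assumes weak: "has_weak_derivative a b u v" and v: "in_L2 a b v" and ab: "a < b"
  obtains g where "continuous_on {a..b} g" "AE x in lebesgue_on {a<..<b}. g x = u x"
    "\<And>x. x \<in> {a..b} \<Longrightarrow> g x = g a + integral {a..x} v"
proof -
  have "has_weak_derivative a b (\<lambda>x. u x - integral {a..x} v) (\<lambda>_. 0)"
    using has_weak_derivative_diff[OF weak has_weak_derivative_primitive[OF v ab] ab] by simp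
  then obtain C where C: "AE x in lebesgue_on {a<..<b}. u x - integral {a..x} v = C"
    using weak_derivative_zero_imp_const[OF _ ab] by blast
  show ?thesis
  proof
    show "continuous_on {a..b} (\<lambda>x. C + integral {a..x} v)"
      using continuous_on_primitive[OF in_L2_imp_integrable[OF v ab]] by (intro continuous_intros)
    show "AE x in lebesgue_on {a<..<b}. C + integral {a..x} v = u x"
      using C by (rule eventually_mono) (auto simp: algebra_simps)
  qed simp
qed

lemma antiderivative_polynomial_function:
  fixes p :: "real \<Rightarrow> 'a::euclidean_space"
  assumes "polynomial_function p"
  obtains P where "polynomial_function P" "\<And>x. (P has_vector_derivative p x) (at x)"
proof -
  have real: "\<exists>Q. real_polynomial_function Q \<and> (\<forall>x. (Q has_real_derivative q x) (at x))"
    if "real_polynomial_function q" for q :: "real \<Rightarrow> real"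
  proof -
    obtain c n where q: "q = (\<lambda>x. \<Sum>i\<le>n. c i * x ^ i)"
      using \<open>real_polynomial_function q\<close> real_polynomial_function_iff_sum by blast
    let ?Q = "\<lambda>x. \<Sum>i\<le>n. (c i / real (Suc i)) * x ^ Suc i"
    have "real_polynomial_function (\<lambda>x::real. x)"
      by (simp add: real_polynomial_function.intros(1))
    then have "real_polynomial_function ?Q"
      by (intro real_polynomial_function_sum real_polynomial_function.intros(2,4) real_polynomial_function_power) auto
    moreover have "(?Q has_real_derivative q x) (at x)" for x
      unfolding q by (rule DERIV_sum) (auto intro!: derivative_eq_intros simp del: power_Suc)
    ultimately show ?thesis
      by blast
  qed
  have "\<forall>e\<in>Basis. \<exists>Q. real_polynomial_function Q \<and> (\<forall>x. (Q has_real_derivative p x \<bullet> e) (at x))"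
    using assms real by (auto simp: polynomial_function_iff_Basis_inner)
  then obtain Q where Q: "\<And>e. e \<in> Basis \<Longrightarrow> real_polynomial_function (Q e)"
      "\<And>e x. e \<in> Basis \<Longrightarrow> (Q e has_real_derivative p x \<bullet> e) (at x)"
    by metis
  show ?thesis
  proof
    show "polynomial_function (\<lambda>x. \<Sum>e\<in>Basis. Q e x *\<^sub>R e)"
      using Q(1) by (intro polynomial_function_sum polynomial_function_mult)
        (auto simp: real_polynomial_function_eq)
    have "((\<lambda>x. \<Sum>e\<in>Basis. Q e x *\<^sub>R e) has_vector_derivative (\<Sum>e\<in>Basis. (p x \<bullet> e) *\<^sub>R e)) (at x)" for x
      using Q(2) by (intro has_vector_derivative_sum) (auto intro!: derivative_eq_intros)
    then show "((\<lambda>x. \<Sum>e\<in>Basis. Q e x *\<^sub>R e) has_vector_derivative p x) (at x)" for x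
      by (simp add: euclidean_representation)
  qed
qed

text \<open>Approximating the derivative and integrating gives uniform closeness for free. The
  primitive misses the value at \<open>b\<close> by a small \<open>\<kappa>\<close>, which an affine
  term spreads over the interval without moving the value at \<open>a\<close>.\<close>

lemma H1_approx_by_polynomial:
  fixes v :: "real \<Rightarrow> 'a::euclidean_space"
  assumes v: "in_L2 a b v" and g: "\<And>x. x \<in> {a..b} \<Longrightarrow> g x = g a + integral {a..x} v" and ab: "a < b"
    and \<delta>: "\<delta> > 0"
  obtains \<sigma> \<sigma>' where "polynomial_function \<sigma>" "polynomial_function \<sigma>'"
    "\<And>x. (\<sigma> has_vector_derivative \<sigma>' x) (at x)" "\<sigma> a = g a" "\<sigma> b = g b"
    "\<And>x. x \<in> {a..b} \<Longrightarrow> norm (\<sigma> x - g x) \<le> \<delta>" "L2_sq a b (\<lambda>x. \<sigma>' x - v x) \<le> \<delta>"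
proof -
  \<comment> \<open>The first bound gives \<open>4 * \<eta> \<le> \<delta>\<close> for the two
    derivative errors under \<open>L2_sq_add\<close>. The second gives
    \<open>\<rho> \<le> \<delta> / 2\<close>, so that the primitive and the affine correction
    together stay within \<open>\<delta>\<close>.\<close>
  define \<eta> where "\<eta> = min (\<delta> / 4) (\<delta>\<^sup>2 / (4 * (b - a)))"
  have \<eta>: "\<eta> > 0" "\<eta> \<le> \<delta> / 4" "(b - a) * \<eta> \<le> (\<delta> / 2)\<^sup>2"
  proof -
    show "\<eta> > 0"
      using \<delta> ab by (simp add: \<eta>_def)
    show "\<eta> \<le> \<delta> / 4"
      unfolding \<eta>_def by (rule min.cobounded1)
    have "(b - a) * \<eta> \<le> (b - a) * (\<delta>\<^sup>2 / (4 * (b - a)))"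
      using ab by (intro mult_left_mono) (auto simp: \<eta>_def)
    moreover have "w * (\<delta>\<^sup>2 / (4 * w)) = (\<delta> / 2)\<^sup>2" if "w \<noteq> 0" for w
      using that by (simp add: power2_eq_square)
    ultimately show "(b - a) * \<eta> \<le> (\<delta> / 2)\<^sup>2"
      using ab by (metis diff_gt_0_iff_gt less_irrefl)
  qed
  define \<rho> where "\<rho> = sqrt ((b - a) * \<eta>)"
  have \<rho>: "0 \<le> \<rho>" "\<rho> \<le> \<delta> / 2" "\<rho>\<^sup>2 = (b - a) * \<eta>"
    using \<eta> ab \<delta> real_le_lsqrt[OF _ \<eta>(3)] by (simp_all add: \<rho>_def)
  obtain p where p: "polynomial_function p" "L2_sq a b (\<lambda>x. p x - v x) \<le> \<eta>"
    using L2_approx_by_polynomial[OF v ab \<eta>(1)] .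
  obtain P where P: "polynomial_function P" "\<And>x. (P has_vector_derivative p x) (at x)"
    using antiderivative_polynomial_function[OF p(1)] by blast
  have cp: "continuous_on S p" for S
    using p(1) by (rule continuous_on_polymonial_function)
  have L2p: "in_L2 a b p"
    using cp by (rule in_L2_continuous)
  have Pint: "integral {a..x} p = P x - P a" if "x \<in> {a..b}" for x
    using that by (intro integral_unique fundamental_theorem_of_calculus
        has_vector_derivative_at_within[OF P(2)]) auto
  define \<kappa> where "\<kappa> = g b - g a - (P b - P a)"
  have close: "norm ((P x - P a) - (g x - g a)) \<le> \<rho>" if "x \<in> {a..b}" for x
  proof -
    have "norm ((P x - P a) - (g x - g a)) \<le> sqrt ((b - a) * L2_sq a b (\<lambda>x. p x - v x))"
      using norm_primitive_diff_le[OF L2p v ab that] g[OF that] Pint[OF that] by simp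
    also have "\<dots> \<le> \<rho>"
      unfolding \<rho>_def using p(2) ab by (intro real_sqrt_le_mono mult_left_mono) auto
    finally show ?thesis .
  qed
  have \<kappa>: "norm \<kappa> \<le> \<rho>"
    using close[of b] ab by (simp add: \<kappa>_def norm_minus_commute algebra_simps)
  define \<sigma> where "\<sigma> x = (g a - P a) + (P x + ((x - a) / (b - a)) *\<^sub>R \<kappa>)" for x
  define \<sigma>' where "\<sigma>' x = p x + (1 / (b - a)) *\<^sub>R \<kappa>" for x
  have lin: "polynomial_function (\<lambda>x::real. (x - a) / (b - a))"
    by (simp flip: real_polynomial_function_eq add: real_polynomial_function_divide
        real_polynomial_function_diff real_polynomial_function.intros(1,2))
  show ?thesis
  proof (rule that)
    show "polynomial_function \<sigma>"
      unfolding \<sigma>_def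
      by (intro polynomial_function_add polynomial_function_mult lin P(1) polynomial_function_const)
    show "polynomial_function \<sigma>'"
      unfolding \<sigma>'_def by (intro polynomial_function_add p(1) polynomial_function_const)
    show "(\<sigma> has_vector_derivative \<sigma>' x) (at x)" for x
      unfolding \<sigma>_def \<sigma>'_def
      using P(2)[of x] ab by (auto intro!: derivative_eq_intros)
    show "\<sigma> a = g a" "\<sigma> b = g b"
      using ab by (auto simp: \<sigma>_def \<kappa>_def)
    show "norm (\<sigma> x - g x) \<le> \<delta>" if x: "x \<in> {a..b}" for x
    proof -
      have "norm (((x - a) / (b - a)) *\<^sub>R \<kappa>) \<le> 1 * \<rho>"
        unfolding norm_scaleR using x ab \<kappa> by (intro mult_mono) auto
      moreover have eq: "\<sigma> x - g x = ((P x - P a) - (g x - g a)) + ((x - a) / (b - a)) *\<^sub>R \<kappa>"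
        by (simp add: \<sigma>_def)
      ultimately show ?thesis
        unfolding eq
        using norm_triangle_ineq[of "(P x - P a) - (g x - g a)" "((x - a) / (b - a)) *\<^sub>R \<kappa>"] close[OF x] \<rho>(2)
        by linarith
    qed
    have c: "in_L2 a b (\<lambda>_. (1 / (b - a)) *\<^sub>R \<kappa>)"
      by (intro in_L2_continuous continuous_on_const)
    have "L2_sq a b (\<lambda>_. (1 / (b - a)) *\<^sub>R \<kappa>) \<le> (\<rho> / (b - a))\<^sup>2 * (b - a)"
      using \<kappa> ab by (intro L2_sq_le_const c) (auto simp: divide_right_mono)
    also have "\<dots> = \<eta>"
      using ab \<rho>(3) by (simp add: power_divide) (simp add: power2_eq_square)
    finally have "L2_sq a b (\<lambda>_. (1 / (b - a)) *\<^sub>R \<kappa>) \<le> \<eta>" .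
    then have "L2_sq a b (\<lambda>x. (p x - v x) + (1 / (b - a)) *\<^sub>R \<kappa>) \<le> \<delta>"
      using L2_sq_add[OF in_L2_diff[OF L2p v] c] p(2) \<eta>(2) by linarith
    then show "L2_sq a b (\<lambda>x. \<sigma>' x - v x) \<le> \<delta>"
      by (simp add: \<sigma>'_def algebra_simps)
  qed
qed

section \<open>Convergence in \<open>H\<^sup>1\<close>\<close>

text \<open>H^1 convergence with the derivatives carried along explicitly. The functions converge
  uniformly rather than in L^2, which makes the notion stable under products. That \<open>v\<close>
  is a weak derivative of \<open>u\<close> is a consequence, not a clause.\<close>

definition H1_conv ::
    "real \<Rightarrow> real \<Rightarrow> (nat \<Rightarrow> real \<Rightarrow> 'a::euclidean_space) \<Rightarrow> (nat \<Rightarrow> real \<Rightarrow> 'a) \<Rightarrow> (real \<Rightarrow> 'a) \<Rightarrow> (real \<Rightarrow> 'a) \<Rightarrow> bool" where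
  "H1_conv a b \<sigma> \<sigma>' u v \<longleftrightarrow>
     (\<forall>n. \<forall>x\<in>{a..b}. (\<sigma> n has_vector_derivative \<sigma>' n x) (at x within {a..b})) \<and>
     (\<forall>n. continuous_on {a..b} (\<sigma>' n)) \<and> uniform_limit {a..b} \<sigma> u sequentially \<and>
     in_L2 a b v \<and> (\<lambda>n. L2_sq a b (\<lambda>x. \<sigma>' n x - v x)) \<longlonglongrightarrow> 0"

lemma H1_convD:
  assumes "H1_conv a b \<sigma> \<sigma>' u v"
  shows "\<And>n x. x \<in> {a..b} \<Longrightarrow> (\<sigma> n has_vector_derivative \<sigma>' n x) (at x within {a..b})"
    and "\<And>n. continuous_on {a..b} (\<sigma>' n)" and "uniform_limit {a..b} \<sigma> u sequentially"
    and "in_L2 a b v" and "(\<lambda>n. L2_sq a b (\<lambda>x. \<sigma>' n x - v x)) \<longlonglongrightarrow> 0"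
  using assms by (auto simp: H1_conv_def)

lemma H1_conv_continuous:
  assumes "H1_conv a b \<sigma> \<sigma>' u v"
  shows "continuous_on {a..b} (\<sigma> n)" "continuous_on {a..b} u"
proof -
  show *: "continuous_on {a..b} (\<sigma> n)" for n
    using H1_convD(1)[OF assms] by (rule continuous_on_vector_derivative)
  show "continuous_on {a..b} u"
    using * by (intro uniform_limit_theorem[OF _ H1_convD(3)[OF assms]] always_eventually) auto
qed

lemma H1_conv_subseq:
  assumes H: "H1_conv a b \<sigma> \<sigma>' u v" and r: "strict_mono r"
  shows "H1_conv a b (\<lambda>n. \<sigma> (r n)) (\<lambda>n. \<sigma>' (r n)) u v"
proof -
  have "uniform_limit {a..b} (\<lambda>n. \<sigma> (r n)) u sequentially"
    using filterlim_compose[OF H1_convD(3)[OF H] filterlim_subseq[OF r]] .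
  moreover have "(\<lambda>n. L2_sq a b (\<lambda>x. \<sigma>' (r n) x - v x)) \<longlonglongrightarrow> 0"
    using filterlim_compose[OF H1_convD(5)[OF H] filterlim_subseq[OF r]] .
  ultimately show ?thesis
    using H by (auto simp: H1_conv_def)
qed

lemma H1_conv_cong_limit:
  assumes "H1_conv a b \<sigma> \<sigma>' u v" "\<And>x. x \<in> {a..b} \<Longrightarrow> u x = w x"
  shows "H1_conv a b \<sigma> \<sigma>' w v"
proof -
  have "uniform_limit {a..b} \<sigma> u sequentially \<longleftrightarrow> uniform_limit {a..b} \<sigma> w sequentially"
    using assms(2) by (intro uniform_limit_cong') auto
  then show ?thesis
    using assms(1) by (simp add: H1_conv_def)
qed

lemma bounded_continuous_Icc:
  fixes f :: "real \<Rightarrow> 'a::real_normed_vector"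
  assumes "continuous_on {a..b} f"
  obtains B where "B \<ge> 0" "\<And>x. x \<in> {a..b} \<Longrightarrow> norm (f x) \<le> B"
  using compact_imp_bounded[OF compact_continuous_image[OF assms compact_Icc]]
  by (metis bounded_pos imageI less_imp_le)

section \<open>Bilinear products of uniform limits with L^2 limits\<close>

context
  fixes prod :: "'a::euclidean_space \<Rightarrow> 'b::euclidean_space \<Rightarrow> 'c::euclidean_space" and K :: real
  assumes bil: "bounded_bilinear prod" and K: "K \<ge> 0" "\<And>x y. norm (prod x y) \<le> norm x * norm y * K"
begin

lemma
  assumes f: "continuous_on {a..b} f" and B: "\<And>x. x \<in> {a..b} \<Longrightarrow> norm (f x) \<le> B" and v: "in_L2 a b v"
  shows in_L2_bilinear_bound: "in_L2 a b (\<lambda>x. prod (f x) (v x))"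
    and L2_sq_bilinear_bound: "L2_sq a b (\<lambda>x. prod (f x) (v x)) \<le> (B * K)\<^sup>2 * L2_sq a b v"
proof -
  let ?M = "lebesgue_on {a<..<b}"
  have le: "(norm (prod (f x) (v x)))\<^sup>2 \<le> (B * K)\<^sup>2 * (norm (v x))\<^sup>2" if x: "x \<in> {a<..<b}" for x
  proof -
    have "norm (prod (f x) (v x)) \<le> norm (f x) * (norm (v x) * K)"
      using K(2)[of "f x" "v x"] by (simp add: mult.assoc)
    also have "\<dots> \<le> B * (norm (v x) * K)"
      using B[of x] x K(1) by (intro mult_right_mono) auto
    finally have "norm (prod (f x) (v x)) \<le> B * K * norm (v x)"
      by (simp add: mult_ac)
    then have "(norm (prod (f x) (v x)))\<^sup>2 \<le> (B * K * norm (v x))\<^sup>2"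
      by (intro power_mono) auto
    then show ?thesis
      by (simp add: power_mult_distrib)
  qed
  have v2: "integrable ?M (\<lambda>x. (B * K)\<^sup>2 * (norm (v x))\<^sup>2)"
    using v by (simp add: in_L2_def)
  have "f \<in> borel_measurable ?M"
    using continuous_on_subset[OF f, of "{a<..<b}"]
    by (intro continuous_imp_measurable_on_sets_lebesgue) (auto simp: subset_eq)
  moreover have "v \<in> borel_measurable ?M"
    using v by (simp add: in_L2_def)
  moreover have "continuous_on UNIV (\<lambda>x. prod (fst x) (snd x))"
    by (intro bounded_bilinear.continuous_on[OF bil] continuous_intros)
  ultimately have "(\<lambda>x. prod (f x) (v x)) \<in> borel_measurable ?M"
    by (rule borel_measurable_continuous_Pair)
  then show L2: "in_L2 a b (\<lambda>x. prod (f x) (v x))"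
    using v2 le by (rule in_L2I)
  have "L2_sq a b (\<lambda>x. prod (f x) (v x)) \<le> integral\<^sup>L ?M (\<lambda>x. (B * K)\<^sup>2 * (norm (v x))\<^sup>2)"
    unfolding L2_sq_def using L2 v2 le by (intro integral_mono) (auto simp: in_L2_def)
  then show "L2_sq a b (\<lambda>x. prod (f x) (v x)) \<le> (B * K)\<^sup>2 * L2_sq a b v"
    by (simp add: L2_sq_def)
qed

text \<open>The difference splits into \<open>prod (F n x) (V n x - v x)\<close>, a bounded factor
  times an L^2-small one, and \<open>prod (F n x - f x) (v x)\<close>, a uniformly small factor
  times a fixed L^2 function.\<close>

lemma L2_limit_bilinear_bound:
  assumes F: "\<And>n. continuous_on {a..b} (F n)" and f: "continuous_on {a..b} f"
    and lim: "uniform_limit {a..b} F f sequentially"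
    and V: "\<And>n. in_L2 a b (V n)" and v: "in_L2 a b v"
    and limV: "(\<lambda>n. L2_sq a b (\<lambda>x. V n x - v x)) \<longlonglongrightarrow> 0"
  shows "(\<lambda>n. L2_sq a b (\<lambda>x. prod (F n x) (V n x) - prod (f x) (v x))) \<longlonglongrightarrow> 0"
proof (rule tendstoI)
  interpret bounded_bilinear prod
    by (rule bil)
  fix r :: real assume r: "r > 0"
  obtain B where B: "B \<ge> 0" "\<And>x. x \<in> {a..b} \<Longrightarrow> norm (f x) \<le> B"
    using bounded_continuous_Icc[OF f] by blast
  \<comment> \<open>\<open>A\<close> and \<open>C\<close> are the constants of these two summands,
    each with the 2 from \<open>L2_sq_add\<close>; \<open>B + 1\<close> bounds \<open>F n\<close> as
    soon as \<open>F n\<close> is within 1 of \<open>f\<close>.\<close>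
  define A where "A = 2 * ((B + 1) * K)\<^sup>2"
  define C where "C = 2 * K\<^sup>2 * L2_sq a b v"
  have AC: "A \<ge> 0" "C \<ge> 0"
    using L2_sq_nonneg[of a b v] by (auto simp: A_def C_def)
  define e where "e = min 1 (r / (2 * (C + 1)))"
  have e: "0 < e" "e \<le> 1" "C * e\<^sup>2 < r / 2"
  proof -
    show "0 < e"
      using r AC by (simp add: e_def)
    show e1: "e \<le> 1"
      by (simp add: e_def)
    have "e\<^sup>2 \<le> e"
      using \<open>0 < e\<close> e1 by (simp add: power2_eq_square mult_left_le)
    then have "C * e\<^sup>2 \<le> C * e"
      using AC by (intro mult_left_mono)
    also have "\<dots> < (C + 1) * e"
      using \<open>0 < e\<close> by (simp add: algebra_simps)
    also have "\<dots> \<le> (C + 1) * (r / (2 * (C + 1)))"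
      using AC by (intro mult_left_mono) (auto simp: e_def)
    also have "\<dots> = r / 2"
      using AC by (simp add: field_simps)
    finally show "C * e\<^sup>2 < r / 2" .
  qed
  have "\<forall>\<^sub>F n in sequentially. A * L2_sq a b (\<lambda>x. V n x - v x) < r / 2"
    using order_tendstoD(2)[OF tendsto_mult_left[OF limV, of A], of "r / 2"] r by simp
  moreover have "\<forall>\<^sub>F n in sequentially. \<forall>x\<in>{a..b}. dist (F n x) (f x) < e"
    using uniform_limitD[OF lim e(1)] .
  ultimately show "\<forall>\<^sub>F n in sequentially. dist (L2_sq a b (\<lambda>x. prod (F n x) (V n x) - prod (f x) (v x))) 0 < r"
  proof eventually_elim
    case (elim n)
    have Fn: "norm (F n x - f x) \<le> e" if "x \<in> {a..b}" for x
      using elim(2) that by (auto simp: dist_norm less_imp_le)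
    have FB: "norm (F n x) \<le> B + 1" if "x \<in> {a..b}" for x
      using Fn[OF that] B(2)[OF that] e(2) norm_triangle_ineq2[of "F n x" "f x"] by linarith
    note 1 = F[of n] FB in_L2_diff[OF V[of n] v]
    note 2 = continuous_on_diff[OF F[of n] f] Fn v
    have "L2_sq a b (\<lambda>x. prod (F n x) (V n x - v x) + prod (F n x - f x) (v x)) \<le>
        2 * L2_sq a b (\<lambda>x. prod (F n x) (V n x - v x)) + 2 * L2_sq a b (\<lambda>x. prod (F n x - f x) (v x))"
      using in_L2_bilinear_bound[OF 1] in_L2_bilinear_bound[OF 2] by (rule L2_sq_add)
    also have "\<dots> \<le> 2 * (((B + 1) * K)\<^sup>2 * L2_sq a b (\<lambda>x. V n x - v x)) + 2 * ((e * K)\<^sup>2 * L2_sq a b v)"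
      using L2_sq_bilinear_bound[OF 1] L2_sq_bilinear_bound[OF 2] by simp
    also have "\<dots> = A * L2_sq a b (\<lambda>x. V n x - v x) + C * e\<^sup>2"
      by (simp add: A_def C_def power_mult_distrib)
    also have "\<dots> < r"
      using elim(1) e(3) by simp
    finally have "L2_sq a b (\<lambda>x. prod (F n x) (V n x) - prod (f x) (v x)) < r"
      by (simp add: diff_left diff_right)
    then show ?case
      by (simp add: L2_sq_nonneg)
  qed
qed

end

lemma
  fixes prod :: "'a::euclidean_space \<Rightarrow> 'b::euclidean_space \<Rightarrow> 'c::euclidean_space"
  assumes "bounded_bilinear prod" and f: "continuous_on {a..b} f" and "in_L2 a b v"
  shows in_L2_bilinear: "in_L2 a b (\<lambda>x. prod (f x) (v x))"
    and L2_limit_bilinear: "(\<And>n. continuous_on {a..b} (F n)) \<Longrightarrow> uniform_limit {a..b} F f sequentially \<Longrightarrow>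
      (\<And>n. in_L2 a b (V n)) \<Longrightarrow> (\<lambda>n. L2_sq a b (\<lambda>x. V n x - v x)) \<longlonglongrightarrow> 0 \<Longrightarrow>
      (\<lambda>n. L2_sq a b (\<lambda>x. prod (F n x) (V n x) - prod (f x) (v x))) \<longlonglongrightarrow> 0"
proof -
  obtain K where K: "K \<ge> 0" "\<And>x y. norm (prod x y) \<le> norm x * norm y * K"
    using bounded_bilinear.nonneg_bounded[OF assms(1)] by blast
  obtain B where B: "\<And>x. x \<in> {a..b} \<Longrightarrow> norm (f x) \<le> B"
    using bounded_continuous_Icc[OF f] by blast
  show "in_L2 a b (\<lambda>x. prod (f x) (v x))"
    by (rule in_L2_bilinear_bound[OF assms(1) K f B assms(3)])
  show "(\<lambda>n. L2_sq a b (\<lambda>x. prod (F n x) (V n x) - prod (f x) (v x))) \<longlonglongrightarrow> 0"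
    if "\<And>n. continuous_on {a..b} (F n)" "uniform_limit {a..b} F f sequentially"
      "\<And>n. in_L2 a b (V n)" "(\<lambda>n. L2_sq a b (\<lambda>x. V n x - v x)) \<longlonglongrightarrow> 0"
    by (rule L2_limit_bilinear_bound[OF assms(1) K that(1) f that(2,3) assms(3) that(4)])
qed

lemma L2_limit_add:
  fixes U V :: "nat \<Rightarrow> real \<Rightarrow> 'a::euclidean_space"
  assumes "\<And>n. in_L2 a b (U n)" "\<And>n. in_L2 a b (V n)" "in_L2 a b u" "in_L2 a b v"
    and "(\<lambda>n. L2_sq a b (\<lambda>x. U n x - u x)) \<longlonglongrightarrow> 0" "(\<lambda>n. L2_sq a b (\<lambda>x. V n x - v x)) \<longlonglongrightarrow> 0"
  shows "(\<lambda>n. L2_sq a b (\<lambda>x. (U n x + V n x) - (u x + v x))) \<longlonglongrightarrow> 0"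
proof (rule Lim_null_comparison)
  show "(\<lambda>n. 2 * L2_sq a b (\<lambda>x. U n x - u x) + 2 * L2_sq a b (\<lambda>x. V n x - v x)) \<longlonglongrightarrow> 0"
    using tendsto_add[OF tendsto_mult_left[OF assms(5), of 2] tendsto_mult_left[OF assms(6), of 2]] by simp
  show "\<forall>\<^sub>F n in sequentially. norm (L2_sq a b (\<lambda>x. (U n x + V n x) - (u x + v x)))
      \<le> 2 * L2_sq a b (\<lambda>x. U n x - u x) + 2 * L2_sq a b (\<lambda>x. V n x - v x)"
  proof (intro always_eventually allI)
    fix n
    show "norm (L2_sq a b (\<lambda>x. (U n x + V n x) - (u x + v x)))
      \<le> 2 * L2_sq a b (\<lambda>x. U n x - u x) + 2 * L2_sq a b (\<lambda>x. V n x - v x)"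
      using L2_sq_add[OF in_L2_diff[OF assms(1)[of n] assms(3)] in_L2_diff[OF assms(2)[of n] assms(4)]]
      by (simp add: L2_sq_nonneg algebra_simps)
  qed
qed

text \<open>Each term of the product rule pairs a uniformly convergent factor with an L^2 convergent
  one. The same statement serves \<open>scaleR\<close> and the inner product.\<close>

lemma H1_conv_bilinear:
  fixes prod :: "'a::euclidean_space \<Rightarrow> 'b::euclidean_space \<Rightarrow> 'c::euclidean_space"
  assumes bil: "bounded_bilinear prod" and H: "H1_conv a b \<sigma> \<sigma>' u v" and G: "H1_conv a b \<rho> \<rho>' w z"
  shows "H1_conv a b (\<lambda>n x. prod (\<sigma> n x) (\<rho> n x)) (\<lambda>n x. prod (\<sigma> n x) (\<rho>' n x) + prod (\<sigma>' n x) (\<rho> n x))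
    (\<lambda>x. prod (u x) (w x)) (\<lambda>x. prod (u x) (z x) + prod (v x) (w x))"
  unfolding H1_conv_def
proof (intro conjI allI ballI)
  note cH = H1_conv_continuous[OF H] and cG = H1_conv_continuous[OF G]
  \<comment> \<open>The auxiliary limits expect the uniformly convergent factor on the left, so the
    second term of the product rule uses the flipped product.\<close>
  note bil' = bounded_bilinear.flip[OF bil]
  show "((\<lambda>x. prod (\<sigma> n x) (\<rho> n x)) has_vector_derivative prod (\<sigma> n x) (\<rho>' n x) + prod (\<sigma>' n x) (\<rho> n x)) (at x within {a..b})"
    if "x \<in> {a..b}" for n x
    by (intro bounded_bilinear.has_vector_derivative[OF bil] H1_convD(1)[OF H that] H1_convD(1)[OF G that])
  show "continuous_on {a..b} (\<lambda>x. prod (\<sigma> n x) (\<rho>' n x) + prod (\<sigma>' n x) (\<rho> n x))" for n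
    by (intro continuous_on_add bounded_bilinear.continuous_on[OF bil] cH cG H1_convD(2)[OF H] H1_convD(2)[OF G])
  show "uniform_limit {a..b} (\<lambda>n x. prod (\<sigma> n x) (\<rho> n x)) (\<lambda>x. prod (u x) (w x)) sequentially"
    by (intro bounded_bilinear.bounded_uniform_limit[OF bil] H1_convD(3)[OF H] H1_convD(3)[OF G]
        compact_imp_bounded compact_continuous_image cH(2) cG(2)) auto
  have L2: "in_L2 a b (\<sigma>' n)" "in_L2 a b (\<rho>' n)" for n
    using H1_convD(2)[OF H] H1_convD(2)[OF G] by (auto intro: in_L2_continuous)
  have 1: "in_L2 a b (\<lambda>x. prod (f x) (g x))" if "continuous_on {a..b} f" "in_L2 a b g" for f g
    by (rule in_L2_bilinear[OF bil that])
  have 2: "in_L2 a b (\<lambda>x. prod (f x) (g x))" if "continuous_on {a..b} g" "in_L2 a b f" for f g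
    by (rule in_L2_bilinear[OF bil' that])
  show "in_L2 a b (\<lambda>x. prod (u x) (z x) + prod (v x) (w x))"
    by (intro in_L2_add 1[OF cH(2) H1_convD(4)[OF G]] 2[OF cG(2) H1_convD(4)[OF H]])
  show "(\<lambda>n. L2_sq a b (\<lambda>x. prod (\<sigma> n x) (\<rho>' n x) + prod (\<sigma>' n x) (\<rho> n x) - (prod (u x) (z x) + prod (v x) (w x)))) \<longlonglongrightarrow> 0"
  proof (rule L2_limit_add[OF 1[OF cH(1) L2(2)] 2[OF cG(1) L2(1)] 1[OF cH(2) H1_convD(4)[OF G]]
        2[OF cG(2) H1_convD(4)[OF H]]])
    show "(\<lambda>n. L2_sq a b (\<lambda>x. prod (\<sigma> n x) (\<rho>' n x) - prod (u x) (z x))) \<longlonglongrightarrow> 0"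
      by (rule L2_limit_bilinear[OF bil cH(2) H1_convD(4)[OF G] cH(1) H1_convD(3)[OF H] L2(2) H1_convD(5)[OF G]])
    show "(\<lambda>n. L2_sq a b (\<lambda>x. prod (\<sigma>' n x) (\<rho> n x) - prod (v x) (w x))) \<longlonglongrightarrow> 0"
      by (rule L2_limit_bilinear[OF bil' cG(2) H1_convD(4)[OF H] cG(1) H1_convD(3)[OF G] L2(1) H1_convD(5)[OF H]])
  qed
qed

lemma H1_conv_diff:
  assumes H: "H1_conv a b \<sigma> \<sigma>' u v" and G: "H1_conv a b \<rho> \<rho>' w z"
  shows "H1_conv a b (\<lambda>n x. \<sigma> n x - \<rho> n x) (\<lambda>n x. \<sigma>' n x - \<rho>' n x) (\<lambda>x. u x - w x) (\<lambda>x. v x - z x)"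
  unfolding H1_conv_def
proof (intro conjI allI ballI)
  show "((\<lambda>x. \<sigma> n x - \<rho> n x) has_vector_derivative \<sigma>' n x - \<rho>' n x) (at x within {a..b})"
    if "x \<in> {a..b}" for n x
    by (intro has_vector_derivative_diff H1_convD(1)[OF H that] H1_convD(1)[OF G that])
  show "continuous_on {a..b} (\<lambda>x. \<sigma>' n x - \<rho>' n x)" for n
    by (intro continuous_on_diff H1_convD(2)[OF H] H1_convD(2)[OF G])
  show "uniform_limit {a..b} (\<lambda>n x. \<sigma> n x - \<rho> n x) (\<lambda>x. u x - w x) sequentially"
    by (intro uniform_limit_intros H1_convD(3)[OF H] H1_convD(3)[OF G])
  have L2: "in_L2 a b (\<sigma>' n)" "in_L2 a b (\<lambda>x. - \<rho>' n x)" for n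
    using H1_convD(2)[OF H] H1_convD(2)[OF G] by (auto intro: in_L2_continuous in_L2_minus)
  show "in_L2 a b (\<lambda>x. v x - z x)"
    by (intro in_L2_diff H1_convD(4)[OF H] H1_convD(4)[OF G])
  have "L2_sq a b (\<lambda>x. - \<rho>' n x - - z x) = L2_sq a b (\<lambda>x. \<rho>' n x - z x)" for n
    by (simp add: L2_sq_def norm_minus_commute)
  then have "(\<lambda>n. L2_sq a b (\<lambda>x. - \<rho>' n x - - z x)) \<longlonglongrightarrow> 0"
    using H1_convD(5)[OF G] by simp
  from L2_limit_add[OF L2 H1_convD(4)[OF H] in_L2_minus[OF H1_convD(4)[OF G]] H1_convD(5)[OF H] this]
  show "(\<lambda>n. L2_sq a b (\<lambda>x. \<sigma>' n x - \<rho>' n x - (v x - z x))) \<longlonglongrightarrow> 0"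
    by (simp add: algebra_simps)
qed

text \<open>By the chain rule the derivative is \<open>- (i n x * i n x) * (sgn (\<sigma> n x)
  \<bullet> \<sigma>' n x)\<close> with \<open>i n x\<close> the inverse norm: uniformly convergent
  factors applied to the L^2 convergent \<open>\<sigma>'\<close>. The unit length of the limit lets
  the inverse norms converge uniformly.\<close>

lemma H1_conv_inverse_norm:
  fixes \<sigma> :: "nat \<Rightarrow> real \<Rightarrow> 'a::euclidean_space"
  assumes H: "H1_conv a b \<sigma> \<sigma>' u v" and unit: "\<And>x. x \<in> {a..b} \<Longrightarrow> norm (u x) = 1"
    and nz: "\<And>n x. x \<in> {a..b} \<Longrightarrow> \<sigma> n x \<noteq> 0"
  obtains r v' where "H1_conv a b (\<lambda>n x. inverse (norm (\<sigma> n x))) r (\<lambda>x. 1) v'"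
proof -
  define i where "i n x = inverse (norm (\<sigma> n x))" for n x
  define r where "r n x = (- (i n x * i n x)) * (sgn (\<sigma> n x) \<bullet> \<sigma>' n x)" for n x
  note c = H1_conv_continuous[OF H]
  have ci: "continuous_on {a..b} (i n)" for n
    unfolding i_def using nz by (intro continuous_on_inverse continuous_on_norm c) auto
  have cs: "continuous_on {a..b} (\<lambda>x. sgn (\<sigma> n x))" for n
    using nz by (intro continuous_on_sgn c) auto
  have ui: "uniform_limit {a..b} i (\<lambda>x. 1) sequentially"
  proof -
    have "uniform_limit {a..b} (\<lambda>n x. norm (\<sigma> n x)) (\<lambda>x. norm (u x)) sequentially"
      by (intro uniform_limit_intros H1_convD(3)[OF H])
    then have "uniform_limit {a..b} (\<lambda>n x. inverse (norm (\<sigma> n x))) (inverse \<circ> (\<lambda>x. norm (u x))) sequentially"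
      by (rule uniform_lim_inverse[of _ _ _ _ 1]) (auto simp: unit)
    then show ?thesis
      by (rule uniform_limit_cong'[THEN iffD1, rotated -1]) (auto simp: i_def unit)
  qed
  have ui2: "uniform_limit {a..b} (\<lambda>n x. - (i n x * i n x)) (\<lambda>x. - (1 * 1)) sequentially"
    by (intro uniform_limit_intros ui) (auto simp: image_constant_conv)
  have us: "uniform_limit {a..b} (\<lambda>n x. sgn (\<sigma> n x)) (\<lambda>x. 1 *\<^sub>R u x) sequentially"
  proof -
    have "uniform_limit {a..b} (\<lambda>n x. i n x *\<^sub>R \<sigma> n x) (\<lambda>x. 1 *\<^sub>R u x) sequentially"
      using compact_imp_bounded[OF compact_continuous_image[OF c(2) compact_Icc]]
      by (intro bounded_bilinear.bounded_uniform_limit[OF bounded_bilinear_scaleR] ui H1_convD(3)[OF H])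
        (auto simp: image_constant_conv)
    then show ?thesis
      by (simp add: i_def sgn_div_norm)
  qed
  have L2: "in_L2 a b (\<sigma>' n)" for n
    by (intro in_L2_continuous H1_convD(2)[OF H])
  have cu: "continuous_on {a..b} (\<lambda>x. 1 *\<^sub>R u x)" and c1: "continuous_on {a..b} (\<lambda>x. - (1 * 1 :: real))"
    using c(2) by simp_all
  have ci2: "continuous_on {a..b} (\<lambda>x. - (i n x * i n x))" for n
    by (intro continuous_intros ci)
  note L2s = in_L2_bilinear[OF bounded_bilinear_inner cs L2]
  note lims = L2_limit_bilinear[OF bounded_bilinear_inner cu H1_convD(4)[OF H] cs us L2 H1_convD(5)[OF H]]
  note L2u = in_L2_bilinear[OF bounded_bilinear_inner cu H1_convD(4)[OF H]]
  have "H1_conv a b i r (\<lambda>x. 1) (\<lambda>x. (- (1 * 1)) * ((1 *\<^sub>R u x) \<bullet> v x))"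
    unfolding H1_conv_def
  proof (intro conjI allI ballI)
    show "(i n has_vector_derivative r n x) (at x within {a..b})" if x: "x \<in> {a..b}" for n x
    proof -
      have "((\<lambda>x. norm (\<sigma> n x)) has_derivative (\<lambda>h. (h *\<^sub>R \<sigma>' n x) \<bullet> sgn (\<sigma> n x))) (at x within {a..b})"
        using H1_convD(1)[OF H x, of n] has_derivative_norm[OF nz[OF x, of n]]
        unfolding has_vector_derivative_def by (rule has_derivative_compose)
      then have "((\<lambda>x. norm (\<sigma> n x)) has_real_derivative sgn (\<sigma> n x) \<bullet> \<sigma>' n x) (at x within {a..b})"
        unfolding has_field_derivative_def by (rule has_derivative_eq_rhs) (auto simp: inner_commute)
      then have "((\<lambda>x. inverse (norm (\<sigma> n x))) has_real_derivative
          - (inverse (norm (\<sigma> n x)) * (sgn (\<sigma> n x) \<bullet> \<sigma>' n x) * inverse (norm (\<sigma> n x)))) (at x within {a..b})"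
        using nz[OF x, of n] by (intro DERIV_inverse') auto
      then show ?thesis
        by (simp add: has_real_derivative_iff_has_vector_derivative[symmetric] i_def[abs_def] r_def mult_ac)
    qed
    show "continuous_on {a..b} (r n)" for n
      unfolding r_def by (intro continuous_on_mult ci2 continuous_on_inner cs H1_convD(2)[OF H])
    show "in_L2 a b (\<lambda>x. (- (1 * 1)) * ((1 *\<^sub>R u x) \<bullet> v x))"
      by (rule in_L2_bilinear[OF bounded_bilinear_mult c1 L2u])
    show "(\<lambda>n. L2_sq a b (\<lambda>x. r n x - (- (1 * 1)) * ((1 *\<^sub>R u x) \<bullet> v x))) \<longlonglongrightarrow> 0"
      unfolding r_def
      by (rule L2_limit_bilinear[OF bounded_bilinear_mult c1 L2u ci2 ui2 L2s lims])
  qed (rule ui)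
  then show thesis
    unfolding i_def by (rule that)
qed

text \<open>The limit derivative \<open>v'\<close> stays anonymous here; uniqueness of weak
  derivatives identifies it later.\<close>

lemma H1_conv_sgn:
  fixes \<sigma> :: "nat \<Rightarrow> real \<Rightarrow> 'a::euclidean_space"
  assumes H: "H1_conv a b \<sigma> \<sigma>' u v" and unit: "\<And>x. x \<in> {a..b} \<Longrightarrow> norm (u x) = 1"
    and nz: "\<And>n x. x \<in> {a..b} \<Longrightarrow> \<sigma> n x \<noteq> 0"
  obtains \<tau>' v' where "H1_conv a b (\<lambda>n x. sgn (\<sigma> n x)) \<tau>' u v'"
proof -
  obtain r v' where r: "H1_conv a b (\<lambda>n x. inverse (norm (\<sigma> n x))) r (\<lambda>x. 1) v'"
    by (rule H1_conv_inverse_norm[OF assms])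
  show thesis
    using H1_conv_bilinear[OF bounded_bilinear_scaleR r H] that by (simp add: sgn_div_norm)
qed

lemma L2_sq_uniform_limit:
  fixes \<sigma> :: "nat \<Rightarrow> real \<Rightarrow> 'a::euclidean_space"
  assumes lim: "uniform_limit {a..b} \<sigma> u sequentially" and ab: "a < b"
    and c: "\<And>n. continuous_on {a..b} (\<sigma> n)" "continuous_on {a..b} u"
  shows "(\<lambda>n. L2_sq a b (\<lambda>x. \<sigma> n x - u x)) \<longlonglongrightarrow> 0"
proof (rule tendstoI)
  fix r :: real assume r: "r > 0"
  define e where "e = sqrt (r / (2 * (b - a)))"
  have e: "e > 0" "e\<^sup>2 * (b - a) = r / 2"
    using r ab by (simp_all add: e_def nonzero_divide_eq_eq)
  show "\<forall>\<^sub>F n in sequentially. dist (L2_sq a b (\<lambda>x. \<sigma> n x - u x)) 0 < r"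
    using uniform_limitD[OF lim e(1)]
  proof eventually_elim
    case (elim n)
    have "L2_sq a b (\<lambda>x. \<sigma> n x - u x) \<le> e\<^sup>2 * (b - a)"
      using elim ab by (intro L2_sq_le_const in_L2_continuous continuous_on_diff c) (auto simp: dist_norm less_imp_le)
    then show ?case
      using e(2) r by (simp add: L2_sq_nonneg)
  qed
qed

lemma H1_conv_imp_weak_derivative:
  assumes H: "H1_conv a b \<sigma> \<sigma>' u v" and ab: "a < b"
  shows "has_weak_derivative a b u v"
proof (rule has_weak_derivative_limit[OF ab])
  note c = H1_conv_continuous[OF H]
  show "has_weak_derivative a b (\<sigma> n) (\<sigma>' n)" for n
    by (intro has_weak_derivative_C1 H1_convD(1,2)[OF H] ab)
  show "in_L2 a b (\<sigma> n)" "in_L2 a b (\<sigma>' n)" "in_L2 a b u" for n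
    by (intro in_L2_continuous c H1_convD(2)[OF H])+
  show "in_L2 a b v" "(\<lambda>n. L2_sq a b (\<lambda>x. \<sigma>' n x - v x)) \<longlonglongrightarrow> 0"
    by (rule H1_convD[OF H])+
  show "(\<lambda>n. L2_sq a b (\<lambda>x. \<sigma> n x - u x)) \<longlonglongrightarrow> 0"
    by (intro L2_sq_uniform_limit H1_convD(3)[OF H] ab c)
qed

text \<open>The limit of the derivatives is itself a weak derivative of \<open>u\<close>, so it
  agrees a.e. with \<open>w\<close>. For unit curves this hides the cancellation of the tangential
  term of the product rule.\<close>

lemma H1_conv_change_derivative:
  assumes H: "H1_conv a b \<sigma> \<sigma>' u v" and ab: "a < b"
    and w: "has_weak_derivative a b u w" "in_L2 a b w"
  shows "H1_conv a b \<sigma> \<sigma>' u w"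
proof -
  have "AE x in lebesgue_on {a<..<b}. v x = w x"
    by (rule weak_derivative_unique[OF H1_conv_imp_weak_derivative[OF H ab] w(1) ab])
  then have "AE x in lebesgue_on {a<..<b}. \<sigma>' n x - w x = \<sigma>' n x - v x" for n
    by (rule eventually_mono) simp
  then have "L2_sq a b (\<lambda>x. \<sigma>' n x - w x) = L2_sq a b (\<lambda>x. \<sigma>' n x - v x)" for n
    by (intro AE_L2_cong in_L2_diff in_L2_continuous H1_convD[OF H])
  then show ?thesis
    using H w(2) by (simp add: H1_conv_def)
qed

section \<open>Correcting the mean of a unit curve\<close>

text \<open>One \<open>norm (x - y) / norm y\<close> pays for changing the vector, the other for
  changing the normalising factor. The case \<open>x = 0\<close> relies on
  \<open>sgn 0 = 0\<close>.\<close>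

lemma norm_sgn_diff_le:
  fixes x y :: "'a::real_normed_vector"
  assumes "y \<noteq> 0"
  shows "norm (sgn x - sgn y) \<le> 2 * norm (x - y) / norm y"
proof (cases "x = 0")
  case False
  have "sgn x - sgn y = (1 / norm y) *\<^sub>R (x - y) + (1 / norm x - 1 / norm y) *\<^sub>R x"
    by (simp add: sgn_div_norm scaleR_diff_right scaleR_diff_left inverse_eq_divide)
  also have "norm \<dots> \<le> norm (x - y) / norm y + \<bar>1 / norm x - 1 / norm y\<bar> * norm x"
    by (intro order_trans[OF norm_triangle_ineq]) simp
  also have "\<bar>1 / norm x - 1 / norm y\<bar> * norm x = \<bar>(1 / norm x - 1 / norm y) * norm x\<bar>"
    by (simp add: abs_mult)
  also have "(1 / norm x - 1 / norm y) * norm x = (norm y - norm x) / norm y"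
    using False assms by (simp add: field_simps)
  also have "\<bar>(norm y - norm x) / norm y\<bar> \<le> norm (x - y) / norm y"
    using norm_triangle_ineq3[of x y] by (simp add: divide_right_mono abs_minus_commute)
  finally show ?thesis
    by simp
qed (use assms in \<open>simp add: norm_sgn\<close>)

lemma inner_sgn_add_diff:
  fixes t h :: "'a::real_inner"
  assumes t: "norm t = 1" and nz: "t + h \<noteq> 0"
  shows "(sgn (t + h) - t) \<bullet> h = (1 + norm (t + h)) * (1 - sgn (t + h) \<bullet> t)"
proof -
  define n where "n = sgn (t + h)"
  have h: "h = norm (t + h) *\<^sub>R n - t"
    by (simp add: n_def sgn_div_norm nz)
  have "n \<bullet> n = 1" "t \<bullet> t = 1"
    using t nz by (simp_all add: n_def dot_square_norm norm_sgn)
  then have "(n - t) \<bullet> (norm (t + h) *\<^sub>R n - t) = (1 + norm (t + h)) * (1 - n \<bullet> t)"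
    by (simp add: inner_diff_left inner_diff_right algebra_simps inner_commute[of t n])
  then show ?thesis
    using h by (simp add: n_def)
qed

lemma inner_sgn_add_diff_nonneg:
  fixes t h :: "'a::real_inner"
  assumes t: "norm t = 1" and nz: "t + h \<noteq> 0"
  shows "(sgn (t + h) - t) \<bullet> h \<ge> 0"
proof -
  have "sgn (t + h) \<bullet> t \<le> 1"
    using norm_cauchy_schwarz[of "sgn (t + h)" t] t nz by (simp add: norm_sgn)
  then show ?thesis
    unfolding inner_sgn_add_diff[OF t nz] by simp
qed

text \<open>Equality in Cauchy-Schwarz: a unit vector whose inner product with the unit vector
  \<open>t\<close> is 1 equals \<open>t\<close>, so \<open>t + h\<close>, and hence
  \<open>h\<close>, is a multiple of \<open>t\<close>.\<close>

lemma parallel_if_inner_sgn_add_diff_zero: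
  fixes t h :: "'a::real_inner"
  assumes t: "norm t = 1" and nz: "t + h \<noteq> 0" and zero: "(sgn (t + h) - t) \<bullet> h = 0"
  shows "h = (h \<bullet> t) *\<^sub>R t"
proof -
  have "1 + norm (t + h) \<noteq> 0"
    using norm_ge_zero[of "t + h"] by linarith
  then have "sgn (t + h) \<bullet> t = 1"
    using zero unfolding inner_sgn_add_diff[OF t nz] by simp
  moreover have "sgn (t + h) \<bullet> sgn (t + h) = 1" "t \<bullet> t = 1"
    using t nz by (simp_all add: dot_square_norm norm_sgn)
  moreover have "(n - t) \<bullet> (n - t) = n \<bullet> n - 2 * (n \<bullet> t) + t \<bullet> t" for n
    by (simp add: inner_diff_left inner_diff_right inner_commute)
  note this[of "sgn (t + h)"]
  ultimately have "(sgn (t + h) - t) \<bullet> (sgn (t + h) - t) = 0"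
    by linarith
  then have "sgn (t + h) = t"
    by simp
  then have "t + h = norm (t + h) *\<^sub>R t"
    using nz by (metis sgn_div_norm scaleR_one scaleR_scaleR norm_eq_zero right_inverse)
  then have h: "h = (norm (t + h) - 1) *\<^sub>R t"
    by (simp add: scaleR_diff_left algebra_simps)
  have "t \<bullet> t = 1"
    using t by (simp add: dot_square_norm)
  then have "h \<bullet> t = norm (t + h) - 1"
    by (subst h) simp
  then show ?thesis
    using h by simp
qed

text \<open>Were there no zero, \<open>c \<mapsto> - r G(c) / |G(c)|\<close> would have a Brouwer fixed point on the sphere.\<close>

lemma zero_in_cball_if_outward:
  fixes G :: "'a::euclidean_space \<Rightarrow> 'a"
  assumes G: "continuous_on (cball 0 r) G" and r: "r > 0"
    and out: "\<And>c. norm c = r \<Longrightarrow> G c \<bullet> c > 0"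
  obtains c where "norm c \<le> r" "G c = 0"
proof (rule ccontr)
  assume "\<not> thesis"
  then have nz: "G c \<noteq> 0" if "norm c \<le> r" for c
    using that \<open>\<And>c. norm c \<le> r \<Longrightarrow> G c = 0 \<Longrightarrow> thesis\<close> by blast
  let ?f = "\<lambda>c. - (r *\<^sub>R sgn (G c))"
  have "continuous_on (cball 0 r) ?f"
    using nz by (intro continuous_intros G) auto
  moreover have "?f \<in> cball 0 r \<rightarrow> cball 0 r"
    using r by (auto simp: norm_sgn)
  ultimately obtain c where c: "c \<in> cball 0 r" "?f c = c"
    using brouwer_ball[OF r] by blast
  then have Gc: "G c \<noteq> 0"
    using nz by simp
  have "norm (?f c) = r"
    using Gc r by (simp add: norm_sgn)
  then have "G c \<bullet> c > 0"
    using out c(2) by simp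
  moreover have "G c \<bullet> ?f c \<le> 0"
    using r Gc by (simp add: sgn_div_norm)
  ultimately show False
    using c(2) by simp
qed

section \<open>The mean of the perturbed unit curve as a function of \<open>c\<close>\<close>

context
  fixes a b :: real and t :: "real \<Rightarrow> 'a::euclidean_space"
  assumes ab: "a < b" and t: "continuous_on {a..b} t"
    and unit: "\<And>x. x \<in> {a..b} \<Longrightarrow> norm (t x) = 1"
begin

lemma weight_bounds:
  assumes "x \<in> {a..b}"
  shows "0 \<le> (x - a) * (b - x)" "(x - a) * (b - x) \<le> (b - a)\<^sup>2"
  using assms mult_mono[of "x - a" "b - a" "b - x" "b - a"] by (auto simp: power2_eq_square)

text \<open>Length 1 minus two errors of at most 1/4 each, as the weight never exceeds
  \<open>(b - a)\<^sup>2\<close>.\<close>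

lemma norm_perturbed_ge:
  fixes \<tau> :: "real \<Rightarrow> 'a"
  assumes x: "x \<in> {a..b}" and c: "norm c * (b - a)\<^sup>2 \<le> 1 / 4" and \<tau>: "norm (\<tau> x - t x) \<le> 1 / 4"
  shows "norm (\<tau> x + ((x - a) * (b - x)) *\<^sub>R c) \<ge> 1 / 2"
proof -
  define z where "z = ((x - a) * (b - x)) *\<^sub>R c"
  have "norm z \<le> norm c * (b - a)\<^sup>2"
    using weight_bounds[OF x] by (simp add: z_def mult.commute[of _ "norm c"] mult_left_mono abs_mult[symmetric])
  moreover have "norm (t x) = norm ((\<tau> x + z) - ((\<tau> x - t x) + z))"
    by simp
  then have "norm (t x) \<le> norm (\<tau> x + z) + (norm (\<tau> x - t x) + norm z)"
    using norm_triangle_ineq4[of "\<tau> x + z" "(\<tau> x - t x) + z"] norm_triangle_ineq[of "\<tau> x - t x" z]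
    by linarith
  ultimately show ?thesis
    unfolding z_def[symmetric] using c \<tau> unit[OF x] by linarith
qed

lemma continuous_on_integral_sgn_perturbed:
  fixes \<tau> :: "real \<Rightarrow> 'a"
  assumes \<tau>: "continuous_on {a..b} \<tau>" and nz: "\<And>c x. norm c \<le> r \<Longrightarrow> x \<in> {a..b} \<Longrightarrow> \<tau> x + ((x - a) * (b - x)) *\<^sub>R c \<noteq> 0"
  shows "continuous_on (cball 0 r) (\<lambda>c. integral {a..b} (\<lambda>x. sgn (\<tau> x + ((x - a) * (b - x)) *\<^sub>R c)))"
proof -
  have c\<tau>: "continuous_on (cball 0 r \<times> {a..b}) (\<lambda>p. \<tau> (snd p))"
    by (rule continuous_on_compose2[OF \<tau> continuous_on_snd[OF continuous_on_id]]) auto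
  have "continuous_on (cball 0 r \<times> {a..b}) (\<lambda>(c, x). sgn (\<tau> x + ((x - a) * (b - x)) *\<^sub>R c))"
    unfolding split_beta
  proof (rule continuous_on_sgn)
    show "continuous_on (cball 0 r \<times> {a..b}) (\<lambda>p. \<tau> (snd p) + ((snd p - a) * (b - snd p)) *\<^sub>R fst p)"
      by (intro continuous_on_add c\<tau> continuous_intros)
  qed (use nz in auto)
  then show ?thesis
    using integral_continuous_on_param[of "cball 0 r" a b "\<lambda>c x. sgn (\<tau> x + ((x - a) * (b - x)) *\<^sub>R c)"] by simp
qed

lemma continuous_on_sgn_perturbed:
  fixes \<tau> :: "real \<Rightarrow> 'a"
  assumes \<tau>: "continuous_on {a..b} \<tau>"
    and nz: "\<And>x. x \<in> {a..b} \<Longrightarrow> \<tau> x + ((x - a) * (b - x)) *\<^sub>R c \<noteq> 0"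
  shows "continuous_on {a..b} (\<lambda>x. sgn (\<tau> x + ((x - a) * (b - x)) *\<^sub>R c))"
proof (rule continuous_on_sgn)
  show "continuous_on {a..b} (\<lambda>x. \<tau> x + ((x - a) * (b - x)) *\<^sub>R c)"
    by (intro continuous_on_add \<tau> continuous_intros)
qed (use nz in auto)

text \<open>The pointwise inequality for \<open>h = \<phi> c\<close>, divided by
  \<open>\<phi> > 0\<close>, makes the integrand nonnegative. A zero integral forces it to vanish
  everywhere, so \<open>c\<close> is parallel to \<open>t x\<close> at every interior
  \<open>x\<close>, and connectedness prevents \<open>t\<close> from switching between the two
  possible directions.\<close>

lemma integral_sgn_perturbed_pos:
  assumes nonconst: "\<not> (\<exists>k. \<forall>x\<in>{a..b}. t x = k)"
    and c: "c \<noteq> 0" "norm c * (b - a)\<^sup>2 \<le> 1 / 4"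
  shows "(integral {a..b} (\<lambda>x. sgn (t x + ((x - a) * (b - x)) *\<^sub>R c)) - integral {a..b} t) \<bullet> c > 0"
proof -
  let ?\<phi> = "\<lambda>x. (x - a) * (b - x)"
  let ?s = "\<lambda>x. sgn (t x + ?\<phi> x *\<^sub>R c)"
  let ?f = "\<lambda>x. (?s x - t x) \<bullet> c"
  have nz: "t x + ?\<phi> x *\<^sub>R c \<noteq> 0" if "x \<in> {a..b}" for x
    using norm_perturbed_ge[OF that c(2), of t] by auto
  have cs: "continuous_on {a..b} ?s"
    using t nz by (rule continuous_on_sgn_perturbed)
  then have cf: "continuous_on {a..b} ?f"
    by (intro continuous_on_inner continuous_on_diff continuous_on_const t)
  have nonneg: "?f x \<ge> 0" if x: "x \<in> {a..b}" for x
  proof (cases "?\<phi> x = 0")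
    \<comment> \<open>Where the weight vanishes nothing is perturbed, and
      \<open>sgn (t x) = t x\<close>.\<close>
    case True
    then show ?thesis
      using unit[OF x] unfolding True by (simp add: sgn_div_norm)
  next
    case False
    then have "?\<phi> x > 0"
      using weight_bounds(1)[OF x] by linarith
    then show ?thesis
      using inner_sgn_add_diff_nonneg[OF unit[OF x] nz[OF x]] by (simp add: zero_le_mult_iff)
  qed
  have eq: "(integral {a..b} ?s - integral {a..b} t) \<bullet> c = integral {a..b} ?f"
  proof -
    have "(\<lambda>x. ?s x - t x) integrable_on {a..b}"
      by (intro integrable_continuous_interval continuous_on_diff cs t)
    then have "integral {a..b} (\<lambda>x. ?s x - t x) \<bullet> c = integral {a..b} ?f"
      using integral_linear[OF _ bounded_linear_inner_left[of c]] by (simp add: o_def)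
    then show ?thesis
      using cs t by (simp add: Henstock_Kurzweil_Integration.integral_diff integrable_continuous_interval)
  qed
  have "integral {a..b} ?f \<noteq> 0"
  proof
    assume "integral {a..b} ?f = 0"
    then have zero: "\<forall>x\<in>{a..b}. ?f x = 0"
      using integral_eq_0_iff[OF cf ab nonneg] by blast
    have par: "c = (c \<bullet> t x) *\<^sub>R t x" if x: "x \<in> {a<..<b}" for x
    proof -
      have x': "x \<in> {a..b}" and pos: "?\<phi> x > 0"
        using x by auto
      have "?\<phi> x *\<^sub>R c = ((?\<phi> x *\<^sub>R c) \<bullet> t x) *\<^sub>R t x"
        using zero x' by (intro parallel_if_inner_sgn_add_diff_zero[OF unit[OF x'] nz[OF x']]) simp
      then have "?\<phi> x *\<^sub>R c = ?\<phi> x *\<^sub>R ((c \<bullet> t x) *\<^sub>R t x)"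
        by simp
      then show ?thesis
        using pos by (subst (asm) scaleR_cancel_left) auto
    qed
    have "\<bar>c \<bullet> t x\<bar> = norm c" if x: "x \<in> {a<..<b}" for x
      using arg_cong[OF par[OF x], of norm] unit[of x] x by simp
    then have "(\<lambda>x. c \<bullet> t x) ` {a<..<b} \<subseteq> {norm c, - norm c}"
      by (force simp: abs_if split: if_splits)
    then have "finite ((\<lambda>x. c \<bullet> t x) ` {a<..<b})"
      by (rule finite_subset) simp
    moreover have "continuous_on {a<..<b} (\<lambda>x. c \<bullet> t x)"
      by (intro continuous_intros continuous_on_subset[OF t]) auto
    ultimately have "(\<lambda>x. c \<bullet> t x) constant_on {a<..<b}"
      by (intro continuous_finite_range_constant) auto
    then obtain \<mu> where \<mu>: "\<And>x. x \<in> {a<..<b} \<Longrightarrow> c \<bullet> t x = \<mu>"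
      by (auto simp: constant_on_def)
    have "t x = (1 / \<mu>) *\<^sub>R c" if x: "x \<in> {a<..<b}" for x
    proof -
      have *: "c = \<mu> *\<^sub>R t x"
        using par[OF x] \<mu>[OF x] by simp
      with c(1) have "\<mu> \<noteq> 0"
        by auto
      then show ?thesis
        by (subst *) simp
    qed
    then have "t x = (1 / \<mu>) *\<^sub>R c" if "x \<in> {a..b}" for x
      using continuous_constant_on_closure[of "{a<..<b}" t _ x] t that ab
      by (simp add: closure_greaterThanLessThan)
    then show False
      using nonconst by blast
  qed
  moreover have "integral {a..b} ?f \<ge> 0"
    using nonneg cf by (intro Henstock_Kurzweil_Integration.integral_nonneg integrable_continuous_interval) auto
  ultimately show ?thesis
    unfolding eq by linarith
qed

text \<open>\<open>\<rho>\<close> is fixed before \<open>\<tau>\<close>: compactness of the sphere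
  turns strict positivity for \<open>t\<close> into a uniform margin \<open>\<alpha>\<close>, at
  most half of which is lost on passing from \<open>t\<close> to any \<open>\<tau>\<close> within
  \<open>\<rho>\<close>.\<close>

lemma integral_sgn_correction:
  assumes nonconst: "\<not> (\<exists>k. \<forall>x\<in>{a..b}. t x = k)" and \<delta>: "\<delta> > 0"
  obtains \<rho> where "\<rho> > 0" "\<And>\<tau>. continuous_on {a..b} \<tau> \<Longrightarrow> (\<And>x. x \<in> {a..b} \<Longrightarrow> norm (\<tau> x - t x) \<le> \<rho>) \<Longrightarrow>
    \<exists>c. norm c \<le> \<delta> \<and> integral {a..b} (\<lambda>x. sgn (\<tau> x + ((x - a) * (b - x)) *\<^sub>R c)) = integral {a..b} t"
proof -
  let ?\<phi> = "\<lambda>x. (x - a) * (b - x)"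
  define G where "G \<tau> c = integral {a..b} (\<lambda>x. sgn (\<tau> x + ?\<phi> x *\<^sub>R c)) - integral {a..b} t" for \<tau> c
  \<comment> \<open>The second bound gives \<open>norm c * (b - a)\<^sup>2 \<le> 1 / 4\<close>,
    which keeps the perturbed curves away from zero.\<close>
  define r where "r = min \<delta> (1 / (4 * (b - a)\<^sup>2))"
  have r: "r > 0" "r \<le> \<delta>"
    using \<delta> ab by (auto simp: r_def)
  have small: "norm c * (b - a)\<^sup>2 \<le> 1 / 4" if "norm c \<le> r" for c :: 'a
  proof -
    have "norm c * (b - a)\<^sup>2 \<le> 1 / (4 * (b - a)\<^sup>2) * (b - a)\<^sup>2"
      using that by (intro mult_right_mono) (auto simp: r_def)
    then show ?thesis
      using ab by simp
  qed
  have nz: "\<tau> x + ?\<phi> x *\<^sub>R c \<noteq> 0"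
    if "norm c \<le> r" "x \<in> {a..b}" "norm (\<tau> x - t x) \<le> 1 / 4" for \<tau> c x
    using norm_perturbed_ge[OF that(2) small[OF that(1)], of \<tau>] that(3) by auto
  have contG: "continuous_on (cball 0 r) (G \<tau>)"
    if "continuous_on {a..b} \<tau>" "\<And>x. x \<in> {a..b} \<Longrightarrow> norm (\<tau> x - t x) \<le> 1 / 4" for \<tau>
    unfolding G_def using that nz
    by (intro continuous_on_diff continuous_on_const continuous_on_integral_sgn_perturbed) auto
  have "continuous_on (sphere 0 r) (\<lambda>c. G t c \<bullet> c)"
    using contG[OF t] by (intro continuous_intros continuous_on_subset[OF contG[OF t]]) auto
  moreover have "sphere (0::'a) r \<noteq> {}"
    using r by simp
  ultimately obtain c0 where c0: "c0 \<in> sphere 0 r" "\<And>c. c \<in> sphere 0 r \<Longrightarrow> G t c0 \<bullet> c0 \<le> G t c \<bullet> c"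
    using continuous_attains_inf[OF compact_sphere, of 0 r "\<lambda>c. G t c \<bullet> c"] by blast
  define \<alpha> where "\<alpha> = G t c0 \<bullet> c0"
  have \<alpha>: "\<alpha> > 0"
    unfolding \<alpha>_def G_def using c0(1) r small[of c0] by (intro integral_sgn_perturbed_pos nonconst) auto
  \<comment> \<open>The norm to divide by is at least 1/2, so the two normalised curves differ by at
    most \<open>4 * \<rho>\<close>. Integrating and pairing with \<open>c\<close> multiplies this by
    \<open>(b - a) * r\<close>, and the 8 brings the result down to
    \<open>\<alpha> / 2\<close>.\<close>
  define \<rho> where "\<rho> = min (1 / 4) (\<alpha> / (8 * (b - a) * r))"
  have \<rho>: "\<rho> > 0" "\<rho> \<le> 1 / 4" "4 * \<rho> * (b - a) * r \<le> \<alpha> / 2"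
  proof -
    show "\<rho> > 0"
      using \<alpha> ab r by (simp add: \<rho>_def)
    show "\<rho> \<le> 1 / 4"
      unfolding \<rho>_def by (rule min.cobounded1)
    have "\<rho> \<le> \<alpha> / (8 * (b - a) * r)"
      unfolding \<rho>_def by (rule min.cobounded2)
    then have "\<rho> * (8 * (b - a) * r) \<le> \<alpha>"
      using ab r by (subst (asm) pos_le_divide_eq) auto
    then show "4 * \<rho> * (b - a) * r \<le> \<alpha> / 2"
      by (simp add: algebra_simps)
  qed
  show ?thesis
  proof (rule that[OF \<rho>(1)])
    fix \<tau> assume \<tau>: "continuous_on {a..b} \<tau>" "\<And>x. x \<in> {a..b} \<Longrightarrow> norm (\<tau> x - t x) \<le> \<rho>"
    have \<tau>4: "norm (\<tau> x - t x) \<le> 1 / 4" if "x \<in> {a..b}" for x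
      using \<tau>(2)[OF that] \<rho>(2) by linarith
    have "G \<tau> c \<bullet> c > 0" if c: "norm c = r" for c
    proof -
      let ?d = "\<lambda>x. sgn (\<tau> x + ?\<phi> x *\<^sub>R c) - sgn (t x + ?\<phi> x *\<^sub>R c)"
      have c1: "continuous_on {a..b} (\<lambda>x. sgn (\<tau> x + ?\<phi> x *\<^sub>R c))"
        using nz c \<tau>4 by (intro continuous_on_sgn_perturbed \<tau>) auto
      have c2: "continuous_on {a..b} (\<lambda>x. sgn (t x + ?\<phi> x *\<^sub>R c))"
        using nz[of c _ t] c by (intro continuous_on_sgn_perturbed t) auto
      have "norm (?d x) \<le> 4 * \<rho>" if x: "x \<in> {a..b}" for x
      proof -
        have ge: "norm (t x + ?\<phi> x *\<^sub>R c) \<ge> 1 / 2"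
          using norm_perturbed_ge[OF x small, of c t] c by simp
        have "norm (?d x) \<le> 2 * norm (\<tau> x - t x) / norm (t x + ?\<phi> x *\<^sub>R c)"
          using norm_sgn_diff_le[of "t x + ?\<phi> x *\<^sub>R c" "\<tau> x + ?\<phi> x *\<^sub>R c"] nz[of c x t] c x by simp
        also have "\<dots> \<le> 2 * \<rho> / (1 / 2)"
          using ge \<tau>(2)[OF x] \<rho>(1) by (intro frac_le) auto
        finally show ?thesis
          by simp
      qed
      then have "norm (integral {a..b} ?d) \<le> 4 * \<rho> * (b - a)"
        using ab c1 c2 by (intro integral_bound continuous_on_diff) auto
      moreover have "integral {a..b} ?d = G \<tau> c - G t c"
        using c1 c2 by (simp add: G_def Henstock_Kurzweil_Integration.integral_diff integrable_continuous_interval)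
      ultimately have "norm (G \<tau> c - G t c) * norm c \<le> (4 * \<rho> * (b - a)) * r"
        using c r ab \<rho>(1) by (intro mult_mono) auto
      then have "\<bar>(G \<tau> c - G t c) \<bullet> c\<bar> \<le> \<alpha> / 2"
        using Cauchy_Schwarz_ineq2[of "G \<tau> c - G t c" c] \<rho>(3) by linarith
      moreover have "G t c \<bullet> c \<ge> \<alpha>"
        unfolding \<alpha>_def using c by (intro c0(2)) simp
      ultimately show ?thesis
        using \<alpha> unfolding inner_diff_left by linarith
    qed
    then obtain c where "norm c \<le> r" "G \<tau> c = 0"
      using zero_in_cball_if_outward[OF contG[OF \<tau>(1) \<tau>4] r(1)] by blast
    then show "\<exists>c. norm c \<le> \<delta> \<and> integral {a..b} (\<lambda>x. sgn (\<tau> x + ?\<phi> x *\<^sub>R c)) = integral {a..b} t"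
      using r(2) by (auto simp: G_def intro!: exI[of _ c])
  qed
qed

end

section \<open>Approximation of framed curves\<close>

lemma H1_conv_const:
  assumes "\<And>x. x \<in> {a..b} \<Longrightarrow> (f has_vector_derivative f' x) (at x within {a..b})" "continuous_on {a..b} f'"
  shows "H1_conv a b (\<lambda>n. f) (\<lambda>n. f') f f'"
  using assms by (auto simp: H1_conv_def in_L2_continuous L2_sq_def intro: uniform_limit_const)

lemma H1_conv_avoids_zero:
  assumes H: "H1_conv a b \<sigma> \<sigma>' u v" and unit: "\<And>x. x \<in> {a..b} \<Longrightarrow> norm (u x) = 1"
  obtains N where "\<And>n x. x \<in> {a..b} \<Longrightarrow> \<sigma> (n + N) x \<noteq> 0"
proof -
  obtain N where N: "\<forall>n\<ge>N. \<forall>x\<in>{a..b}. dist (\<sigma> n x) (u x) < 1"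
    using uniform_limitD[OF H1_convD(3)[OF H] zero_less_one] unfolding eventually_sequentially by blast
  \<comment> \<open>Zero has distance exactly 1 from a unit vector.\<close>
  have "\<sigma> (n + N) x \<noteq> 0" if "x \<in> {a..b}" for n x
    using N[rule_format, of "n + N" x] that unit[OF that] by auto
  then show ?thesis
    by (iprover intro: that)+
qed

text \<open>The tolerances \<open>\<rho> n\<close> are left free because the closeness required by
  the mean correction depends on how small a \<open>c\<close> is wanted at stage \<open>n\<close>.
  Capping them by \<open>inverse (real (Suc n))\<close> adds convergence.\<close>

lemma H1_approx_polynomial_sequence:
  fixes g v :: "real \<Rightarrow> 'a::euclidean_space"
  assumes v: "in_L2 a b v" and g: "\<And>x. x \<in> {a..b} \<Longrightarrow> g x = g a + integral {a..x} v" and ab: "a < b"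
    and \<rho>: "\<And>n. \<rho> n > 0"
  obtains \<tau> \<tau>' where "\<And>n. polynomial_function (\<tau> n)" "\<And>n. \<tau> n a = g a" "\<And>n. \<tau> n b = g b"
    "\<And>n x. x \<in> {a..b} \<Longrightarrow> norm (\<tau> n x - g x) \<le> \<rho> n" "H1_conv a b \<tau> \<tau>' g v"
proof -
  define \<delta> where "\<delta> n = min (\<rho> n) (inverse (real (Suc n)))" for n
  have \<delta>: "\<delta> n > 0" for n
    using \<rho> by (simp add: \<delta>_def)
  define P where "P n \<tau> \<tau>' \<longleftrightarrow> polynomial_function \<tau> \<and> polynomial_function \<tau>' \<and>
      (\<forall>x. (\<tau> has_vector_derivative \<tau>' x) (at x)) \<and> \<tau> a = g a \<and> \<tau> b = g b \<and>
      (\<forall>x\<in>{a..b}. norm (\<tau> x - g x) \<le> \<delta> n) \<and> L2_sq a b (\<lambda>x. \<tau>' x - v x) \<le> \<delta> n" for n \<tau> \<tau>'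
  have "\<exists>\<tau> \<tau>'. P n \<tau> \<tau>'" for n
  proof -
    obtain \<tau> \<tau>' where "polynomial_function \<tau>" "polynomial_function \<tau>'"
      "\<And>x. (\<tau> has_vector_derivative \<tau>' x) (at x)" "\<tau> a = g a" "\<tau> b = g b"
      "\<And>x. x \<in> {a..b} \<Longrightarrow> norm (\<tau> x - g x) \<le> \<delta> n" "L2_sq a b (\<lambda>x. \<tau>' x - v x) \<le> \<delta> n"
      by (rule H1_approx_by_polynomial[OF v g ab \<delta>[of n]]) (iprover intro: that)+
    then show ?thesis
      unfolding P_def by blast
  qed
  then obtain \<tau> \<tau>' where P: "\<And>n. P n (\<tau> n) (\<tau>' n)"
    by metis
  have \<tau>: "\<And>n. polynomial_function (\<tau> n)" "\<And>n. polynomial_function (\<tau>' n)"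
    "\<And>n x. (\<tau> n has_vector_derivative \<tau>' n x) (at x)" "\<And>n. \<tau> n a = g a" "\<And>n. \<tau> n b = g b"
    "\<And>n x. x \<in> {a..b} \<Longrightarrow> norm (\<tau> n x - g x) \<le> \<delta> n" "\<And>n. L2_sq a b (\<lambda>x. \<tau>' n x - v x) \<le> \<delta> n"
    using P unfolding P_def by blast+
  have \<delta>0: "\<delta> \<longlonglongrightarrow> 0"
  proof (rule Lim_null_comparison[OF _ LIMSEQ_inverse_real_of_nat])
    show "\<forall>\<^sub>F n in sequentially. norm (\<delta> n) \<le> inverse (real (Suc n))"
      using \<delta> by (intro always_eventually) (auto simp: \<delta>_def abs_of_pos)
  qed
  have "H1_conv a b \<tau> \<tau>' g v"
    unfolding H1_conv_def
  proof (intro conjI allI ballI v)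
    show "(\<tau> n has_vector_derivative \<tau>' n x) (at x within {a..b})" for n x
      using \<tau>(3) by (rule has_vector_derivative_at_within)
    show "continuous_on {a..b} (\<tau>' n)" for n
      using \<tau>(2) by (rule continuous_on_polymonial_function)
    show "uniform_limit {a..b} \<tau> g sequentially"
    proof (rule uniform_limitI)
      fix e :: real assume "e > 0"
      then have "\<forall>\<^sub>F n in sequentially. \<delta> n < e"
        by (rule order_tendstoD(2)[OF \<delta>0])
      then show "\<forall>\<^sub>F n in sequentially. \<forall>x\<in>{a..b}. dist (\<tau> n x) (g x) < e"
        by eventually_elim (metis \<tau>(6) dist_norm order_le_less_trans)
    qed
    show "(\<lambda>n. L2_sq a b (\<lambda>x. \<tau>' n x - v x)) \<longlonglongrightarrow> 0"
      using \<tau>(7) by (intro Lim_null_comparison[OF _ \<delta>0] always_eventually) (auto simp: L2_sq_nonneg)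
  qed
  moreover have "norm (\<tau> n x - g x) \<le> \<rho> n" if "x \<in> {a..b}" for n x
    using \<tau>(6)[OF that, of n] by (simp add: \<delta>_def)
  ultimately show ?thesis
    using that \<tau>(1,4,5) by blast
qed

text \<open>The perturbation \<open>(x - a) (b - x) c\<close> vanishes at both end points, so it corrects the mean without
  moving the boundary values.\<close>

lemma unit_curve_approx_sequence:
  fixes t w :: "real \<Rightarrow> 'a::euclidean_space"
  assumes w: "in_L2 a b w" and t: "\<And>x. x \<in> {a..b} \<Longrightarrow> t x = t a + integral {a..x} w"
    and weak: "has_weak_derivative a b t w"
    and ab: "a < b" and unit: "\<And>x. x \<in> {a..b} \<Longrightarrow> norm (t x) = 1"
  obtains \<sigma> \<sigma>' where "\<And>n. polynomial_function (\<sigma> n)" "\<And>n. \<sigma> n a = t a" "\<And>n. \<sigma> n b = t b"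
    "\<And>n. integral {a..b} (\<lambda>x. sgn (\<sigma> n x)) = integral {a..b} t" "H1_conv a b \<sigma> \<sigma>' t w"
    "\<And>n x. x \<in> {a..b} \<Longrightarrow> \<sigma> n x \<noteq> 0"
proof (cases "\<exists>k. \<forall>x\<in>{a..b}. t x = k")
  case True
  then obtain k where k: "\<And>x. x \<in> {a..b} \<Longrightarrow> t x = k"
    by blast
  \<comment> \<open>The constant curve is its own approximation; the limit derivative 0 is then
    exchanged for \<open>w\<close>, which equals it only a.e.\<close>
  have "H1_conv a b (\<lambda>n x. k) (\<lambda>n x. 0) (\<lambda>x. k) (\<lambda>x. 0)"
    by (intro H1_conv_const) auto
  then have "H1_conv a b (\<lambda>n x. k) (\<lambda>n x. 0) t (\<lambda>x. 0)"
    by (rule H1_conv_cong_limit) (simp add: k)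
  then have H: "H1_conv a b (\<lambda>n x. k) (\<lambda>n x. 0) t w"
    by (rule H1_conv_change_derivative[OF _ ab weak w])
  have "norm k = 1"
    using unit[of a] k[of a] ab by simp
  then have "sgn k = k" "k \<noteq> 0"
    by (auto simp: sgn_div_norm)
  moreover have "integral {a..b} (\<lambda>x. k) = integral {a..b} t"
    using k by (intro integral_cong) auto
  ultimately show ?thesis
    using ab k H by (intro that[of "\<lambda>n x. k"]) auto
next
  case False
  have "integrable (lebesgue_on {a<..<b}) w"
    by (rule in_L2_imp_integrable[OF w ab])
  then have "continuous_on {a..b} (\<lambda>x. t a + integral {a..x} w)"
    by (intro continuous_on_add continuous_on_const continuous_on_primitive)
  then have ct: "continuous_on {a..b} t"
    by (rule continuous_on_eq) (rule t[symmetric])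
  let ?\<phi> = "\<lambda>x. (x - a) * (b - x)"
  \<comment> \<open>\<open>P n \<rho>\<close> says that closeness \<open>\<rho>\<close> makes the
    mean correctable by a vector of length at most \<open>inverse (real (Suc n))\<close>, so that
    the corrections tend to 0.\<close>
  define P where "P n \<rho> \<longleftrightarrow> \<rho> > 0 \<and> (\<forall>\<tau>. continuous_on {a..b} \<tau> \<longrightarrow> (\<forall>x\<in>{a..b}. norm (\<tau> x - t x) \<le> \<rho>) \<longrightarrow>
    (\<exists>c. norm c \<le> inverse (real (Suc n)) \<and> integral {a..b} (\<lambda>x. sgn (\<tau> x + ?\<phi> x *\<^sub>R c)) = integral {a..b} t))" for n \<rho>
  have "\<exists>\<rho>. P n \<rho>" for n
  proof (rule integral_sgn_correction[OF ab ct unit False, of "inverse (real (Suc n))"])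
    fix \<rho> :: real
    assume "\<rho> > 0" and "\<And>\<tau>. continuous_on {a..b} \<tau> \<Longrightarrow> (\<And>x. x \<in> {a..b} \<Longrightarrow> norm (\<tau> x - t x) \<le> \<rho>) \<Longrightarrow>
      \<exists>c. norm c \<le> inverse (real (Suc n)) \<and> integral {a..b} (\<lambda>x. sgn (\<tau> x + ?\<phi> x *\<^sub>R c)) = integral {a..b} t"
    then have "P n \<rho>"
      by (simp add: P_def)
    then show "\<exists>\<rho>. P n \<rho>" ..
  qed simp_all
  then obtain \<rho> where \<rho>: "\<And>n. P n (\<rho> n)"
    by metis
  then have \<rho>0: "\<rho> n > 0" for n
    unfolding P_def by blast
  obtain \<tau> \<tau>' where \<tau>: "\<And>n. polynomial_function (\<tau> n)" "\<And>n. \<tau> n a = t a" "\<And>n. \<tau> n b = t b"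
    "\<And>n x. x \<in> {a..b} \<Longrightarrow> norm (\<tau> n x - t x) \<le> \<rho> n" and H\<tau>: "H1_conv a b \<tau> \<tau>' t w"
    by (rule H1_approx_polynomial_sequence[OF w t ab \<rho>0]) (iprover intro: that)+
  have "\<exists>c. norm c \<le> inverse (real (Suc n)) \<and> integral {a..b} (\<lambda>x. sgn (\<tau> n x + ?\<phi> x *\<^sub>R c)) = integral {a..b} t" for n
    using \<rho>[of n] \<tau>(4) continuous_on_polymonial_function[OF \<tau>(1)] unfolding P_def by blast
  then obtain c where c: "\<And>n. norm (c n) \<le> inverse (real (Suc n))"
    "\<And>n. integral {a..b} (\<lambda>x. sgn (\<tau> n x + ?\<phi> x *\<^sub>R c n)) = integral {a..b} t"
    by metis
  \<comment> \<open>The sign is turned because the sum will be obtained from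
    \<open>H1_conv_diff\<close>, by subtracting \<open>?\<phi> x *\<^sub>R (- c n)\<close>.\<close>
  have c0: "(\<lambda>n. - c n) \<longlonglongrightarrow> 0"
    using c(1) by (intro Lim_null_comparison[OF _ LIMSEQ_inverse_real_of_nat] always_eventually) auto
  have "H1_conv a b (\<lambda>n. ?\<phi>) (\<lambda>n x. a + b - 2 * x) ?\<phi> (\<lambda>x. a + b - 2 * x)"
    by (intro H1_conv_const continuous_intros) (auto intro!: derivative_eq_intros simp: algebra_simps
        simp flip: has_real_derivative_iff_has_vector_derivative)
  moreover have "H1_conv a b (\<lambda>n x. - c n) (\<lambda>n x. 0) (\<lambda>x. 0) (\<lambda>x. 0)"
    using c0 by (auto simp: H1_conv_def L2_sq_def in_L2_def uniform_limit_iff tendsto_iff eventually_sequentially)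
  ultimately have "H1_conv a b (\<lambda>n x. \<tau> n x - ?\<phi> x *\<^sub>R (- c n))
    (\<lambda>n x. \<tau>' n x - (?\<phi> x *\<^sub>R 0 + (a + b - 2 * x) *\<^sub>R (- c n)))
    (\<lambda>x. t x - ?\<phi> x *\<^sub>R 0) (\<lambda>x. w x - (?\<phi> x *\<^sub>R 0 + (a + b - 2 * x) *\<^sub>R 0))"
    by (intro H1_conv_diff H\<tau> H1_conv_bilinear[OF bounded_bilinear_scaleR])
  then obtain \<sigma>' where H: "H1_conv a b (\<lambda>n x. \<tau> n x + ?\<phi> x *\<^sub>R c n) \<sigma>' t w"
    by auto
  \<comment> \<open>Normalisation needs nonvanishing at every index, so finitely many initial terms
    are dropped.\<close>
  obtain N where N: "\<And>n x. x \<in> {a..b} \<Longrightarrow> \<tau> (n + N) x + ?\<phi> x *\<^sub>R c (n + N) \<noteq> 0"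
    by (rule H1_conv_avoids_zero[OF H unit]) (iprover intro: that)+
  show ?thesis
  proof (rule that[of "\<lambda>n x. \<tau> (n + N) x + ?\<phi> x *\<^sub>R c (n + N)" "\<lambda>n. \<sigma>' (n + N)"])
    have "real_polynomial_function ?\<phi>"
      by (intro real_polynomial_function.intros(4) real_polynomial_function_diff real_polynomial_function.intros(1,2)) auto
    then show "polynomial_function (\<lambda>x. \<tau> (n + N) x + ?\<phi> x *\<^sub>R c (n + N))" for n
      by (intro polynomial_function_add \<tau>(1) polynomial_function_mult polynomial_function_const)
        (simp add: real_polynomial_function_eq)
    show "H1_conv a b (\<lambda>n x. \<tau> (n + N) x + ?\<phi> x *\<^sub>R c (n + N)) (\<lambda>n. \<sigma>' (n + N)) t w"
      by (rule H1_conv_subseq[OF H]) (simp add: strict_mono_def)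
  qed (use \<tau> c N in auto)
qed

text \<open>Multiplying the Gram-Schmidt projection of \<open>\<beta>\<close> by \<open>\<sigma> \<bullet> \<sigma>\<close> keeps it polynomial and does not affect
  its direction.\<close>

lemma frame_approx:
  fixes t w u z :: "real \<Rightarrow> 'a::euclidean_space"
  assumes w: "in_L2 a b w" and t: "\<And>x. x \<in> {a..b} \<Longrightarrow> t x = t a + integral {a..x} w"
    and weakt: "has_weak_derivative a b t w"
    and z: "in_L2 a b z" and u: "\<And>x. x \<in> {a..b} \<Longrightarrow> u x = u a + integral {a..x} z"
    and weaku: "has_weak_derivative a b u z"
    and ab: "a < b"
    and frame: "\<And>x. x \<in> {a..b} \<Longrightarrow> norm (t x) = 1 \<and> norm (u x) = 1 \<and> t x \<bullet> u x = 0"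
  obtains T T' U U' where
    "H1_conv a b T T' t w" "H1_conv a b U U' u z"
    "\<And>n. smooth_on {a..b} (T n)" "\<And>n. smooth_on {a..b} (U n)"
    "\<And>n. T n a = t a" "\<And>n. T n b = t b" "\<And>n. U n a = u a" "\<And>n. U n b = u b"
    "\<And>n. integral {a..b} (T n) = integral {a..b} t"
    "\<And>n x. x \<in> {a..b} \<Longrightarrow> norm (T n x) = 1 \<and> norm (U n x) = 1 \<and> T n x \<bullet> U n x = 0"
proof -
  have unit: "norm (t x) = 1" "norm (u x) = 1" "t x \<bullet> u x = 0" if "x \<in> {a..b}" for x
    using frame[OF that] by auto
  obtain \<sigma> \<sigma>' where \<sigma>: "\<And>n. polynomial_function (\<sigma> n)" "\<And>n. \<sigma> n a = t a" "\<And>n. \<sigma> n b = t b"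
    "\<And>n. integral {a..b} (\<lambda>x. sgn (\<sigma> n x)) = integral {a..b} t" and H\<sigma>: "H1_conv a b \<sigma> \<sigma>' t w"
    and \<sigma>nz: "\<And>n x. x \<in> {a..b} \<Longrightarrow> \<sigma> n x \<noteq> 0"
    by (rule unit_curve_approx_sequence[OF w t weakt ab unit(1)]) (iprover intro: that)+
  obtain \<beta> \<beta>' where \<beta>: "\<And>n. polynomial_function (\<beta> n)" "\<And>n. \<beta> n a = u a" "\<And>n. \<beta> n b = u b"
    "\<And>n x. x \<in> {a..b} \<Longrightarrow> norm (\<beta> n x - u x) \<le> 1" and H\<beta>: "H1_conv a b \<beta> \<beta>' u z"
    by (rule H1_approx_polynomial_sequence[OF z u ab zero_less_one]) (iprover intro: that)+
  define W where "W n x = (\<sigma> n x \<bullet> \<sigma> n x) *\<^sub>R \<beta> n x - (\<beta> n x \<bullet> \<sigma> n x) *\<^sub>R \<sigma> n x" for n x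
  have W: "\<exists>W' v. H1_conv a b W W' (\<lambda>x. (t x \<bullet> t x) *\<^sub>R u x - (u x \<bullet> t x) *\<^sub>R t x) v"
    unfolding W_def
    using H1_conv_diff[OF H1_conv_bilinear[OF bounded_bilinear_scaleR
            H1_conv_bilinear[OF bounded_bilinear_inner H\<sigma> H\<sigma>] H\<beta>]
          H1_conv_bilinear[OF bounded_bilinear_scaleR
            H1_conv_bilinear[OF bounded_bilinear_inner H\<beta> H\<sigma>] H\<sigma>]] by blast
  \<comment> \<open>In the limit the Gram-Schmidt expression is \<open>u\<close> itself, since
    \<open>t\<close> is a unit vector orthogonal to \<open>u\<close>.\<close>
  have "(t x \<bullet> t x) *\<^sub>R u x - (u x \<bullet> t x) *\<^sub>R t x = u x" if "x \<in> {a..b}" for x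
    using unit[OF that] by (simp add: inner_commute dot_square_norm)
  then obtain W' v where HW: "H1_conv a b W W' u v"
    using W H1_conv_cong_limit by blast
  obtain N where N: "\<And>n x. x \<in> {a..b} \<Longrightarrow> W (n + N) x \<noteq> 0"
    by (rule H1_conv_avoids_zero[OF HW unit(2)]) (iprover intro: that)+
  have shift: "strict_mono (\<lambda>n. n + N)"
    by (simp add: strict_mono_def)
  obtain T' v1 where T': "H1_conv a b (\<lambda>n x. sgn (\<sigma> (n + N) x)) T' t v1"
    by (rule H1_conv_sgn[OF H1_conv_subseq[OF H\<sigma> shift] unit(1) \<sigma>nz]) (iprover intro: that)+
  obtain U' v2 where U': "H1_conv a b (\<lambda>n x. sgn (W (n + N) x)) U' u v2"
    by (rule H1_conv_sgn[OF H1_conv_subseq[OF HW shift] unit(2) N]) (iprover intro: that)+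
  have polyW: "polynomial_function (W n)" for n
    unfolding W_def using \<sigma>(1) \<beta>(1) real_polynomial_function_inner
    by (intro polynomial_function_diff polynomial_function_mult) (auto simp flip: real_polynomial_function_eq)
  \<comment> \<open>At the end points \<open>\<sigma>\<close> and \<open>\<beta>\<close> already
    form the orthonormal pair, which Gram-Schmidt and normalisation leave fixed.\<close>
  have ends: "sgn (t x) = t x" "sgn (u x) = u x" "t x \<bullet> t x = 1" "u x \<bullet> t x = 0" if "x \<in> {a..b}" for x
    using unit[OF that] by (simp_all add: sgn_div_norm dot_square_norm inner_commute)
  have "a \<in> {a..b}" "b \<in> {a..b}"
    using ab by auto
  note e = ends[OF this(1)] ends[OF this(2)]
  show ?thesis
  proof (rule that[of "\<lambda>n x. sgn (\<sigma> (n + N) x)" T' "\<lambda>n x. sgn (W (n + N) x)" U'])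
    show "smooth_on {a..b} (\<lambda>x. sgn (\<sigma> (n + N) x))" "smooth_on {a..b} (\<lambda>x. sgn (W (n + N) x))" for n
      using \<sigma>nz N by (intro smooth_on_sgn_polynomial \<sigma>(1) polyW; blast)+
    show "H1_conv a b (\<lambda>n x. sgn (\<sigma> (n + N) x)) T' t w"
      by (rule H1_conv_change_derivative[OF T' ab weakt w])
    show "H1_conv a b (\<lambda>n x. sgn (W (n + N) x)) U' u z"
      by (rule H1_conv_change_derivative[OF U' ab weaku z])
    show "sgn (\<sigma> (n + N) a) = t a" "sgn (\<sigma> (n + N) b) = t b" for n
      by (simp_all add: \<sigma> e)
    show "sgn (W (n + N) a) = u a" "sgn (W (n + N) b) = u b" for n
      by (simp_all add: W_def \<sigma> \<beta> e)
    show "integral {a..b} (\<lambda>x. sgn (\<sigma> (n + N) x)) = integral {a..b} t" for n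
      by (rule \<sigma>(4))
    show "norm (sgn (\<sigma> (n + N) x)) = 1 \<and> norm (sgn (W (n + N) x)) = 1 \<and> sgn (\<sigma> (n + N) x) \<bullet> sgn (W (n + N) x) = 0"
      if x: "x \<in> {a..b}" for n x
    proof -
      \<comment> \<open>The two terms of \<open>W\<close> contribute
        \<open>(\<sigma> \<bullet> \<sigma>) * (\<beta> \<bullet> \<sigma>)\<close> with opposite
        signs.\<close>
      have "\<sigma> m x \<bullet> W m x = 0" for m
        by (simp add: W_def inner_diff_right inner_commute)
      then show ?thesis
        using \<sigma>nz[OF x] N[OF x] by (simp add: norm_sgn) (simp add: sgn_div_norm)
    qed
  qed
qed

lemma weak_derivative_const_add_primitive:
  fixes v :: "real \<Rightarrow> 'a::euclidean_space"
  assumes v: "continuous_on {a..b} v" and ab: "a < b"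
  shows "has_weak_derivative a b (\<lambda>x. k + integral {a..x} v) v"
    and "x \<in> {a..b} \<Longrightarrow> ((\<lambda>x. k + integral {a..x} v) has_vector_derivative v x) (at x within {a..b})"
proof -
  show *: "((\<lambda>x. k + integral {a..x} v) has_vector_derivative v x) (at x within {a..b})" if "x \<in> {a..b}" for x
    using integral_has_vector_derivative[OF v that] by (auto intro!: derivative_eq_intros)
  show "has_weak_derivative a b (\<lambda>x. k + integral {a..x} v) v"
    using * v ab by (rule has_weak_derivative_C1)
qed

section \<open>Boundary values, smoothness and norms of the approximating framed curve\<close>

theorem lemma3p1:
  fixes L :: real
    and Lbc :: "(real \<Rightarrow> real^3) \<Rightarrow> (real \<Rightarrow> real^3) \<Rightarrow> 'v::real_vector"
    and l :: 'v
    and y b :: "real \<Rightarrow> real^3"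
    and \<epsilon> :: real
  assumes "L > 0"
    and "\<exists>B :: 'v set. finite B \<and> span B = UNIV"
    and "boundary_operator L Lbc"
    and "admissible_curves L Lbc l \<noteq> {}"
    and "(y, b) \<in> admissible_curves L Lbc l"
    and "\<epsilon> > 0"
  shows "\<exists>y\<^sub>\<epsilon> b\<^sub>\<epsilon>. (y\<^sub>\<epsilon>, b\<^sub>\<epsilon>) \<in> admissible_curves L Lbc l \<and>
           smooth_on {0..L} y\<^sub>\<epsilon> \<and> smooth_on {0..L} b\<^sub>\<epsilon> \<and>
           H2_norm 0 L (\<lambda>t. y\<^sub>\<epsilon> t - y t) \<le> \<epsilon> \<and>
           H1_norm 0 L (\<lambda>t. b\<^sub>\<epsilon> t - b t) \<le> \<epsilon>"
proof -
  note L = \<open>L > 0\<close>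
  have adm: "in_H2 0 L y" "in_H1 0 L b" "Lbc y b = l"
    "\<And>x. x \<in> {0..L} \<Longrightarrow> norm (cont_rep 0 L (weak_deriv 0 L y) x) = 1 \<and> norm (cont_rep 0 L b x) = 1 \<and>
       cont_rep 0 L (weak_deriv 0 L y) x \<bullet> cont_rep 0 L b x = 0"
    using assms(5) by (auto simp: admissible_curves_def)
  obtain v w where y: "in_L2 0 L y" "has_weak_derivative 0 L y v" "in_L2 0 L v"
      "has_weak_derivative 0 L v w" "in_L2 0 L w"
    using adm(1) by (auto simp: in_H2_def)
  obtain z where b: "in_L2 0 L b" "has_weak_derivative 0 L b z" "in_L2 0 L z"
    using adm(2) by (auto simp: in_H1_def)
  obtain Y where Y: "continuous_on {0..L} Y" "AE x in lebesgue_on {0<..<L}. Y x = y x"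
      "\<And>x. x \<in> {0..L} \<Longrightarrow> Y x = Y 0 + integral {0..x} v"
    by (rule weak_derivative_imp_primitive[OF y(2,3) L]) (iprover intro: that)+
  obtain t where t: "continuous_on {0..L} t" "AE x in lebesgue_on {0<..<L}. t x = v x"
      "\<And>x. x \<in> {0..L} \<Longrightarrow> t x = t 0 + integral {0..x} w"
    by (rule weak_derivative_imp_primitive[OF y(4,5) L]) (iprover intro: that)+
  obtain u where u: "continuous_on {0..L} u" "AE x in lebesgue_on {0<..<L}. u x = b x"
      "\<And>x. x \<in> {0..L} \<Longrightarrow> u x = u 0 + integral {0..x} z"
    by (rule weak_derivative_imp_primitive[OF b(2,3) L]) (iprover intro: that)+
  have "AE x in lebesgue_on {0<..<L}. t x = weak_deriv 0 L y x"
    using t(2) weak_deriv_AE[OF y(2) L] by eventually_elim simp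
  then have rep: "cont_rep 0 L y x = Y x" "cont_rep 0 L (weak_deriv 0 L y) x = t x" "cont_rep 0 L b x = u x"
    if "x \<in> {0..L}" for x
    using cont_rep_eq[OF Y(1,2) L that] cont_rep_eq[OF t(1) _ L that] cont_rep_eq[OF u(1,2) L that] by auto
  have frame: "norm (t x) = 1 \<and> norm (u x) = 1 \<and> t x \<bullet> u x = 0" if "x \<in> {0..L}" for x
    using adm(4)[OF that] rep[OF that] by simp
  have Yt: "Y x = Y 0 + integral {0..x} t" if x: "x \<in> {0..L}" for x
  proof -
    obtain N where N: "negligible N" "\<And>x. x \<in> {0<..<L} - N \<Longrightarrow> t x = v x"
      using t(2) by (auto simp: AE_lebesgue_on_iff_negligible)
    \<comment> \<open>The exceptional set is controlled only inside the open interval, so the end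
      points are added to it.\<close>
    have "negligible (insert 0 (insert L N))"
      using N(1) by simp
    then have "integral {0..x} v = integral {0..x} t"
      by (rule integral_spike) (use N(2) x in auto)
    then show ?thesis
      using Y(3)[OF x] by simp
  qed
  obtain T T' U U' where HT: "H1_conv 0 L T T' t w" and HU: "H1_conv 0 L U U' u z"
    and smooth: "\<And>n. smooth_on {0..L} (T n)" "\<And>n. smooth_on {0..L} (U n)"
    and ends: "\<And>n. T n 0 = t 0" "\<And>n. T n L = t L" "\<And>n. U n 0 = u 0" "\<And>n. U n L = u L"
    and mean: "\<And>n. integral {0..L} (T n) = integral {0..L} t"
    and frames: "\<And>n x. x \<in> {0..L} \<Longrightarrow> norm (T n x) = 1 \<and> norm (U n x) = 1 \<and> T n x \<bullet> U n x = 0"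
    by (rule frame_approx[OF y(5) t(3) has_weak_derivative_cong_AE[OF y(4) t(2) L]
          b(3) u(3) has_weak_derivative_cong_AE[OF b(2) u(2) L] L frame]; (assumption | rule that)+)
  \<comment> \<open>Starting at \<open>Y 0\<close> matches the left end, and the equal means of
    \<open>T n\<close> and \<open>t\<close> match the right end.\<close>
  define Z where "Z n x = Y 0 + integral {0..x} (T n)" for n x
  note cT = H1_conv_continuous[OF HT] and cU = H1_conv_continuous[OF HU]
  have weakZ: "has_weak_derivative 0 L (Z n) (T n)" for n
    unfolding Z_def by (rule weak_derivative_const_add_primitive[OF cT(1) L])
  have derZ: "(Z n has_vector_derivative T n x) (at x within {0..L})" if "x \<in> {0..L}" for n x
    unfolding Z_def using that by (rule weak_derivative_const_add_primitive[OF cT(1) L])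
  have cZ: "continuous_on {0..L} (Z n)" for n
    using derZ by (rule continuous_on_vector_derivative)
  have weakT: "has_weak_derivative 0 L (T n) (T' n)" for n
    by (intro has_weak_derivative_C1 H1_convD(1,2)[OF HT] L)
  have weakU: "has_weak_derivative 0 L (U n) (U' n)" for n
    by (intro has_weak_derivative_C1 H1_convD(1,2)[OF HU] L)
  have L2: "in_L2 0 L (Z n)" "in_L2 0 L (T n)" "in_L2 0 L (T' n)" "in_L2 0 L (U n)" "in_L2 0 L (U' n)" for n
    using cZ cT cU H1_convD(2)[OF HT] H1_convD(2)[OF HU] by (auto intro: in_L2_continuous)
  have "(Z n, U n) \<in> admissible_curves L Lbc l" for n
  proof -
    have H2: "in_H2 0 L (Z n)"
      unfolding in_H2_def using L2 weakZ weakT by blast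
    have H1: "in_H1 0 L (U n)"
      unfolding in_H1_def using L2 weakU by blast
    have ae: "AE x in lebesgue_on {0<..<L}. T n x = weak_deriv 0 L (Z n) x"
      using weak_deriv_AE[OF weakZ L, of n] by (rule eventually_mono) simp
    have repn: "cont_rep 0 L (Z n) x = Z n x" "cont_rep 0 L (weak_deriv 0 L (Z n)) x = T n x"
      "cont_rep 0 L (U n) x = U n x" if "x \<in> {0..L}" for x
      using cont_rep_eq[OF cZ _ L that, of n "Z n"] cont_rep_eq[OF cT(1) ae L that]
        cont_rep_eq[OF cU(1) _ L that, of n "U n"] by auto
    obtain \<Lambda> where \<Lambda>: "\<And>y b. in_H2 0 L y \<Longrightarrow> in_H1 0 L b \<Longrightarrow>
         Lbc y b = \<Lambda> (cont_rep 0 L y 0, cont_rep 0 L y L,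
                       cont_rep 0 L (weak_deriv 0 L y) 0, cont_rep 0 L (weak_deriv 0 L y) L,
                       cont_rep 0 L b 0, cont_rep 0 L b L)"
      using assms(3) unfolding boundary_operator_def by blast
    have in0L: "0 \<in> {0..L}" "L \<in> {0..L}"
      using L by auto
    have "Z n 0 = Y 0" "Z n L = Y L"
      using Yt[OF in0L(2)] mean[of n] by (auto simp: Z_def)
    \<comment> \<open>The operator sees a pair only through six boundary values, and the two pairs
      share all of them.\<close>
    then have "Lbc (Z n) (U n) = Lbc y b"
      unfolding \<Lambda>[OF H2 H1] \<Lambda>[OF adm(1,2)]
      by (simp only: rep[OF in0L(1)] rep[OF in0L(2)] repn[OF in0L(1)] repn[OF in0L(2)] ends)
    then show ?thesis
      using H2 H1 adm(3) frames repn by (simp add: admissible_curves_def)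
  qed
  moreover have "smooth_on {0..L} (Z n)" for n
    by (rule smooth_on_antiderivative[OF smooth(1) derZ])
  moreover have "\<forall>\<^sub>F n in sequentially. H2_norm 0 L (\<lambda>x. Z n x - y x) < \<epsilon>"
  proof -
    \<comment> \<open>The chosen weak derivatives become explicit ones, and \<open>y\<close> and
      \<open>v\<close> give way to their continuous representatives, to which uniform convergence
      applies.\<close>
    have H2n: "H2_norm 0 L (\<lambda>x. Z n x - y x) = sqrt (L2_sq 0 L (\<lambda>x. Z n x - Y x) + L2_sq 0 L (\<lambda>x. T n x - t x)
        + L2_sq 0 L (\<lambda>x. T' n x - w x))" for n
    proof -
      have "AE x in lebesgue_on {0<..<L}. Z n x - y x = Z n x - Y x"
        using Y(2) by (rule eventually_mono) simp
      then have "L2_sq 0 L (\<lambda>x. Z n x - y x) = L2_sq 0 L (\<lambda>x. Z n x - Y x)"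
        by (intro AE_L2_cong in_L2_continuous continuous_on_diff cZ Y(1))
      moreover have "AE x in lebesgue_on {0<..<L}. T n x - v x = T n x - t x"
        using t(2) by (rule eventually_mono) simp
      then have "L2_sq 0 L (\<lambda>x. T n x - v x) = L2_sq 0 L (\<lambda>x. T n x - t x)"
        by (intro AE_L2_cong in_L2_continuous continuous_on_diff cT)
      moreover have "H2_norm 0 L (\<lambda>x. Z n x - y x) = sqrt (L2_sq 0 L (\<lambda>x. Z n x - y x) + L2_sq 0 L (\<lambda>x. T n x - v x)
        + L2_sq 0 L (\<lambda>x. T' n x - w x))"
        by (intro H2_norm_eq has_weak_derivative_diff in_L2_diff weakZ weakT y L2 L)
      ultimately show ?thesis
        by simp
    qed
    have limT: "(\<lambda>n. L2_sq 0 L (\<lambda>x. T n x - t x)) \<longlonglongrightarrow> 0"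
      by (intro L2_sq_uniform_limit H1_convD(3)[OF HT] L cT)
    \<comment> \<open>Primitives inherit convergence: one factor \<open>L\<close> comes from
      Cauchy-Schwarz in the pointwise bound, the other from the length of the interval.\<close>
    have limZ: "(\<lambda>n. L2_sq 0 L (\<lambda>x. Z n x - Y x)) \<longlonglongrightarrow> 0"
    proof (rule Lim_null_comparison)
      show "(\<lambda>n. L * L2_sq 0 L (\<lambda>x. T n x - t x) * L) \<longlonglongrightarrow> 0"
        using tendsto_mult_right[OF tendsto_mult_left[OF limT, of L], of L] by simp
      have "L2_sq 0 L (\<lambda>x. Z n x - Y x) \<le> (sqrt ((L - 0) * L2_sq 0 L (\<lambda>x. T n x - t x)))\<^sup>2 * (L - 0)" for n
      proof (rule L2_sq_le_const)
        show "in_L2 0 L (\<lambda>x. Z n x - Y x)"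
          by (intro in_L2_continuous continuous_on_diff cZ Y(1))
        show "norm (Z n x - Y x) \<le> sqrt ((L - 0) * L2_sq 0 L (\<lambda>x. T n x - t x))" if "x \<in> {0<..<L}" for x
          using norm_primitive_diff_le[OF L2(2) in_L2_continuous[OF t(1)] L, of x n] Yt[of x] that
          by (simp add: Z_def)
      qed (use L in simp)
      then show "\<forall>\<^sub>F n in sequentially. norm (L2_sq 0 L (\<lambda>x. Z n x - Y x)) \<le> L * L2_sq 0 L (\<lambda>x. T n x - t x) * L"
        using L by (simp add: L2_sq_nonneg)
    qed
    have "(\<lambda>n. H2_norm 0 L (\<lambda>x. Z n x - y x)) \<longlonglongrightarrow> sqrt (0 + 0 + 0)"
      unfolding H2n by (intro tendsto_real_sqrt tendsto_add limZ limT H1_convD(5)[OF HT])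
    then show ?thesis
      using order_tendstoD(2)[of _ "sqrt (0 + 0 + 0)" sequentially \<epsilon>] \<open>\<epsilon> > 0\<close> by simp
  qed
  moreover have "\<forall>\<^sub>F n in sequentially. H1_norm 0 L (\<lambda>x. U n x - b x) < \<epsilon>"
  proof -
    have H1n: "H1_norm 0 L (\<lambda>x. U n x - b x) = sqrt (L2_sq 0 L (\<lambda>x. U n x - u x) + L2_sq 0 L (\<lambda>x. U' n x - z x))" for n
    proof -
      have "AE x in lebesgue_on {0<..<L}. U n x - b x = U n x - u x"
        using u(2) by (rule eventually_mono) simp
      then have "L2_sq 0 L (\<lambda>x. U n x - b x) = L2_sq 0 L (\<lambda>x. U n x - u x)"
        by (intro AE_L2_cong in_L2_continuous continuous_on_diff cU)
      moreover have "H1_norm 0 L (\<lambda>x. U n x - b x) = sqrt (L2_sq 0 L (\<lambda>x. U n x - b x) + L2_sq 0 L (\<lambda>x. U' n x - z x))"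
        by (intro H1_norm_eq has_weak_derivative_diff in_L2_diff weakU b L2 L)
      ultimately show ?thesis
        by simp
    qed
    have "(\<lambda>n. H1_norm 0 L (\<lambda>x. U n x - b x)) \<longlonglongrightarrow> sqrt (0 + 0)"
      unfolding H1n
      by (intro tendsto_real_sqrt tendsto_add L2_sq_uniform_limit H1_convD(3,5)[OF HU] L cU)
    then show ?thesis
      using order_tendstoD(2)[of _ "sqrt (0 + 0)" sequentially \<epsilon>] \<open>\<epsilon> > 0\<close> by simp
  qed
  ultimately obtain n where "(Z n, U n) \<in> admissible_curves L Lbc l" "smooth_on {0..L} (Z n)"
    "H2_norm 0 L (\<lambda>x. Z n x - y x) < \<epsilon>" "H1_norm 0 L (\<lambda>x. U n x - b x) < \<epsilon>"
    using eventually_happens'[OF sequentially_bot eventually_conj] by blast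
  then show ?thesis
    using smooth(2)[of n] by (intro exI[of _ "Z n"] exI[of _ "U n"]) simp
qed

end
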